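(* Let $r\geqslant 1$, and let $\xi_1,\dots,\xi_r,\gamma_1,\dots,\gamma_r\in\mathbb{C}$ with $|\xi_j|=1$ and $\Re\gamma_j>0$ for $1\leqslant j\leqslant r$. For $(s_1,\dots,s_r)\in\mathbb{C}^r$ in the region of absolute convergence define $$\zeta_r((s_j);(\xi_j);(\gamma_j))=\sum_{m_1=1}^\infty\cdots\sum_{m_r=1}^\infty\prod_{j=1}^r \xi_j^{m_j}(m_1\gamma_1+\cdots+m_j\gamma_j)^{-s_j}.$$ Then $\zeta_r((s_j);(\xi_j);(\gamma_j))$ can be continued meromorphically to the whole space $\mathbb{C}^r$. Moreover: (i) If $\xi_j\neq 1$ for all $1\leqslant j\leqslant r$, then $\zeta_r((s_j);(\xi_j);(\gamma_j))$ is entire. (ii) If $\xi_j\neq 1$ for all $1\leqslant j\leqslant r-1$ and $\xi_r=1$, then $\zeta_r((s_j);(\xi_j);(\gamma_j))$ has a unique simple singular hyperplane, namely $s_r=1$. (iii) If $\xi_j=1$ for some $1\leqslant j\leqslant r-1$, then $\zeta_r((s_j);(\xi_j);(\gamma_j))$ has infinitely many simple singular hyperplanes.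
   Context: Powers $(m_1\gamma_1+\cdots+m_j\gamma_j)^{-s_j}$ are taken with the principal branch of the logarithm. *)

theory Defs
  imports "HOL-Analysis.Analysis"
begin

text \<open>
  The space of \<open>r\<close>-tuples of complex numbers is \<open>complex ^ 'n\<close> for a linearly ordered finite index
  type \<open>'n\<close> with \<open>CARD('n) = r \<ge> 1\<close>. Its elements are listed in increasing order as the indices
  \<open>1, \<dots>, r\<close>.
\<close>

definition last_index :: "'n::{finite,linorder}" where
  "last_index = Max UNIV"

subsection \<open>Holomorphic and meromorphic functions of several complex variables\<close>

text \<open>The Frechet derivative of the library is only real linear, hence the last conjunct.\<close>

definition holo_on :: "(complex ^ 'n \<Rightarrow> complex) \<Rightarrow> (complex ^ 'n) set \<Rightarrow> bool" where
  "holo_on f U \<longleftrightarrow>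
     (\<forall>z\<in>U. \<exists>D. (f has_derivative D) (at z within U) \<and> (\<forall>c v. D (c *s v) = c * D v))"

text \<open>
  Locally a quotient of holomorphic functions whose denominator does not vanish identically.
  As for \<open>meromorphic_on\<close> in one variable, the values of the total function \<open>F\<close> on a thin set
  (where every admissible denominator vanishes) are irrelevant.
\<close>

definition mero_on :: "(complex ^ 'n \<Rightarrow> complex) \<Rightarrow> (complex ^ 'n) set \<Rightarrow> bool" where
  "mero_on F S \<longleftrightarrow>
     (\<forall>p\<in>S. \<exists>U g h. open U \<and> connected U \<and> p \<in> U \<and> U \<subseteq> S \<and> holo_on g U \<and> holo_on h U \<and>
        (\<exists>z\<in>U. h z \<noteq> 0) \<and> (\<forall>z\<in>U. h z \<noteq> 0 \<longrightarrow> F z = g z / h z))"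

text \<open>
  The points near which a meromorphic function has no holomorphic representative. Agreement is
  asked on a dense subset only, so that removable singularities and arbitrary values of \<open>F\<close> on a
  thin set do not count as singular.
\<close>

definition singular_set :: "(complex ^ 'n \<Rightarrow> complex) \<Rightarrow> (complex ^ 'n) set" where
  "singular_set F =
     {p. \<not> (\<exists>U g. open U \<and> p \<in> U \<and> holo_on g U \<and> U \<subseteq> closure {z \<in> U. F z = g z})}"

text \<open>
  A complex affine hyperplane consisting of singular points of \<open>F\<close> and along which the pole has
  order one, that is, multiplication by a defining linear equation removes the singularity at
  generic points of the hyperplane.
\<close>

definition simple_singular_hyperplane ::
    "(complex ^ 'n \<Rightarrow> complex) \<Rightarrow> (complex ^ 'n) set \<Rightarrow> bool" where
  "simple_singular_hyperplane F H \<longleftrightarrow>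
     (\<exists>a c. a \<noteq> 0 \<and> H = {s. (\<Sum>j\<in>UNIV. a $ j * s $ j) = c} \<and> H \<subseteq> singular_set F \<and>
        H \<subseteq> closure (H - singular_set (\<lambda>s. ((\<Sum>j\<in>UNIV. a $ j * s $ j) - c) * F s)))"

subsection \<open>The multiple zeta-function\<close>

definition pos_tuples :: "('n \<Rightarrow> nat) set" where
  "pos_tuples = {m. \<forall>j. m j \<ge> 1}"

definition mzeta_term ::
    "(complex, 'n::{finite,linorder}) vec \<Rightarrow> (complex, 'n) vec \<Rightarrow> (complex, 'n) vec \<Rightarrow>
     ('n \<Rightarrow> nat) \<Rightarrow> complex" where
  "mzeta_term \<xi> \<gamma> s m =
     (\<Prod>j\<in>UNIV. \<xi> $ j ^ m j * (\<Sum>i\<in>{..j}. of_nat (m i) * \<gamma> $ i) powr (- (s $ j)))"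

definition abs_conv_region ::
    "(complex, 'n::{finite,linorder}) vec \<Rightarrow> (complex, 'n) vec \<Rightarrow> (complex, 'n) vec set" where
  "abs_conv_region \<xi> \<gamma> = {s. (\<lambda>m. norm (mzeta_term \<xi> \<gamma> s m)) summable_on pos_tuples}"

text \<open>
  Only used on \<^const>\<open>abs_conv_region\<close>, where the unordered sum is the iterated sum.
\<close>

definition mzeta ::
    "(complex, 'n::{finite,linorder}) vec \<Rightarrow> (complex, 'n) vec \<Rightarrow> (complex, 'n) vec \<Rightarrow> complex" where
  "mzeta \<xi> \<gamma> s = (\<Sum>\<^sub>\<infinity>m\<in>pos_tuples. mzeta_term \<xi> \<gamma> s m)"

end

theory Submission
  imports Defs "HOL-Complex_Analysis.Complex_Analysis"
begin

text \<open>
  The sum is evaluated from the last variable to the first. Suppose that the sum over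
  \<open>m\<^sub>j\<^sub>+\<^sub>1, \<dots>, m\<^sub>r\<close>, as a function of \<open>X = m\<^sub>1 \<gamma>\<^sub>1 + \<dots> + m\<^sub>j \<gamma>\<^sub>j\<close>, has a finite expansion in
  powers \<open>X powr (- u - k)\<close> up to a remainder decaying in a sector. To sum over \<open>m\<^sub>j\<close> one only needs
  the expansion of the Lerch function \<open>\<Sum>m\<ge>1. \<xi> ^ m * (X + m * \<gamma>) powr (- w)\<close>, which follows from the
  difference equation in \<open>X\<close> that it satisfies. Its only pole is at \<open>w = 1\<close>, and only if \<open>\<xi> = 1\<close>. Hence
  the poles lie on hyperplanes \<open>s\<^sub>j + \<dots> + s\<^sub>r = n\<close> with \<open>\<xi>\<^sub>j = 1\<close>, and on every tube domain the
  continuation is a quotient with a product of linear forms as denominator; these quotients agree by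
  the identity theorem along complex lines.

  A hyperplane is singular because the numerator is nonzero at one of its points. Putting \<open>s\<^sub>i = 0\<close>
  if \<open>\<xi>\<^sub>i \<noteq> 1\<close> and \<open>s\<^sub>i = 1\<close> if \<open>\<xi>\<^sub>i = 1\<close> turns every expansion into a nonzero constant; for the
  infinitely many hyperplanes one changes \<open>s\<^sub>j\<close> and \<open>s\<^sub>j\<^sub>+\<^sub>1\<close> so that the coefficient number \<open>k\<close> of a Lerch
  expansion appears, and infinitely many of these coefficients are nonzero.
\<close>

subsection \<open>Holomorphic functions of several variables\<close>

text \<open>Each summation costs one order: an expansion of order \<open>N + 1\<close> of the inner
  sum gives only order \<open>N\<close> for the next one, so the inner expansions must be longer.
  Poles may not appear inside the induction, because a remainder has to be summed again: after
  multiplication by \<open>den\<close> the coefficients are entire, and the remainder is holomorphic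
  on a tube domain with a bound continuous in \<open>s\<close>. A factor of \<open>den\<close> alone
  does not prove that its hyperplane is singular. Nonvanishing of the numerator at one point does: a
  regular point would force zeros of the numerator on the hyperplane nearby, and the identity
  theorem on a line inside the hyperplane carries them to the chosen point. The chosen points work
  because at exponent \<open>0\<close> the difference equation is solved exactly by a constant.
  Finally, the region of absolute convergence is given by summability alone; the explicit
  inequalities \<open>convdom\<close>, on which the iterated sums are expanded, have to be derived
  from it by lower bounds.\<close>

lemma holo_on_const: "holo_on (\<lambda>s. c) U"
  unfolding holo_on_def by (intro ballI exI[of _ "\<lambda>_. 0"]) auto

lemma holo_on_nth: "holo_on (\<lambda>s. s $ j) U"
  unfolding holo_on_def
  by (intro ballI exI[of _ "\<lambda>s. s $ j"])
     (auto intro: bounded_linear.has_derivative bounded_linear_vec_nth bounded_linear_imp_has_derivative)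

lemma holo_on_add:
  assumes "holo_on f U" "holo_on g U" shows "holo_on (\<lambda>s. f s + g s) U"
  unfolding holo_on_def
proof
  fix z assume "z \<in> U"
  then obtain D E where D: "(f has_derivative D) (at z within U)" "\<And>c v. D (c *s v) = c * D v"
    and E: "(g has_derivative E) (at z within U)" "\<And>c v. E (c *s v) = c * E v"
    using assms unfolding holo_on_def by metis
  show "\<exists>D. ((\<lambda>s. f s + g s) has_derivative D) (at z within U) \<and> (\<forall>c v. D (c *s v) = c * D v)"
    by (intro exI[of _ "\<lambda>h. D h + E h"] conjI has_derivative_add D E) (auto simp: D E algebra_simps)
qed

lemma holo_on_mult:
  assumes "holo_on f U" "holo_on g U" shows "holo_on (\<lambda>s. f s * g s) U"
  unfolding holo_on_def
proof
  fix z assume "z \<in> U"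
  then obtain D E where D: "(f has_derivative D) (at z within U)" "\<And>c v. D (c *s v) = c * D v"
    and E: "(g has_derivative E) (at z within U)" "\<And>c v. E (c *s v) = c * E v"
    using assms unfolding holo_on_def by metis
  show "\<exists>D. ((\<lambda>s. f s * g s) has_derivative D) (at z within U) \<and> (\<forall>c v. D (c *s v) = c * D v)"
    by (intro exI[of _ "\<lambda>h. f z * E h + D h * g z"] conjI has_derivative_mult D E)
       (auto simp: D E algebra_simps)
qed

lemma holo_on_compose:
  assumes "holo_on f U" "\<And>s. s \<in> U \<Longrightarrow> g field_differentiable (at (f s))"
  shows "holo_on (\<lambda>s. g (f s)) U"
  unfolding holo_on_def
proof
  fix z assume z: "z \<in> U"
  then obtain D where D: "(f has_derivative D) (at z within U)" "\<And>c v. D (c *s v) = c * D v"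
    using assms unfolding holo_on_def by metis
  obtain g' where g: "(g has_derivative (*) g') (at (f z))"
    using assms(2)[OF z] unfolding field_differentiable_def has_field_derivative_def by auto
  show "\<exists>D. ((\<lambda>s. g (f s)) has_derivative D) (at z within U) \<and> (\<forall>c v. D (c *s v) = c * D v)"
    using has_derivative_compose[OF D(1) g]
    by (intro exI[of _ "\<lambda>h. g' * D h"] conjI) (auto simp: D algebra_simps)
qed

lemma holo_on_cong:
  assumes "\<And>s. s \<in> U \<Longrightarrow> f s = g s" "holo_on f U" shows "holo_on g U"
  unfolding holo_on_def
proof
  fix z assume z: "z \<in> U"
  then obtain D where D: "(f has_derivative D) (at z within U)" "\<And>c v. D (c *s v) = c * D v"
    using assms(2) unfolding holo_on_def by metis
  have "(g has_derivative D) (at z within U)"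
    using has_derivative_transform[OF z _ D(1)] assms(1) by metis
  then show "\<exists>D. (g has_derivative D) (at z within U) \<and> (\<forall>c v. D (c *s v) = c * D v)"
    using D(2) by blast
qed

lemma holo_on_subset: "holo_on f U \<Longrightarrow> V \<subseteq> U \<Longrightarrow> holo_on f V"
  unfolding holo_on_def by (meson has_derivative_subset subsetD)

lemma holo_on_uminus: "holo_on f U \<Longrightarrow> holo_on (\<lambda>s. - f s) U"
  using holo_on_mult[OF holo_on_const[of "-1"], of f U] by simp

lemma holo_on_diff: "holo_on f U \<Longrightarrow> holo_on g U \<Longrightarrow> holo_on (\<lambda>s. f s - g s) U"
  using holo_on_add[OF _ holo_on_uminus, of f U g] by simp

lemma holo_on_sum: "(\<And>i. i \<in> I \<Longrightarrow> holo_on (f i) U) \<Longrightarrow> holo_on (\<lambda>s. \<Sum>i\<in>I. f i s) U"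
  by (induction I rule: infinite_finite_induct) (auto intro: holo_on_const holo_on_add)

lemma holo_on_prod: "(\<And>i. i \<in> I \<Longrightarrow> holo_on (f i) U) \<Longrightarrow> holo_on (\<lambda>s. \<Prod>i\<in>I. f i s) U"
  by (induction I rule: infinite_finite_induct) (auto intro: holo_on_const holo_on_mult)

lemma holo_on_divide:
  assumes "holo_on f U" "holo_on g U" "\<And>s. s \<in> U \<Longrightarrow> g s \<noteq> 0"
  shows "holo_on (\<lambda>s. f s / g s) U"
proof -
  have "holo_on (\<lambda>s. inverse (g s)) U"
    by (rule holo_on_compose[OF assms(2)])
       (use assms(3) in \<open>auto intro!: derivative_intros\<close>)
  then show ?thesis using holo_on_mult[OF assms(1)] by (simp add: divide_inverse)
qed

lemma holo_on_powr: "holo_on v U \<Longrightarrow> c \<noteq> 0 \<Longrightarrow> holo_on (\<lambda>s. c powr v s) U"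
  by (rule holo_on_compose[of v U "\<lambda>w. c powr w"])
     (auto simp: field_differentiable_def intro!: exI derivative_eq_intros)

lemma holo_on_gbinomial: "holo_on v U \<Longrightarrow> holo_on (\<lambda>s. v s gchoose k) U"
  unfolding gbinomial_prod_rev
  by (intro holo_on_divide holo_on_prod holo_on_diff holo_on_const) auto

lemmas holo_intros = holo_on_const holo_on_nth holo_on_add holo_on_mult holo_on_uminus
  holo_on_diff holo_on_sum holo_on_prod holo_on_powr holo_on_gbinomial

lemma holo_on_open_iff:
  "open U \<Longrightarrow> holo_on f U \<longleftrightarrow> (\<forall>z\<in>U. \<exists>D. (f has_derivative D) (at z) \<and> (\<forall>c v. D (c *s v) = c * D v))"
  unfolding holo_on_def by (rule ball_cong) (simp_all add: at_within_open[of _ U])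

lemma holo_on_Union:
  assumes "\<And>i. i \<in> I \<Longrightarrow> open (U i)" "\<And>i. i \<in> I \<Longrightarrow> holo_on f (U i)"
  shows "holo_on f (\<Union>i\<in>I. U i)"
proof -
  have op: "open (\<Union>i\<in>I. U i)" using assms(1) by blast
  show ?thesis
    unfolding holo_on_open_iff[OF op]
  proof
    fix z assume "z \<in> (\<Union>i\<in>I. U i)"
    then obtain i where i: "i \<in> I" "z \<in> U i" by blast
    then show "\<exists>D. (f has_derivative D) (at z) \<and> (\<forall>c v. D (c *s v) = c * D v)"
      using assms(2)[OF i(1)] holo_on_open_iff[OF assms(1)[OF i(1)], of f] by simp
  qed
qed

lemma holo_on_continuous: "holo_on f U \<Longrightarrow> continuous_on U f"
  unfolding holo_on_def continuous_on_eq_continuous_within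
  by (auto dest!: bspec intro: has_derivative_continuous)

lemma norm_vector_scalar_mult: "norm (c *s (v :: complex ^ 'n::finite)) = norm c * norm v"
  by (simp add: norm_vec_def norm_mult L2_set_right_distrib)

lemma bounded_linear_line: "bounded_linear (\<lambda>z :: complex. z *s (v :: complex ^ 'n::finite))"
  by (rule bounded_linear_intro[where K = "norm v"])
     (auto simp: norm_vector_scalar_mult vec_eq_iff algebra_simps)

lemma line_has_derivative:
  fixes f :: "complex ^ 'n::finite \<Rightarrow> complex"
  assumes "(f has_derivative D) (at (p + z *s v))" "\<And>c v. D (c *s v) = c * D v"
  shows "((\<lambda>z. f (p + z *s v)) has_field_derivative D v) (at z)"
proof -
  have "((\<lambda>z. p + z *s v) has_derivative (\<lambda>h. h *s v)) (at z)"
    using has_derivative_add[OF has_derivative_const[of p]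
        bounded_linear_imp_has_derivative[OF bounded_linear_line[of v]]] by simp
  moreover have "(\<lambda>h. D (h *s v)) = (*) (D v)" by (auto simp: assms(2))
  ultimately show ?thesis
    using has_derivative_compose[of "\<lambda>z. p + z *s v" _ z UNIV, OF _ assms(1)]
    unfolding has_field_derivative_def by fastforce
qed

lemma holo_on_line:
  assumes "holo_on f U" "open U"
  shows "(\<lambda>z. f (p + z *s v)) holomorphic_on {z. p + z *s v \<in> U}"
  unfolding holomorphic_on_def
proof
  fix z assume "z \<in> {z. p + z *s v \<in> U}"
  then obtain D where D: "(f has_derivative D) (at (p + z *s v))" "\<And>c v. D (c *s v) = c * D v"
    using assms by (auto simp: holo_on_open_iff)
  from line_has_derivative[OF this] show
    "(\<lambda>z. f (p + z *s v)) field_differentiable at z within {z. p + z *s v \<in> U}"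
    by (meson field_differentiable_at_within field_differentiable_def)
qed

lemma open_line:
  fixes U :: "(complex ^ 'n::finite) set"
  assumes "open U" shows "open {z. p + z *s v \<in> U}"
proof -
  have "continuous_on UNIV (\<lambda>z. p + z *s v)"
    by (intro continuous_on_add continuous_on_const
        bounded_linear.continuous_on[OF bounded_linear_line] continuous_on_id)
  from open_vimage[OF assms this] show ?thesis by (simp add: vimage_def)
qed

text \<open>Cauchy's inequality for the function of one variable \<open>z\<close> on the line
  \<open>s + z *s v\<close>, whose derivative at \<open>0\<close> is \<open>D v\<close>. The radius
  \<open>\<rho> / (2 * norm v)\<close> keeps the closed disc inside the ball, whence the factor
  2.\<close>

lemma holo_derivative_bound:
  assumes f: "holo_on f (ball s \<rho>)" and D: "(f has_derivative D) (at s)"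
    and Dl: "\<And>c v. D (c *s v) = c * D v" and \<rho>: "\<rho> > 0"
    and B: "\<And>x. x \<in> ball s \<rho> \<Longrightarrow> norm (f x) \<le> B"
  shows "norm (D v) \<le> 2 * B / \<rho> * norm v"
proof (cases "v = 0")
  case True
  moreover have "D 0 = 0" using Dl[of 0 0] by (simp add: vec_eq_iff flip: zero_vec_def)
  ultimately show ?thesis by simp
next
  case False
  define r where "r = \<rho> / (2 * norm v)"
  have r: "r > 0" using False \<rho> by (simp add: r_def)
  have sub: "s + z *s v \<in> ball s \<rho>" if "norm z \<le> r" for z
  proof -
    have "norm z * norm v \<le> \<rho> / 2"
      using mult_right_mono[OF that norm_ge_zero[of v]] False by (simp add: r_def)
    then show ?thesis using \<rho> by (simp add: dist_norm norm_vector_scalar_mult)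
  qed
  have hol: "(\<lambda>z. f (s + z *s v)) holomorphic_on cball 0 r"
    by (rule holomorphic_on_subset[OF holo_on_line[OF f]]) (use sub in auto)
  have "norm ((deriv ^^ 1) (\<lambda>z. f (s + z *s v)) 0) \<le> fact 1 * B / r ^ 1"
  proof (rule Cauchy_inequality)
    show "(\<lambda>z. f (s + z *s v)) holomorphic_on ball 0 r"
      using hol by (rule holomorphic_on_subset) auto
    show "continuous_on (cball 0 r) (\<lambda>z. f (s + z *s v))"
      using hol by (rule holomorphic_on_imp_continuous_on)
  qed (use r B sub in auto)
  moreover have "deriv (\<lambda>z. f (s + z *s v)) 0 = D v"
    using line_has_derivative[of f D s 0 v, OF _ Dl] D by (intro DERIV_imp_deriv) simp
  ultimately show ?thesis by (simp add: r_def mult.commute mult.left_commute)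
qed

text \<open>A Weierstrass test. Termwise differentiation needs uniform convergence of the
  derivatives, which Cauchy's inequality derives from the majorant of the functions; the radius is
  halved so that a ball of radius \<open>\<rho>\<close> around each point of the smaller ball stays
  in the larger one.\<close>

lemma holo_on_suminf_ball:
  fixes f :: "nat \<Rightarrow> complex ^ 'n::finite \<Rightarrow> complex"
  assumes f: "\<And>m. holo_on (f m) (ball p (2 * \<rho>))" and \<rho>: "\<rho> > 0"
    and M: "summable M" "\<And>m s. s \<in> ball p (2 * \<rho>) \<Longrightarrow> norm (f m s) \<le> M m"
  shows "holo_on (\<lambda>s. \<Sum>m. f m s) (ball p \<rho>)"
proof -
  have ex: "\<exists>D. (f m has_derivative D) (at s) \<and> (\<forall>c v. D (c *s v) = c * D v)"
    if "s \<in> ball p \<rho>" for m s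
    using f[of m] that \<rho> unfolding holo_on_open_iff[OF open_ball] by simp
  define D where "D m s = (SOME D. (f m has_derivative D) (at s) \<and> (\<forall>c v. D (c *s v) = c * D v))" for m s
  have D: "(f m has_derivative D m s) (at s)" "D m s (c *s v) = c * D m s v"
    if "s \<in> ball p \<rho>" for m s c v
  proof -
    have "(f m has_derivative D m s) (at s) \<and> (\<forall>c v. D m s (c *s v) = c * D m s v)"
      unfolding D_def by (rule someI_ex[OF ex[OF that]])
    then show "(f m has_derivative D m s) (at s)" "D m s (c *s v) = c * D m s v" by simp_all
  qed
  have bnd: "norm (D m s v) \<le> 2 * M m / \<rho> * norm v" if s: "s \<in> ball p \<rho>" for m s v
  proof (rule holo_derivative_bound[OF _ D(1)[OF s] D(2)[OF s] \<rho>])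
    have sub: "ball s \<rho> \<subseteq> ball p (2 * \<rho>)"
      using s by (intro ball_subset_ball_iff[THEN iffD2]) (auto simp: dist_commute)
    then show "holo_on (f m) (ball s \<rho>)" using f holo_on_subset by blast
    show "norm (f m x) \<le> M m" if "x \<in> ball s \<rho>" for x using M(2) sub that by blast
  qed
  define N where "N m = 2 * M m / \<rho>" for m
  have N: "summable N" unfolding N_def using M(1) by (intro summable_divide summable_mult)
  have N0: "N m \<ge> 0" for m
    using order_trans[OF norm_ge_zero M(2)[of p m]] \<rho> by (auto simp: N_def)
  have sD: "summable (\<lambda>m. norm (D m s v))" if "s \<in> ball p \<rho>" for s v
    by (rule summable_comparison_test[OF _ summable_mult2[OF N, of "norm v"]])
       (use bnd[OF that] in \<open>auto simp: N_def\<close>)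
  have "\<exists>g. \<forall>x\<in>ball p \<rho>. (\<lambda>n. f n x) sums g x \<and>
      (g has_derivative (\<lambda>h. \<Sum>m. D m x h)) (at x within ball p \<rho>)"
  proof (rule has_derivative_series)
    show "(f n has_derivative D n x) (at x within ball p \<rho>)" if "x \<in> ball p \<rho>" for n x
      using D(1)[OF that] by (rule has_derivative_at_withinI)
    show "\<forall>\<^sub>F n in sequentially. \<forall>x\<in>ball p \<rho>. \<forall>h.
        norm (sum (\<lambda>i. D i x h) {..<n} - (\<Sum>m. D m x h)) \<le> e * norm h" if e: "e > 0" for e
    proof -
      have "(\<lambda>n. \<Sum>i. N (i + n)) \<longlonglongrightarrow> 0" using suminf_exist_split2[OF N] .
      then have "\<forall>\<^sub>F n in sequentially. (\<Sum>i. N (i + n)) < e"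
        using e by (rule order_tendstoD)
      then show ?thesis
      proof eventually_elim
        case (elim n)
        show ?case
        proof (intro ballI allI)
          fix x h assume x: "x \<in> ball p \<rho>"
          have "norm (sum (\<lambda>i. D i x h) {..<n} - (\<Sum>m. D m x h)) = norm (\<Sum>i. D (i + n) x h)"
            using suminf_split_initial_segment[OF summable_norm_cancel[OF sD[OF x, of h]], of n]
            by (simp add: norm_minus_commute)
          also have "\<dots> \<le> (\<Sum>i. norm (D (i + n) x h))"
            by (rule summable_norm) (rule summable_ignore_initial_segment[OF sD[OF x]])
          also have "\<dots> \<le> (\<Sum>i. N (i + n) * norm h)"
            using bnd[OF x]
            by (intro suminf_le summable_mult2 summable_ignore_initial_segment[OF sD[OF x]]
                summable_ignore_initial_segment[OF N]) (simp add: N_def)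
          also have "\<dots> = (\<Sum>i. N (i + n)) * norm h"
            by (rule suminf_mult2[symmetric]) (rule summable_ignore_initial_segment[OF N])
          also have "\<dots> \<le> e * norm h" using elim by (intro mult_right_mono) auto
          finally show "norm (sum (\<lambda>i. D i x h) {..<n} - (\<Sum>m. D m x h)) \<le> e * norm h" .
        qed
      qed
    qed
    show "p \<in> ball p \<rho>" using \<rho> by simp
    show "(\<lambda>n. f n p) sums (\<Sum>n. f n p)"
      by (rule summable_sums, rule summable_norm_cancel, rule summable_comparison_test[OF _ M(1)])
         (use M(2)[of p] \<rho> in auto)
  qed simp
  then obtain g where g: "\<And>x. x \<in> ball p \<rho> \<Longrightarrow> (\<lambda>n. f n x) sums g x"
    "\<And>x. x \<in> ball p \<rho> \<Longrightarrow> (g has_derivative (\<lambda>h. \<Sum>m. D m x h)) (at x within ball p \<rho>)"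
    by blast
  have "holo_on g (ball p \<rho>)"
    unfolding holo_on_def
  proof
    fix z assume z: "z \<in> ball p \<rho>"
    have "(\<Sum>m. D m z (c *s v)) = c * (\<Sum>m. D m z v)" for c v
      using suminf_mult[OF summable_norm_cancel[OF sD[OF z]]] by (simp add: D(2)[OF z])
    then show "\<exists>D. (g has_derivative D) (at z within ball p \<rho>) \<and> (\<forall>c v. D (c *s v) = c * D v)"
      using g(2)[OF z] by (intro exI[of _ "\<lambda>h. \<Sum>m. D m z h"]) auto
  qed
  then show ?thesis by (rule holo_on_cong[rotated]) (rule sums_unique[OF g(1)])
qed

lemma holo_on_suminf:
  fixes f :: "nat \<Rightarrow> complex ^ 'n::finite \<Rightarrow> complex"
  assumes U: "open U" and f: "\<And>m. holo_on (f m) U"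
    and M: "\<And>p. p \<in> U \<Longrightarrow> \<exists>V M. open V \<and> p \<in> V \<and> summable M \<and> (\<forall>m. \<forall>s\<in>V \<inter> U. norm (f m s) \<le> M m)"
  shows "holo_on (\<lambda>s. \<Sum>m. f m s) U"
  unfolding holo_on_open_iff[OF U]
proof
  fix p assume p: "p \<in> U"
  obtain V M where V: "open V" "p \<in> V" "summable M" "\<And>m s. s \<in> V \<Longrightarrow> s \<in> U \<Longrightarrow> norm (f m s) \<le> M m"
    using M[OF p] by blast
  obtain e where e: "e > 0" "ball p e \<subseteq> V \<inter> U"
    using openE[OF open_Int[OF V(1) U], of p] V(2) p by auto
  have "holo_on (\<lambda>s. \<Sum>m. f m s) (ball p (e / 2))"
  proof (rule holo_on_suminf_ball[where M = M])
    show "holo_on (f m) (ball p (2 * (e / 2)))" for m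
      using e(2) by (intro holo_on_subset[OF f]) auto
    show "norm (f m s) \<le> M m" if "s \<in> ball p (2 * (e / 2))" for m s
      using that e(2) V(4)[of s m] by (auto simp: subset_iff)
  qed (use e(1) V(3) in auto)
  then show "\<exists>D. ((\<lambda>s. \<Sum>m. f m s) has_derivative D) (at p) \<and> (\<forall>c v. D (c *s v) = c * D v)"
    unfolding holo_on_open_iff[OF open_ball] using e(1) by simp
qed

text \<open>A complex line meets a convex set in a convex, hence connected, set, so the identity
  theorem of one variable applies. Vanishing is asked only on the line near \<open>p\<close>: this
  admits lines inside a hyperplane, where no open set of zeros is available.\<close>

lemma holo_zero_along_line:
  assumes f: "holo_on f U" and U: "open U" "convex U" "p \<in> U" "p + v \<in> U"
    and e: "e > 0" "\<And>z. norm z < e \<Longrightarrow> p + z *s v \<in> U \<Longrightarrow> f (p + z *s v) = 0"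
  shows "f (p + v) = 0"
proof -
  let ?S = "{z. p + z *s v \<in> U}" and ?g = "\<lambda>z. f (p + z *s v)"
  have hol: "?g holomorphic_on ?S" using holo_on_line[OF f U(1)] .
  have op: "open ?S" using open_line[OF U(1)] .
  have "convex ?S"
  proof (rule convexI)
    fix x y :: complex and a b :: real
    assume *: "x \<in> ?S" "y \<in> ?S" "0 \<le> a" "0 \<le> b" "a + b = 1"
    have "p + (a *\<^sub>R x + b *\<^sub>R y) *s v =
        a *\<^sub>R (p + x *s v) + b *\<^sub>R (p + y *s v) + (1 - (a + b)) *\<^sub>R p"
      by (simp add: vec_eq_iff algebra_simps)
    then show "a *\<^sub>R x + b *\<^sub>R y \<in> ?S"
      using convexD[OF U(2), of "p + x *s v" "p + y *s v" a b] * by simp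
  qed
  then have con: "connected ?S" by (rule convex_connected)
  have 0: "0 \<in> ?S" using U by simp
  obtain d where d: "d > 0" "ball 0 d \<subseteq> ?S" using openE[OF op 0] by blast
  have one: "1 \<in> ?S" using U by simp
  have "?g 1 = 0"
  proof (rule analytic_continuation[OF hol op con, of "ball 0 (min d e)" 0 1])
    show "(0 :: complex) islimpt ball 0 (min d e)" using d e by (simp add: islimpt_ball)
  qed (use d e(1) 0 one in \<open>auto intro!: e(2)\<close>)
  then show ?thesis by simp
qed

subsection \<open>Families of functions decaying in a sector\<close>

locale sector =
  fixes \<delta> T :: real
  assumes \<delta>_pos: "0 < \<delta>" and T_nonneg: "0 \<le> T"
begin

text \<open>A sector cut off at real part \<open>\<delta>\<close>. It is closed under addition, so
  it contains all the nonempty sums of terms \<open>of_nat m * \<gamma> $ j\<close> with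
  \<open>m\<close> positive. In it \<open>norm X\<close> and \<open>Re X\<close> are comparable, and
  \<open>Re X \<ge> \<delta>\<close> makes a faster rate of decay imply a slower one.\<close>

definition sec :: "complex set" where
  "sec = {X. \<delta> \<le> Re X \<and> \<bar>Im X\<bar> \<le> T * Re X}"

lemma sec_Re_pos: "X \<in> sec \<Longrightarrow> 0 < Re X"
  using \<delta>_pos by (auto simp: sec_def)

lemma sec_nonzero: "X \<in> sec \<Longrightarrow> X \<noteq> 0"
  using sec_Re_pos by force

lemma sec_add: "X \<in> sec \<Longrightarrow> Y \<in> sec \<Longrightarrow> X + Y \<in> sec"
  using \<delta>_pos by (auto simp: sec_def algebra_simps abs_le_iff)

lemma sec_add_mult: "X \<in> sec \<Longrightarrow> Y \<in> sec \<Longrightarrow> 0 \<le> t \<Longrightarrow> X + of_real t * Y \<in> sec"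
proof -
  assume *: "X \<in> sec" "Y \<in> sec" "0 \<le> t"
  have "t * \<bar>Im Y\<bar> \<le> t * (T * Re Y)" using * by (intro mult_left_mono) (auto simp: sec_def)
  moreover have "0 \<le> t * Re Y" using * sec_Re_pos[of Y] by (intro mult_nonneg_nonneg) auto
  moreover have "\<bar>Im X + t * Im Y\<bar> \<le> \<bar>Im X\<bar> + t * \<bar>Im Y\<bar>" using *(3) by (simp add: abs_mult abs_triangle_ineq[THEN order_trans])
  ultimately show ?thesis using * by (auto simp: sec_def algebra_simps)
qed

lemma sec_mult_Suc: "Y \<in> sec \<Longrightarrow> of_nat (Suc m) * Y \<in> sec"
  using sec_add_mult[of Y Y "of_nat m"] by (simp add: algebra_simps)

lemma sec_norm_le: "X \<in> sec \<Longrightarrow> norm X \<le> (1 + T) * Re X"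
  using cmod_le[of X] sec_Re_pos[of X] by (auto simp: sec_def algebra_simps)

text \<open>The two losses in comparing \<open>norm (X powr v)\<close> with
  \<open>Re X powr Re v\<close>: \<open>pi\<close> bounds the argument of \<open>X\<close>, and
  \<open>ln (1 + T)\<close> the logarithm of \<open>norm X / Re X\<close>.\<close>

definition powc :: real where
  "powc = pi + ln (1 + T)"

lemma norm_powr_le:
  assumes X: "X \<in> sec"
  shows "norm (X powr v) \<le> exp (powc * norm v) * Re X powr Re v"
proof -
  have X0: "X \<noteq> 0" "0 < Re X" using X sec_nonzero sec_Re_pos by auto
  have le: "Re X \<le> norm X" by (rule complex_Re_le_cmod)
  have a: "Re v * ln (norm X) \<le> norm v * ln (1 + T) + Re v * ln (Re X)"
  proof -
    have l: "0 \<le> ln (norm X) - ln (Re X)" using le X0 by simp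
    have "ln (norm X) \<le> ln ((1 + T) * Re X)"
      using sec_norm_le[OF X] X0 by (intro ln_mono) auto
    also have "\<dots> = ln (1 + T) + ln (Re X)" using X0 T_nonneg by (subst ln_mult) auto
    finally have u: "ln (norm X) - ln (Re X) \<le> ln (1 + T)" by simp
    have "Re v * (ln (norm X) - ln (Re X)) \<le> \<bar>Re v\<bar> * (ln (norm X) - ln (Re X))"
      using l by (intro mult_right_mono) auto
    also have "\<dots> \<le> norm v * ln (1 + T)"
      using l u by (intro mult_mono abs_Re_le_cmod) auto
    finally show ?thesis by (simp add: algebra_simps)
  qed
  have b: "- (Im v * Im (Ln X)) \<le> norm v * pi"
  proof -
    have "- (Im v * Im (Ln X)) \<le> \<bar>Im v\<bar> * \<bar>Im (Ln X)\<bar>"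
      by (metis abs_ge_minus_self abs_mult)
    also have "\<dots> \<le> norm v * pi"
      using mpi_less_Im_Ln[OF X0(1)] Im_Ln_le_pi[OF X0(1)]
      by (intro mult_mono abs_Im_le_cmod) auto
    finally show ?thesis .
  qed
  have "norm (X powr v) = exp (Re v * ln (norm X) - Im v * Im (Ln X))"
    using X0 by (simp add: powr_def)
  also have "\<dots> \<le> exp (powc * norm v + Re v * ln (Re X))"
    using a b by (simp add: powc_def algebra_simps)
  also have "\<dots> = exp (powc * norm v) * Re X powr Re v"
    using X0 by (simp add: powr_def exp_add)
  finally show ?thesis .
qed

lemma norm_powr_ge:
  assumes X: "X \<in> sec"
  shows "exp (- (powc * norm v)) * Re X powr Re v \<le> norm (X powr v)"
proof -
  have "norm (X powr (- v)) \<le> exp (powc * norm v) * Re X powr (- Re v)"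
    using norm_powr_le[OF X, of "- v"] by simp
  moreover have "norm (X powr (- v)) = inverse (norm (X powr v))"
    by (simp add: powr_minus norm_inverse)
  moreover have "0 < norm (X powr v)" using sec_nonzero[OF X] by simp
  moreover have "0 < Re X powr Re v" using sec_Re_pos[OF X] by simp
  ultimately show ?thesis
    by (simp add: powr_minus exp_minus field_simps)
qed

text \<open>The rate \<open>a\<close> depends on \<open>s\<close>, and \<open>B\<close> is
  continuous rather than bounded: bounds near each parameter suffice for holomorphy of the sums,
  while \<open>U\<close> may be an unbounded tube.\<close>

definition decaying ::
  "(complex ^ 'n::finite \<Rightarrow> real) \<Rightarrow> (complex ^ 'n) set \<Rightarrow> (complex \<Rightarrow> complex ^ 'n \<Rightarrow> complex) \<Rightarrow> bool" where
  "decaying a U R \<longleftrightarrow> (\<forall>X\<in>sec. holo_on (R X) U) \<and>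
     (\<exists>B. continuous_on U B \<and> (\<forall>s\<in>U. 0 \<le> B s \<and> (\<forall>X\<in>sec. norm (R X s) \<le> B s * Re X powr (- a s))))"

lemma decayingE:
  assumes "decaying a U R"
  obtains B where "continuous_on U B" "\<And>s. s \<in> U \<Longrightarrow> 0 \<le> B s"
    "\<And>s X. s \<in> U \<Longrightarrow> X \<in> sec \<Longrightarrow> norm (R X s) \<le> B s * Re X powr (- a s)"
    "\<And>X. X \<in> sec \<Longrightarrow> holo_on (R X) U"
  using assms unfolding decaying_def by blast

lemma decayingI:
  assumes "continuous_on U B" "\<And>s. s \<in> U \<Longrightarrow> 0 \<le> B s"
    "\<And>s X. s \<in> U \<Longrightarrow> X \<in> sec \<Longrightarrow> norm (R X s) \<le> B s * Re X powr (- a s)"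
    "\<And>X. X \<in> sec \<Longrightarrow> holo_on (R X) U"
  shows "decaying a U R"
  using assms unfolding decaying_def by blast

lemma decaying_subset: "decaying a U R \<Longrightarrow> V \<subseteq> U \<Longrightarrow> decaying a V R"
  unfolding decaying_def by (meson continuous_on_subset holo_on_subset subsetD)

lemma decaying_add:
  assumes "decaying a U R" "decaying a U S"
  shows "decaying a U (\<lambda>X s. R X s + S X s)"
proof -
  obtain B where B: "continuous_on U B" "\<And>s. s \<in> U \<Longrightarrow> 0 \<le> B s"
    "\<And>s X. s \<in> U \<Longrightarrow> X \<in> sec \<Longrightarrow> norm (R X s) \<le> B s * Re X powr (- a s)"
    "\<And>X. X \<in> sec \<Longrightarrow> holo_on (R X) U" using assms(1) by (rule decayingE) blast
  obtain C where C: "continuous_on U C" "\<And>s. s \<in> U \<Longrightarrow> 0 \<le> C s"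
    "\<And>s X. s \<in> U \<Longrightarrow> X \<in> sec \<Longrightarrow> norm (S X s) \<le> C s * Re X powr (- a s)"
    "\<And>X. X \<in> sec \<Longrightarrow> holo_on (S X) U" using assms(2) by (rule decayingE) blast
  show ?thesis
  proof (rule decayingI)
    show "continuous_on U (\<lambda>s. B s + C s)" using B C by (intro continuous_intros)
    show "norm (R X s + S X s) \<le> (B s + C s) * Re X powr (- a s)" if "s \<in> U" "X \<in> sec" for X s
      using norm_triangle_le[OF add_mono[OF B(3)[OF that] C(3)[OF that]]] by (simp add: algebra_simps)
  qed (use B C in \<open>auto intro: holo_on_add\<close>)
qed

lemma decaying_mult:
  assumes "decaying a U R" "decaying b U S"
  shows "decaying (\<lambda>s. a s + b s) U (\<lambda>X s. R X s * S X s)"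
proof -
  obtain B where B: "continuous_on U B" "\<And>s. s \<in> U \<Longrightarrow> 0 \<le> B s"
    "\<And>s X. s \<in> U \<Longrightarrow> X \<in> sec \<Longrightarrow> norm (R X s) \<le> B s * Re X powr (- a s)"
    "\<And>X. X \<in> sec \<Longrightarrow> holo_on (R X) U" using assms(1) by (rule decayingE) blast
  obtain C where C: "continuous_on U C" "\<And>s. s \<in> U \<Longrightarrow> 0 \<le> C s"
    "\<And>s X. s \<in> U \<Longrightarrow> X \<in> sec \<Longrightarrow> norm (S X s) \<le> C s * Re X powr (- b s)"
    "\<And>X. X \<in> sec \<Longrightarrow> holo_on (S X) U" using assms(2) by (rule decayingE) blast
  show ?thesis
  proof (rule decayingI)
    show "continuous_on U (\<lambda>s. B s * C s)" using B C by (intro continuous_intros)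
    show "norm (R X s * S X s) \<le> (B s * C s) * Re X powr (- (a s + b s))" if "s \<in> U" "X \<in> sec" for X s
    proof -
      have "norm (R X s * S X s) \<le> (B s * Re X powr (- a s)) * (C s * Re X powr (- b s))"
        unfolding norm_mult using B C that by (intro mult_mono) auto
      also have "\<dots> = (B s * C s) * Re X powr (- a s + - b s)"
        unfolding powr_add by (simp add: algebra_simps)
      finally show ?thesis by simp
    qed
  qed (use B C in \<open>auto intro: holo_on_mult\<close>)
qed

lemma decaying_coeff:
  assumes "holo_on f U" shows "decaying (\<lambda>s. 0) U (\<lambda>X. f)"
proof (rule decayingI)
  show "continuous_on U (\<lambda>s. norm (f s))"
    using holo_on_continuous[OF assms] by (intro continuous_intros)
qed (use assms sec_Re_pos in force)+

lemma decaying_cmult: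
  assumes "holo_on f U" "decaying a U R"
  shows "decaying a U (\<lambda>X s. f s * R X s)"
  using decaying_mult[OF decaying_coeff[OF assms(1)] assms(2)] by simp

lemma decaying_zero: "decaying a U (\<lambda>X s. 0)"
  by (rule decayingI[where B = "\<lambda>_. 0"]) (auto intro: holo_on_const)

lemma decaying_uminus: "decaying a U R \<Longrightarrow> decaying a U (\<lambda>X s. - R X s)"
  using decaying_cmult[OF holo_on_const[of "-1"]] by simp

lemma decaying_diff:
  "decaying a U R \<Longrightarrow> decaying a U S \<Longrightarrow> decaying a U (\<lambda>X s. R X s - S X s)"
  using decaying_add[OF _ decaying_uminus, of a U R S] by simp

lemma decaying_sum:
  "(\<And>i. i \<in> I \<Longrightarrow> decaying a U (R i)) \<Longrightarrow> decaying a U (\<lambda>X s. \<Sum>i\<in>I. R i X s)"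
  by (induction I rule: infinite_finite_induct) (auto intro: decaying_zero decaying_add)

lemma decaying_powr:
  assumes "holo_on v U" shows "decaying (\<lambda>s. - Re (v s)) U (\<lambda>X s. X powr v s)"
proof (rule decayingI)
  show "continuous_on U (\<lambda>s. exp (powc * norm (v s)))"
    using holo_on_continuous[OF assms] by (intro continuous_intros)
qed (use assms norm_powr_le sec_nonzero in \<open>auto intro!: holo_on_powr\<close>)

lemma decaying_weaken:
  assumes "decaying (\<lambda>s. a s + c) U R" "0 \<le> c"
  shows "decaying a U R"
proof -
  obtain B where B: "continuous_on U B" "\<And>s. s \<in> U \<Longrightarrow> 0 \<le> B s"
    "\<And>s X. s \<in> U \<Longrightarrow> X \<in> sec \<Longrightarrow> norm (R X s) \<le> B s * Re X powr (- (a s + c))"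
    "\<And>X. X \<in> sec \<Longrightarrow> holo_on (R X) U" using assms(1) by (rule decayingE) blast
  show ?thesis
  proof (rule decayingI)
    show "continuous_on U (\<lambda>s. B s * \<delta> powr (- c))" using B by (intro continuous_intros)
    show "norm (R X s) \<le> B s * \<delta> powr (- c) * Re X powr (- a s)" if "s \<in> U" "X \<in> sec" for X s
    proof -
      have "Re X powr (- c) \<le> \<delta> powr (- c)"
        using that assms(2) \<delta>_pos by (intro powr_mono2') (auto simp: sec_def)
      then have "B s * (Re X powr (- c) * Re X powr (- a s)) \<le> B s * (\<delta> powr (- c) * Re X powr (- a s))"
        using B that by (intro mult_left_mono mult_right_mono) auto
      then show ?thesis using B(3)[OF that] by (simp add: algebra_simps flip: powr_add)
    qed
  qed (use B in auto)
qed

end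

section \<open>Convergence and decay of the sums over one variable\<close>

lemma powr_telescope_bound:
  fixes x g a :: real
  assumes "0 < x" "0 < g" "1 < a"
  shows "(x + g) powr (- a) \<le> (x powr (1 - a) - (x + g) powr (1 - a)) / ((a - 1) * g)"
proof -
  have "\<exists>z>x. z < x + g \<and> (x + g) powr (1 - a) - x powr (1 - a) = (x + g - x) * ((1 - a) * z powr (- a))"
  proof (rule MVT2)
    show "((\<lambda>t. t powr (1 - a)) has_real_derivative (1 - a) * t powr (- a)) (at t)"
      if "x \<le> t" for t
      using that assms by (auto intro!: derivative_eq_intros simp: field_simps)
  qed (use assms in auto)
  then obtain z where z: "x < z" "z < x + g"
    "(x + g) powr (1 - a) - x powr (1 - a) = g * ((1 - a) * z powr (- a))" by auto
  have "(x + g) powr (- a) \<le> z powr (- a)" using z assms by (intro powr_mono2') auto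
  also have "\<dots> = (x powr (1 - a) - (x + g) powr (1 - a)) / ((a - 1) * g)"
    using z(3) assms by (simp add: field_simps)
  finally show ?thesis .
qed

text \<open>Comparison with the integral, by telescoping the mean value estimate. The explicit
  denominator \<open>(a - 1) * g\<close> later shows that the bound depends continuously on the
  exponent.\<close>

lemma powr_sum_bound:
  fixes x g a :: real
  assumes "0 < x" "0 < g" "1 < a"
  shows "summable (\<lambda>m. (x + real (Suc m) * g) powr (- a))"
    and "(\<Sum>m. (x + real (Suc m) * g) powr (- a)) \<le> x powr (1 - a) / ((a - 1) * g)"
proof -
  define F where "F m = (x + real m * g) powr (1 - a) / ((a - 1) * g)" for m
  have le: "(x + real (Suc m) * g) powr (- a) \<le> F m - F (Suc m)" for m
    using powr_telescope_bound[of "x + real m * g" g a] assms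
    by (simp add: F_def diff_divide_distrib algebra_simps add_pos_nonneg)
  have F0: "0 \<le> F m" for m using assms by (simp add: F_def)
  have part: "(\<Sum>m<n. (x + real (Suc m) * g) powr (- a)) \<le> F 0" for n
  proof -
    have "(\<Sum>m<n. (x + real (Suc m) * g) powr (- a)) \<le> (\<Sum>m<n. F m - F (Suc m))"
      by (intro sum_mono le)
    also have "\<dots> = F 0 - F n" by (rule sum_lessThan_telescope')
    finally show ?thesis using F0[of n] by simp
  qed
  show "summable (\<lambda>m. (x + real (Suc m) * g) powr (- a))"
    by (rule summableI_nonneg_bounded[OF _ part]) simp
  then show "(\<Sum>m. (x + real (Suc m) * g) powr (- a)) \<le> x powr (1 - a) / ((a - 1) * g)"
    using suminf_le_const[OF _ part] by (simp add: F_def)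
qed

context sector
begin

definition twsum :: "complex \<Rightarrow> complex \<Rightarrow> (complex \<Rightarrow> complex) \<Rightarrow> complex \<Rightarrow> complex" where
  "twsum x g f X = (\<Sum>m. x ^ Suc m * f (X + of_nat (Suc m) * g))"

lemma sec_shift:
  assumes "X \<in> insert 0 sec" "g \<in> sec" shows "X + of_nat (Suc m) * g \<in> sec"
  using assms sec_mult_Suc[of g m] sec_add by auto

lemma twsum_summable:
  fixes f :: "complex \<Rightarrow> complex" and x :: complex
  assumes X: "X \<in> insert 0 sec" and g: "g \<in> sec" and x: "norm x = 1" and a: "1 < a"
    and f: "\<And>Y. Y \<in> sec \<Longrightarrow> norm (f Y) \<le> B * Re Y powr (- a)"
  shows "summable (\<lambda>m. norm (x ^ Suc m * f (X + of_nat (Suc m) * g)))"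
proof -
  \<comment> \<open>\<open>powr_sum_bound\<close> requires a positive starting point, but
    \<open>X\<close> may be \<open>0\<close>; so the majorant starts at \<open>Re g\<close> and its
    index is then moved by one.\<close>
  have "summable (\<lambda>m. (Re g + real (Suc m) * Re g) powr (- a))"
    using powr_sum_bound(1)[of "Re g" "Re g" a] sec_Re_pos[OF g] a by auto
  then have "summable (\<lambda>m. (Re g + real m * Re g) powr (- a))"
    by (subst (asm) summable_Suc_iff[of "\<lambda>m. (Re g + real m * Re g) powr (- a)"])
  then have "summable (\<lambda>m. \<bar>B\<bar> * (Re g + real m * Re g) powr (- a))"
    by (rule summable_mult)
  then show ?thesis
  proof (rule summable_comparison_test[rotated], intro exI allI impI)
    fix m :: nat
    have Y: "X + of_nat (Suc m) * g \<in> sec" using sec_shift X g .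
    have "Re g + real m * Re g \<le> Re (X + of_nat (Suc m) * g)"
      using X sec_Re_pos[of X] by (auto simp: algebra_simps)
    then have "Re (X + of_nat (Suc m) * g) powr (- a) \<le> (Re g + real m * Re g) powr (- a)"
      using sec_Re_pos[OF g] a by (intro powr_mono2') (auto simp: add_pos_nonneg)
    then have "\<bar>B\<bar> * Re (X + of_nat (Suc m) * g) powr (- a) \<le> \<bar>B\<bar> * (Re g + real m * Re g) powr (- a)"
      by (rule mult_left_mono) simp
    moreover have "B * Re (X + of_nat (Suc m) * g) powr (- a) \<le> \<bar>B\<bar> * Re (X + of_nat (Suc m) * g) powr (- a)"
      by (intro mult_right_mono) auto
    ultimately show "norm (norm (x ^ Suc m * f (X + of_nat (Suc m) * g)))
        \<le> \<bar>B\<bar> * (Re g + real m * Re g) powr (- a)"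
      using f[OF Y] x by (simp add: norm_mult norm_power del: of_nat_Suc)
  qed
qed

lemma decaying_twsum_summable:
  assumes "decaying a U R" "s \<in> U" "1 < a s" "X \<in> insert 0 sec" "g \<in> sec" "norm x = 1"
  shows "summable (\<lambda>m. norm (x ^ Suc m * R (X + of_nat (Suc m) * g) s))"
  using assms by (elim decayingE) (rule twsum_summable[where a = "a s"])

lemma holo_on_twsum:
  assumes U: "open U" and R: "decaying a U R" and a: "continuous_on U a" "\<And>s. s \<in> U \<Longrightarrow> 1 < a s"
    and X: "X \<in> insert 0 sec" and g: "g \<in> sec" and x: "norm x = 1"
  shows "holo_on (\<lambda>s. twsum x g (\<lambda>Y. R Y s) X) U"
  unfolding twsum_def
proof (rule holo_on_suminf[OF U])
  obtain B where B: "continuous_on U B" "\<And>s. s \<in> U \<Longrightarrow> 0 \<le> B s"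
    "\<And>s X. s \<in> U \<Longrightarrow> X \<in> sec \<Longrightarrow> norm (R X s) \<le> B s * Re X powr (- a s)"
    "\<And>X. X \<in> sec \<Longrightarrow> holo_on (R X) U" using R by (rule decayingE) blast
  show "holo_on (\<lambda>s. x ^ Suc m * R (X + of_nat (Suc m) * g) s) U" for m
    by (intro holo_intros B sec_shift X g)
  fix p assume p: "p \<in> U"
  \<comment> \<open>\<open>c\<close> and \<open>d\<close> enclose \<open>a p\<close> with
    \<open>c\<close> still above 1, so \<open>a s\<close> stays between them for \<open>s\<close>
    near \<open>p\<close>.\<close>
  define c where "c = (1 + a p) / 2"
  have c: "1 < c" "c < a p" using a(2)[OF p] by (auto simp: c_def)
  define d where "d = a p + 1"
  have "open (B -` {..<B p + 1} \<inter> U)" "open (a -` {c<..<d} \<inter> U)"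
    using B(1)[unfolded continuous_on_open_vimage[OF U], rule_format, OF open_lessThan]
      a(1)[unfolded continuous_on_open_vimage[OF U], rule_format, OF open_greaterThanLessThan]
    by blast+
  define V where "V = (B -` {..<B p + 1} \<inter> U) \<inter> (a -` {c<..<d} \<inter> U)"
  have V: "open V" "p \<in> V"
    unfolding V_def using \<open>open (B -` _ \<inter> U)\<close> \<open>open (a -` _ \<inter> U)\<close> p c
    by (auto simp: d_def)
  \<comment> \<open>Since \<open>\<delta>\<close> may be below 1, neither exponent alone gives a
    majorant: \<open>c\<close> serves where \<open>Re Y \<ge> 1\<close>, and \<open>d\<close> where
    \<open>Re Y < 1\<close>.\<close>
  define h where "h Y = (B p + 1) * Re Y powr (- c) + (B p + 1) * Re Y powr (- d)" for Y
  have s1: "summable (\<lambda>m. norm ((1 :: complex) ^ Suc m * ((\<lambda>Y. of_real (Re Y powr (- c))) (X + of_nat (Suc m) * g))) :: real)"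
    by (rule twsum_summable[OF X g _ c(1), where B = 1 and f = "\<lambda>Y. of_real (Re Y powr (- c))"]) auto
  have s2: "summable (\<lambda>m. norm ((1 :: complex) ^ Suc m * ((\<lambda>Y. of_real (Re Y powr (- d))) (X + of_nat (Suc m) * g))) :: real)"
    by (rule twsum_summable[OF X g _ _, where B = 1 and a = d and f = "\<lambda>Y. of_real (Re Y powr (- d))"])
       (use c in \<open>auto simp: d_def\<close>)
  have sum: "summable (\<lambda>m. h (X + of_nat (Suc m) * g))"
    unfolding h_def using s1 s2
    by (intro summable_add summable_mult) (auto simp del: of_nat_Suc)
  show "\<exists>V M. open V \<and> p \<in> V \<and> summable M \<and>
      (\<forall>m. \<forall>s\<in>V \<inter> U. norm (x ^ Suc m * R (X + of_nat (Suc m) * g) s) \<le> M m)"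
  proof (intro exI conjI allI ballI)
    fix m s assume s: "s \<in> V \<inter> U"
    define Y where "Y = X + of_nat (Suc m) * g"
    have Y: "Y \<in> sec" unfolding Y_def using sec_shift X g .
    have as: "c < a s" "a s < d" "B s \<le> B p + 1" using s by (auto simp: V_def)
    have "Re Y powr (- a s) \<le> Re Y powr (- c) + Re Y powr (- d)"
    proof (cases "1 \<le> Re Y")
      case True
      then have "Re Y powr (- a s) \<le> Re Y powr (- c)" using as by (intro powr_mono) auto
      then show ?thesis by (simp add: add_increasing2)
    next
      case False
      then have "Re Y powr (- a s) \<le> Re Y powr (- d)"
        using as sec_Re_pos[OF Y] by (intro powr_mono') auto
      then show ?thesis by (simp add: add_increasing)
    qed
    then have "B s * Re Y powr (- a s) \<le> (B p + 1) * (Re Y powr (- c) + Re Y powr (- d))"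
      using as B(2)[of s] s by (intro mult_mono) auto
    then have "norm (R Y s) \<le> h Y" using B(3)[OF _ Y, of s] s by (auto simp: h_def algebra_simps)
    then show "norm (x ^ Suc m * R (X + of_nat (Suc m) * g) s) \<le> h (X + of_nat (Suc m) * g)"
      unfolding Y_def using x by (simp add: norm_mult norm_power del: of_nat_Suc)
  qed (use V sum in auto)
qed

lemma decaying_twsum:
  assumes U: "open U" and R: "decaying a U R" and a: "continuous_on U a" "\<And>s. s \<in> U \<Longrightarrow> 1 < a s"
    and g: "g \<in> sec" and x: "norm x = 1"
  shows "decaying (\<lambda>s. a s - 1) U (\<lambda>X s. twsum x g (\<lambda>Y. R Y s) X)"
proof -
  obtain B where B: "continuous_on U B" "\<And>s. s \<in> U \<Longrightarrow> 0 \<le> B s"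
    "\<And>s X. s \<in> U \<Longrightarrow> X \<in> sec \<Longrightarrow> norm (R X s) \<le> B s * Re X powr (- a s)"
    "\<And>X. X \<in> sec \<Longrightarrow> holo_on (R X) U" using R by (rule decayingE) blast
  show ?thesis
  proof (rule decayingI)
    show "continuous_on U (\<lambda>s. B s / ((a s - 1) * Re g))"
      using B(1) a sec_Re_pos[OF g] by (intro continuous_intros) force+
    show "0 \<le> B s / ((a s - 1) * Re g)" if "s \<in> U" for s
      using B(2) a(2) that sec_Re_pos[OF g] by (simp add: less_imp_le)
    show "holo_on (\<lambda>s. twsum x g (\<lambda>Y. R Y s) X) U" if "X \<in> sec" for X
      using holo_on_twsum[OF U R a _ g x] that by auto
    fix s X assume s: "s \<in> U" and X: "X \<in> sec"
    have sm: "summable (\<lambda>m. norm (x ^ Suc m * R (X + of_nat (Suc m) * g) s))"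
      using decaying_twsum_summable[OF R s a(2)[OF s] _ g x] X by auto
    have "norm (twsum x g (\<lambda>Y. R Y s) X) \<le> (\<Sum>m. norm (x ^ Suc m * R (X + of_nat (Suc m) * g) s))"
      unfolding twsum_def by (rule summable_norm[OF sm])
    also have "\<dots> \<le> (\<Sum>m. B s * (Re X + real (Suc m) * Re g) powr (- a s))"
    proof (rule suminf_le[OF _ sm])
      show "norm (x ^ Suc m * R (X + of_nat (Suc m) * g) s) \<le> B s * (Re X + real (Suc m) * Re g) powr (- a s)" for m
        using B(3)[OF s sec_shift[OF _ g, of X m]] X x by (simp add: norm_mult norm_power del: of_nat_Suc)
      show "summable (\<lambda>m. B s * (Re X + real (Suc m) * Re g) powr (- a s))"
        using powr_sum_bound(1) sec_Re_pos X g a(2)[OF s] by (intro summable_mult) auto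
    qed
    also have "\<dots> = B s * (\<Sum>m. (Re X + real (Suc m) * Re g) powr (- a s))"
      using powr_sum_bound(1) sec_Re_pos X g a(2)[OF s] by (intro suminf_mult) auto
    also have "\<dots> \<le> B s * (Re X powr (1 - a s) / ((a s - 1) * Re g))"
      using powr_sum_bound(2) sec_Re_pos X g a(2)[OF s] B(2)[OF s] by (intro mult_left_mono) auto
    finally show "norm (twsum x g (\<lambda>Y. R Y s) X) \<le> B s / ((a s - 1) * Re g) * Re X powr (- (a s - 1))"
      by simp
  qed
qed

end

subsection \<open>The Lerch function\<close>

text \<open>For \<open>x = 1\<close> these are the Bernoulli numbers with
  \<open>lam 1 1 = 1 / 2\<close>; for \<open>x \<noteq> 1\<close> they are the polylogarithm values
  \<open>Li_{-k}(x)\<close>, the regularised sums of \<open>x ^ m * of_nat m ^ k\<close> over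
  \<open>m \<ge> 1\<close>. Both arise by comparing coefficients in one difference equation.\<close>

fun lam :: "complex \<Rightarrow> nat \<Rightarrow> complex" where
  "lam x k = (if x = 1 then 1 - (\<Sum>l<k. of_nat (Suc k choose l) * lam x l) / of_nat (Suc k)
     else x / (1 - x) * (1 + (\<Sum>l<k. of_nat (k choose l) * lam x l)))"

declare lam.simps [simp del]

lemma lam_0: "lam x 0 = (if x = 1 then 1 else x / (1 - x))"
  by (subst lam.simps) simp

lemma lam_zero_nonzero: "x \<noteq> 0 \<Longrightarrow> lam x 0 \<noteq> 0"
  by (simp add: lam_0)

lemma lam_one_sum: "(\<Sum>l<k. of_nat (k choose l) * lam 1 l) = of_nat k"
proof (cases k)
  case (Suc n)
  have "of_nat (Suc n) * lam 1 n = of_nat (Suc n) - (\<Sum>l<n. of_nat (Suc n choose l) * lam 1 l)"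
    by (subst lam.simps) (simp add: field_simps del: of_nat_Suc)
  then show ?thesis using Suc by (simp del: of_nat_Suc)
qed simp

text \<open>Both recurrences in one form. The left side is the factor of the term number
  \<open>k\<close> when \<open>f X - x * f (X + g)\<close> is formed from the formal expansion with
  coefficients \<open>lam x l\<close>.\<close>

lemma lam_rec:
  "lam x k - x * (\<Sum>l\<le>k. of_nat (k choose l) * lam x l) = (if x = 1 then - of_nat k else x)"
proof (cases "x = 1")
  case True
  then show ?thesis using lam_one_sum[of k] by (simp flip: lessThan_Suc_atMost)
next
  case False
  have "(1 - x) * lam x k = x * (1 + (\<Sum>l<k. of_nat (k choose l) * lam x l))"
    using False by (subst lam.simps) simp
  then show ?thesis using False by (simp add: algebra_simps flip: lessThan_Suc_atMost)
qed

text \<open>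
  If the sequence vanished eventually, its recurrence would be a polynomial identity in \<open>k\<close>,
  which fails at \<open>k = 0\<close>.
\<close>

lemma infinite_lam_nonzero: "x \<noteq> 0 \<Longrightarrow> infinite {k. lam x k \<noteq> 0}"
proof
  assume x: "x \<noteq> 0" and "finite {k. lam x k \<noteq> 0}"
  then obtain n where "\<forall>k\<in>{k. lam x k \<noteq> 0}. k < n" using finite_nat_set_iff_bounded by blast
  then have n: "lam x k = 0" if "n \<le> k" for k using that not_less by blast
  define b :: "nat \<Rightarrow> complex poly" where "b l = smult (1 / fact l) (\<Prod>i=0..<l. [:- of_nat i, 1:])" for l
  have b: "poly (b l) (of_nat k) = of_nat (k choose l)" for l k
    by (simp add: b_def poly_prod gbinomial_prod_rev binomial_gbinomial)
  define P where "P = (\<Sum>l<n. smult (lam x l) (b l)) + (if x = 1 then [:0, -1:] else [:1:])"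
  have P: "poly P (of_nat k) = (\<Sum>l<n. of_nat (k choose l) * lam x l) + (if x = 1 then - of_nat k else 1)" for k
    by (simp add: P_def poly_sum b mult.commute)
  have ext: "(\<Sum>l<n. of_nat (k choose l) * lam x l) = (\<Sum>l\<le>k. of_nat (k choose l) * lam x l)" if "n \<le> k" for k
    by (rule sum.mono_neutral_left) (use that n in auto)
  have "poly P (of_nat k) = 0" if "n \<le> k" for k
  proof (cases "x = 1")
    case True
    then show ?thesis
      using lam_rec[of x k] n[OF that] unfolding P ext[OF that] by (simp add: neg_equal_iff_equal)
  next
    case False
    let ?S = "\<Sum>l\<le>k. of_nat (k choose l) * lam x l"
    have "- (x * ?S) = x" using lam_rec[of x k] n[OF that] False by simp
    then have "x * ?S = - x" by (metis minus_minus)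
    then have "x * (1 + ?S) = 0" by (simp add: distrib_left)
    then show ?thesis using x False unfolding P ext[OF that] by (simp add: add.commute)
  qed
  then have "of_nat ` {n..} \<subseteq> {z. poly P z = 0}" by auto
  moreover have "infinite (of_nat ` {n..} :: complex set)"
    by (subst finite_image_iff) (auto simp: inj_on_def infinite_Ici)
  ultimately have "P = 0" using poly_roots_finite finite_subset by blast
  then have "(\<Sum>l<n. of_nat (0 choose l) * lam x l) + (if x = 1 then 0 else 1) = 0"
    using P[of 0] by (cases "x = 1") simp_all
  moreover have "(\<Sum>l<n. of_nat (0 choose l) * lam x l) = lam x 0"
  proof (cases n)
    case 0
    then show ?thesis using n[of 0] by simp
  next
    case (Suc m)
    then show ?thesis by (simp add: lessThan_Suc_eq_insert_0 sum.insert_remove sum.reindex)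
  qed
  ultimately show False using x by (auto simp: lam_0 field_simps split: if_splits)
qed

section \<open>Taylor remainders of powers in the sector\<close>

context sector
begin

definition taylor_rem :: "nat \<Rightarrow> complex \<Rightarrow> complex \<Rightarrow> complex \<Rightarrow> complex" where
  "taylor_rem n v g X = (X + g) powr v - (\<Sum>i\<le>n. (v gchoose i) * g ^ i * X powr (v - of_nat i))"

text \<open>Taylor's formula on the segment from \<open>X\<close> to \<open>X + g\<close>, which
  stays in the sector. Its points have real part between \<open>Re X\<close> and
  \<open>(1 + Re g / \<delta>) * Re X\<close>, because \<open>Re X \<ge> \<delta>\<close>; the
  absolute value in the exponent covers increasing and decreasing powers.\<close>

lemma taylor_rem_bound:
  assumes X: "X \<in> sec" and g: "g \<in> sec"
  shows "norm (taylor_rem n v g X) \<le>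
    norm (\<Prod>i<Suc n. v - of_nat i) * exp (powc * norm (v - of_nat (Suc n))) *
    (1 + Re g / \<delta>) powr \<bar>Re v - real (Suc n)\<bar> * norm g ^ Suc n / fact n *
    Re X powr (Re v - real (Suc n))"
proof -
  define f where "f i y = (\<Prod>k<i. v - of_nat k) * y powr (v - of_nat i)" for i and y :: complex
  define S where "S = closed_segment X (X + g)"
  define p where "p = Re v - real (Suc n)"
  define K where "K = 1 + Re g / \<delta>"
  define B where "B = norm (\<Prod>i<Suc n. v - of_nat i) * (exp (powc * norm (v - of_nat (Suc n))) * (K powr \<bar>p\<bar> * Re X powr p))"
  have S: "y \<in> sec \<and> Re X \<le> Re y \<and> Re y \<le> Re X + Re g" if yS: "y \<in> S" for y
  proof -
    obtain t where t: "0 \<le> t" "t \<le> 1" "y = (1 - t) *\<^sub>R X + t *\<^sub>R (X + g)"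
      using yS by (auto simp: S_def in_segment)
    then have y: "y = X + of_real t * g" by (simp add: scaleR_conv_of_real algebra_simps)
    have "0 \<le> t * Re g" "t * Re g \<le> 1 * Re g"
      using t sec_Re_pos[OF g] by (auto intro!: mult_right_mono)
    then show ?thesis using sec_add_mult[OF X g t(1)] by (simp add: y)
  qed
  have "norm (f 0 (X + g) - (\<Sum>i\<le>n. f i X * (X + g - X) ^ i / fact i)) \<le>
      B * norm (X + g - X) ^ Suc n / fact n"
  proof (rule complex_Taylor[where S = S])
    show "(f i has_field_derivative f (Suc i) y) (at y within S)" if "y \<in> S" for i y
    proof -
      have "0 < Re y" using S[OF that] sec_Re_pos by blast
      then have "y \<notin> \<real>\<^sub>\<le>\<^sub>0" by (auto simp: complex_nonpos_Reals_iff)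
      then show ?thesis
        unfolding f_def by (auto intro!: derivative_eq_intros simp: algebra_simps)
    qed
    show "norm (f (Suc n) y) \<le> B" if "y \<in> S" for y
    proof -
      have y: "y \<in> sec" "Re X \<le> Re y" "Re y \<le> Re X + Re g" using S[OF that] by auto
      have pos: "0 < Re X" "0 < Re g" using X g sec_Re_pos by auto
      have "1 * Re g \<le> Re X / \<delta> * Re g" using X pos \<delta>_pos by (intro mult_right_mono) (auto simp: sec_def)
      then have yK: "Re y \<le> K * Re X" using y(3) by (simp add: K_def algebra_simps)
      have K1: "1 \<le> K" using pos \<delta>_pos by (simp add: K_def)
      have "Re y powr p \<le> K powr \<bar>p\<bar> * Re X powr p"
      proof (cases "0 \<le> p")
        case True
        then have "Re y powr p \<le> (K * Re X) powr p" using yK y(2) pos by (intro powr_mono2) auto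
        then show ?thesis using True K1 pos by (simp add: powr_mult)
      next
        case False
        then have "Re y powr p \<le> Re X powr p" using y(2) pos by (intro powr_mono2') auto
        also have "\<dots> \<le> K powr \<bar>p\<bar> * Re X powr p"
          using ge_one_powr_ge_zero[OF K1, of "\<bar>p\<bar>"] by (simp add: mult_le_cancel_right1)
        finally show ?thesis .
      qed
      moreover have "norm (y powr (v - of_nat (Suc n))) \<le> exp (powc * norm (v - of_nat (Suc n))) * Re y powr p"
        using norm_powr_le[OF y(1), of "v - of_nat (Suc n)"] by (simp add: p_def)
      ultimately have "norm (y powr (v - of_nat (Suc n))) \<le>
          exp (powc * norm (v - of_nat (Suc n))) * (K powr \<bar>p\<bar> * Re X powr p)"
        by (meson exp_ge_zero mult_left_mono order_trans)
      then show ?thesis unfolding f_def B_def norm_mult by (rule mult_left_mono) simp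
    qed
  qed (auto simp: S_def)
  moreover have "f i X * (X + g - X) ^ i / fact i = (v gchoose i) * g ^ i * X powr (v - of_nat i)" for i
    by (simp add: f_def gbinomial_prod_rev atLeast0LessThan)
  ultimately show ?thesis
    by (simp add: taylor_rem_def f_def B_def p_def K_def mult.assoc mult.commute mult.left_commute)
qed

lemma decaying_taylor_rem:
  assumes v: "holo_on v U" and g: "g \<in> sec"
  shows "decaying (\<lambda>s. real (Suc n) - Re (v s)) U (\<lambda>X s. taylor_rem n (v s) g X)"
proof (rule decayingI)
  have cv: "continuous_on U v" using holo_on_continuous[OF v] .
  have K: "0 < 1 + Re g / \<delta>" using sec_Re_pos[OF g] \<delta>_pos by (simp add: add_pos_pos)
  show "continuous_on U (\<lambda>s. norm (\<Prod>i<Suc n. v s - of_nat i) * exp (powc * norm (v s - of_nat (Suc n))) *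
    (1 + Re g / \<delta>) powr \<bar>Re (v s) - real (Suc n)\<bar> * norm g ^ Suc n / fact n)"
    using K by (intro continuous_intros cv) auto
  show "norm (taylor_rem n (v s) g X) \<le> norm (\<Prod>i<Suc n. v s - of_nat i) * exp (powc * norm (v s - of_nat (Suc n))) *
    (1 + Re g / \<delta>) powr \<bar>Re (v s) - real (Suc n)\<bar> * norm g ^ Suc n / fact n * Re X powr (- (real (Suc n) - Re (v s)))"
    if "X \<in> sec" for X s
    using taylor_rem_bound[OF that g, of n "v s"] by (simp only: minus_diff_eq)
  show "holo_on (\<lambda>s. taylor_rem n (v s) g X) U" if "X \<in> sec" for X
    unfolding taylor_rem_def
    using that sec_nonzero[OF that] sec_nonzero[OF sec_add[OF that g]] by (intro holo_intros v) auto
qed simp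

lemma taylor_rem_0: "g \<in> sec \<Longrightarrow> X \<in> sec \<Longrightarrow> taylor_rem n 0 g X = 0"
proof -
  assume *: "g \<in> sec" "X \<in> sec"
  have "(\<Sum>i\<le>n. (0 gchoose i) * g ^ i * X powr (0 - of_nat i)) = (\<Sum>i\<in>{0}. (0 gchoose i) * g ^ i * X powr (0 - of_nat i))"
    by (rule sum.mono_neutral_right) (auto simp: gbinomial_0_left)
  then show ?thesis
    using sec_nonzero[OF *(2)] sec_nonzero[OF sec_add[OF *(2,1)]] by (simp add: taylor_rem_def)
qed

section \<open>The difference equation of the Lerch function and its approximate solution\<close>

definition eps :: "complex \<Rightarrow> nat" where "eps x = (if x = 1 then 1 else 0)"

text \<open>The sum of \<open>Y powr (v - of_nat (eps x))\<close> has leading power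
  \<open>X powr v\<close> in both cases: untwisted summation raises the exponent by one, which
  \<open>eps\<close> compensates, and twisted summation does not. \<open>polef\<close> removes the
  only pole, at \<open>v = 0\<close> when \<open>x = 1\<close>.\<close>

definition polef :: "complex \<Rightarrow> complex \<Rightarrow> complex" where "polef x v = (if x = 1 then - v else 1)"

definition dcoef :: "complex \<Rightarrow> complex \<Rightarrow> nat \<Rightarrow> complex \<Rightarrow> complex" where
  "dcoef x g l v = lam x l * (v gchoose l) * g ^ l / g ^ eps x"

definition lpart :: "nat \<Rightarrow> complex \<Rightarrow> complex \<Rightarrow> complex \<Rightarrow> complex \<Rightarrow> complex" where
  "lpart n x g v X = (\<Sum>l\<le>n. dcoef x g l v * X powr (v - of_nat l))"

text \<open>The error with which \<open>lpart\<close> solves the difference equation. For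
  \<open>x = 1\<close> the right-hand side contains \<open>(X + g) powr (v - 1)\<close>, so order
  \<open>n - 1\<close> already reaches the last power \<open>v - of_nat n\<close>.\<close>

definition lrem :: "nat \<Rightarrow> complex \<Rightarrow> complex \<Rightarrow> complex \<Rightarrow> complex \<Rightarrow> complex" where
  "lrem n x g v X = - x * (\<Sum>l\<le>n. dcoef x g l v * taylor_rem (n - l) (v - of_nat l) g X)
     - (if x = 1 then - v * taylor_rem (n - 1) (v - 1) g X else x * taylor_rem n v g X)"

text \<open>The term number \<open>l\<close> is expanded to order \<open>n - l\<close>, so that
  every total order up to \<open>n\<close> is complete. Regrouping by total order rests on \<open>(v
  gchoose l) * (v - of_nat l gchoose (k - l)) = (v gchoose k) * of_nat (k choose l)\<close>, the
  reason for the binomial coefficient in \<open>dcoef\<close>.\<close>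

lemma lpart_shift:
  "lpart n x g v (X + g) = (\<Sum>k\<le>n. (\<Sum>l\<le>k. of_nat (k choose l) * lam x l) *
      ((v gchoose k) * g ^ k / g ^ eps x * X powr (v - of_nat k))) +
    (\<Sum>l\<le>n. dcoef x g l v * taylor_rem (n - l) (v - of_nat l) g X)"
proof -
  define G where "G l i = dcoef x g l v * ((v - of_nat l gchoose i) * g ^ i * X powr (v - of_nat l - of_nat i))" for l i
  have G: "G l (k - l) = of_nat (k choose l) * lam x l * ((v gchoose k) * g ^ k / g ^ eps x * X powr (v - of_nat k))"
    if "l \<le> k" for l k
  proof -
    have 1: "(v gchoose l) * (v - of_nat l gchoose (k - l)) = (v gchoose k) * of_nat (k choose l)"
      using gbinomial_trinomial_revision[OF that, of v] by (simp add: binomial_gbinomial)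
    have 2: "g ^ l * g ^ (k - l) = g ^ k" using that by (simp flip: power_add)
    have 3: "v - of_nat l - of_nat (k - l) = v - of_nat k" using that by (simp add: of_nat_diff)
    have "G l (k - l) = lam x l * ((v gchoose l) * (v - of_nat l gchoose (k - l))) *
        (g ^ l * g ^ (k - l)) / g ^ eps x * X powr (v - of_nat k)"
      unfolding G_def dcoef_def 3 by simp
    then show ?thesis unfolding 1 2 by simp
  qed
  have "lpart n x g v (X + g) = (\<Sum>l\<le>n. (\<Sum>i\<le>n - l. G l i) + dcoef x g l v * taylor_rem (n - l) (v - of_nat l) g X)"
    unfolding lpart_def
    by (intro sum.cong refl) (simp add: G_def taylor_rem_def sum_distrib_left algebra_simps)
  also have "\<dots> = (\<Sum>l\<le>n. \<Sum>i\<le>n - l. G l i) + (\<Sum>l\<le>n. dcoef x g l v * taylor_rem (n - l) (v - of_nat l) g X)"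
    by (rule sum.distrib)
  also have "(\<Sum>l\<le>n. \<Sum>i\<le>n - l. G l i) = (\<Sum>(l, i)\<in>{(l, i). l + i \<le> n}. G l i)"
    by (subst sum.Sigma) (auto intro!: sum.cong)
  also have "\<dots> = (\<Sum>k\<le>n. \<Sum>l\<le>k. G l (k - l))"
    by (rule sum.triangle_reindex_eq)
  also have "\<dots> = (\<Sum>k\<le>n. (\<Sum>l\<le>k. of_nat (k choose l) * lam x l) *
      ((v gchoose k) * g ^ k / g ^ eps x * X powr (v - of_nat k)))"
    by (intro sum.cong refl, subst sum_distrib_right, intro sum.cong refl, rule G) simp
  finally show ?thesis .
qed

text \<open>For \<open>x = 1\<close> the absorption identity, which turns
  \<open>v * (v - 1 gchoose i)\<close> into \<open>of_nat (Suc i) * (v gchoose Suc i)\<close>,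
  produces the same basis as in \<open>lpart\<close>, with coefficient \<open>0\<close> at
  \<open>k = 0\<close>.\<close>

lemma rhs_expand:
  assumes g: "g \<noteq> 0" and n: "1 \<le> n"
  shows "polef x v * x * (X + g) powr (v - of_nat (eps x)) =
    (\<Sum>k\<le>n. (if x = 1 then - of_nat k else x) * ((v gchoose k) * g ^ k / g ^ eps x * X powr (v - of_nat k))) +
    (if x = 1 then - v * taylor_rem (n - 1) (v - 1) g X else x * taylor_rem n v g X)"
proof (cases "x = 1")
  case False
  then show ?thesis
    by (simp add: polef_def eps_def taylor_rem_def sum_distrib_left algebra_simps)
next
  case True
  obtain m where m: "n = Suc m" using n by (cases n) auto
  have gb: "of_nat (Suc i) * (v gchoose Suc i) = v * (v - 1 gchoose i)" for i
    using gbinomial_absorption[of i v] by simp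
  have "(\<Sum>k\<le>n. - of_nat k * ((v gchoose k) * g ^ k / g * X powr (v - of_nat k))) =
      (\<Sum>i\<le>m. - (of_nat (Suc i) * (v gchoose Suc i)) * g ^ i * X powr (v - of_nat (Suc i)))"
    unfolding m by (subst sum.atMost_Suc_shift) (use g in \<open>simp add: mult_ac del: of_nat_Suc\<close>)
  also have "\<dots> = - v * (\<Sum>i\<le>m. (v - 1 gchoose i) * g ^ i * X powr (v - 1 - of_nat i))"
    unfolding gb sum_distrib_left by (intro sum.cong refl) (simp add: algebra_simps)
  finally show ?thesis
    using True m by (simp add: polef_def eps_def taylor_rem_def algebra_simps)
qed

lemma lpart_difference:
  assumes "g \<noteq> 0" "1 \<le> n"
  shows "lpart n x g v X - x * lpart n x g v (X + g) =
    polef x v * x * (X + g) powr (v - of_nat (eps x)) + lrem n x g v X"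
proof -
  define t where "t k = (v gchoose k) * g ^ k / g ^ eps x * X powr (v - of_nat k)" for k
  define c where "c k = (\<Sum>l\<le>k. of_nat (k choose l) * lam x l)" for k
  have "lpart n x g v X = (\<Sum>k\<le>n. lam x k * t k)"
    by (simp add: lpart_def dcoef_def t_def mult.assoc)
  then have "lpart n x g v X - x * (\<Sum>k\<le>n. c k * t k) = (\<Sum>k\<le>n. (lam x k - x * c k) * t k)"
    by (simp add: sum_distrib_left sum_subtractf left_diff_distrib mult.assoc)
  then show ?thesis
    unfolding c_def lam_rec rhs_expand[OF assms] lpart_shift lrem_def t_def
    by (simp add: right_diff_distrib distrib_left)
qed

lemma holo_dcoef: "holo_on v U \<Longrightarrow> g \<noteq> 0 \<Longrightarrow> holo_on (\<lambda>s. dcoef x g l (v s)) U"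
  unfolding dcoef_def divide_inverse by (intro holo_intros)

lemma holo_polef: "holo_on v U \<Longrightarrow> holo_on (\<lambda>s. polef x (v s)) U"
  unfolding polef_def by (cases "x = 1") (auto intro!: holo_intros)

lemma decaying_eq: "decaying a U R \<Longrightarrow> (\<And>s. a s = b s) \<Longrightarrow> decaying b U R"
proof -
  assume "decaying a U R" and "\<And>s. a s = b s"
  moreover from this(2) have "a = b" by (rule ext)
  ultimately show ?thesis by simp
qed

text \<open>All Taylor remainders occurring here have the same rate, since the order
  \<open>n - l\<close> complements the exponent \<open>v - of_nat l\<close>.\<close>

lemma decaying_lrem:
  assumes v: "holo_on v U" and g: "g \<in> sec" and n: "1 \<le> n"
  shows "decaying (\<lambda>s. real (Suc n) - Re (v s)) U (\<lambda>X s. lrem n x g (v s) X)"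
proof -
  have t: "decaying (\<lambda>s. real (Suc n) - Re (v s)) U (\<lambda>X s. taylor_rem (n - l) (v s - of_nat l) g X)"
    if "l \<le> n" for l
    by (rule decaying_eq[OF decaying_taylor_rem[OF holo_on_diff[OF v holo_on_const] g]])
       (use that in \<open>simp add: of_nat_diff\<close>)
  have s: "decaying (\<lambda>s. real (Suc n) - Re (v s)) U
      (\<lambda>X s. - x * (\<Sum>l\<le>n. dcoef x g l (v s) * taylor_rem (n - l) (v s - of_nat l) g X))"
    by (intro decaying_cmult decaying_sum holo_intros holo_dcoef v t) (use sec_nonzero[OF g] in auto)
  show ?thesis
  proof (cases "x = 1")
    case True
    show ?thesis
      using decaying_diff[OF s decaying_cmult[OF holo_on_uminus[OF v] t[of 1]]] True n
      by (simp add: lrem_def)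
  next
    case False
    show ?thesis
      using decaying_diff[OF s decaying_cmult[OF holo_on_const t[of 0], of x]] False
      by (simp add: lrem_def)
  qed
qed

lemma dcoef_0: "0 < l \<Longrightarrow> dcoef x g l 0 = 0"
  by (simp add: dcoef_def gbinomial_0_left)

lemma dcoef_0_0: "x \<noteq> 0 \<Longrightarrow> g \<noteq> 0 \<Longrightarrow> dcoef x g 0 0 \<noteq> 0"
  by (simp add: dcoef_def lam_zero_nonzero)

text \<open>At \<open>v = 0\<close> the constant \<open>dcoef x g 0 0\<close> solves the difference
  equation exactly. This is what makes the expansions terminate at the special points.\<close>

lemma lrem_0: "g \<in> sec \<Longrightarrow> X \<in> sec \<Longrightarrow> lrem n x g 0 X = 0"
proof -
  assume *: "g \<in> sec" "X \<in> sec"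
  have "dcoef x g l 0 * taylor_rem (n - l) (0 - of_nat l) g X = 0" for l
    using dcoef_0[of l x g] taylor_rem_0[OF *] by (cases "l = 0") auto
  then have "(\<Sum>l\<le>n. dcoef x g l 0 * taylor_rem (n - l) (0 - of_nat l) g X) = 0"
    by (intro sum.neutral ballI)
  then show ?thesis unfolding lrem_def by (simp add: taylor_rem_0[OF *])
qed

text \<open>Minus the sum of \<open>x ^ m * lrem n x g v (X + of_nat m * g)\<close> over all
  \<open>m \<ge> 0\<close>, the correction that turns \<open>lpart\<close> into an exact solution.
  It converges for all \<open>v\<close> with \<open>Re v < real n\<close>, and this is the source of
  the continuation.\<close>

definition lerch_rem :: "nat \<Rightarrow> complex \<Rightarrow> complex \<Rightarrow> complex \<Rightarrow> complex \<Rightarrow> complex" where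
  "lerch_rem n x g v X = - (lrem n x g v X + twsum x g (lrem n x g v) X)"

lemma decaying_lerch_rem:
  assumes U: "open U" and v: "holo_on v U" "\<And>s. s \<in> U \<Longrightarrow> Re (v s) < real n"
    and g: "g \<in> sec" and x: "norm x = 1" and n: "1 \<le> n"
  shows "decaying (\<lambda>s. real n - Re (v s)) U (\<lambda>X s. lerch_rem n x g (v s) X)"
proof -
  note d = decaying_lrem[OF v(1) g n, of x]
  have "decaying (\<lambda>s. real (Suc n) - Re (v s) - 1) U (\<lambda>X s. twsum x g (\<lambda>Y. lrem n x g (v s) Y) X)"
    using v(2) holo_on_continuous[OF v(1)]
    by (intro decaying_twsum[OF U d _ _ g x] continuous_intros) (auto simp: less_diff_eq)
  then have "decaying (\<lambda>s. real n - Re (v s)) U (\<lambda>X s. twsum x g (\<lambda>Y. lrem n x g (v s) Y) X)"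
    by simp
  moreover have "decaying (\<lambda>s. real n - Re (v s)) U (\<lambda>X s. lrem n x g (v s) X)"
    by (rule decaying_weaken[where c = 1]) (rule decaying_eq[OF d], auto)
  ultimately show ?thesis
    unfolding lerch_rem_def by (intro decaying_uminus decaying_add)
qed

lemma lerch_rem_0: "g \<in> sec \<Longrightarrow> X \<in> sec \<Longrightarrow> lerch_rem n x g 0 X = 0"
  using sec_shift[of X g] by (simp add: lerch_rem_def twsum_def lrem_0 del: of_nat_Suc)

lemma powr_twsum_summable:
  assumes "X \<in> insert 0 sec" "g \<in> sec" "norm x = 1" "Re v < - 1"
  shows "summable (\<lambda>m. norm (x ^ Suc m * (X + of_nat (Suc m) * g) powr v))"
  by (rule twsum_summable[OF assms(1-3), where a = "- Re v" and B = "exp (powc * norm v)" and f = "\<lambda>Y. Y powr v"])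
     (use assms norm_powr_le in auto)

lemma lpart_tendsto_0:
  assumes X: "X \<in> sec" and g: "g \<in> sec" and v: "Re v < 0"
  shows "(\<lambda>m. lpart n x g v (X + of_nat m * g)) \<longlonglongrightarrow> 0"
proof -
  have "(\<lambda>m. (X + of_nat m * g) powr (v - of_nat l)) \<longlonglongrightarrow> 0" for l
  proof (rule Lim_null_comparison)
    let ?w = "v - of_nat l"
    show "\<forall>\<^sub>F m in sequentially. norm ((X + of_nat m * g) powr ?w) \<le> exp (powc * norm ?w) * (Re X + real m * Re g) powr Re ?w"
    proof (intro always_eventually allI)
      fix m
      have "X + of_nat m * g \<in> sec" using sec_add_mult[OF X g, of "real m"] by simp
      from norm_powr_le[OF this, of ?w]
      show "norm ((X + of_nat m * g) powr ?w) \<le> exp (powc * norm ?w) * (Re X + real m * Re g) powr Re ?w"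
        by simp
    qed
    have "filterlim (\<lambda>m. Re X + real m * Re g) at_top sequentially"
      using sec_Re_pos[OF g] by real_asymp
    then have "(\<lambda>m. (Re X + real m * Re g) powr Re ?w) \<longlonglongrightarrow> 0"
      using v by (intro tendsto_neg_powr) auto
    then show "(\<lambda>m. exp (powc * norm ?w) * (Re X + real m * Re g) powr Re ?w) \<longlonglongrightarrow> 0"
      by (rule tendsto_mult_right_zero)
  qed
  then have "(\<lambda>m. \<Sum>l\<le>n. dcoef x g l v * (X + of_nat m * g) powr (v - of_nat l)) \<longlonglongrightarrow> (\<Sum>l\<le>n. 0)"
    by (intro tendsto_sum tendsto_mult_right_zero)
  then show ?thesis by (simp add: lpart_def)
qed

text \<open>The difference equation at \<open>X + of_nat m * g\<close>, multiplied by
  \<open>x ^ m\<close> and summed over \<open>m\<close>, telescopes; the boundary term tends to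
  \<open>0\<close> because \<open>Re v < 0\<close>. In the stated range the series on the left
  converges absolutely.\<close>

lemma lerch_expansion:
  assumes X: "X \<in> sec" and g: "g \<in> sec" and x: "norm x = 1" and n: "1 \<le> n"
    and v: "Re v < real (eps x) - 1"
  shows "polef x v * twsum x g (\<lambda>Y. Y powr (v - of_nat (eps x))) X = lpart n x g v X + lerch_rem n x g v X"
proof -
  have g0: "g \<noteq> 0" using sec_nonzero[OF g] .
  have v0: "Re v < 0" using v by (auto simp: eps_def split: if_splits)
  let ?Y = "\<lambda>m. X + of_nat m * g"
  have YS: "?Y m + g = ?Y (Suc m)" for m by (simp add: algebra_simps)
  have Y: "?Y m \<in> sec" for m using sec_add_mult[OF X g, of "real m"] by simp
  let ?F = "\<lambda>m. x ^ m * lpart n x g v (?Y m)"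
  let ?a = "\<lambda>m. x ^ Suc m * ?Y (Suc m) powr (v - of_nat (eps x))"
  let ?b = "\<lambda>m. x ^ m * lrem n x g v (?Y m)"
  have diff: "?F m - ?F (Suc m) = polef x v * ?a m + ?b m" for m
    using lpart_difference[OF g0 n, of x v "?Y m"] unfolding YS
    by (simp add: algebra_simps del: of_nat_Suc)
  have "?F \<longlonglongrightarrow> 0"
    by (rule Lim_null_comparison[OF _ tendsto_norm_zero[OF lpart_tendsto_0[OF X g v0, of n x]]])
       (use x in \<open>auto simp: norm_mult norm_power\<close>)
  then have "(\<lambda>m. ?F m - ?F (Suc m)) sums (?F 0 - 0)" by (rule telescope_sums')
  then have S: "(\<lambda>m. polef x v * ?a m + ?b m) sums lpart n x g v X"
    unfolding diff by simp
  have sa: "summable ?a"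
    by (rule summable_norm_cancel, rule powr_twsum_summable) (use X g x v in auto)
  \<comment> \<open>Here \<open>v\<close> is a fixed number, so \<open>complex ^ unit\<close> is a
    dummy parameter space and all functions are constant in \<open>s\<close>.\<close>
  have d: "decaying (\<lambda>s :: complex ^ unit. real (Suc n) - Re v) UNIV (\<lambda>X s. lrem n x g v X)"
    by (rule decaying_lrem[OF holo_on_const g n])
  have sb: "summable (\<lambda>m. ?b (Suc m))"
    by (rule summable_norm_cancel, rule decaying_twsum_summable[OF d, of undefined X g x])
       (use X g x v0 n in auto)
  then have sb': "summable ?b" by (subst (asm) summable_Suc_iff)
  have "lpart n x g v X = (\<Sum>m. polef x v * ?a m + ?b m)" using S by (rule sums_unique)
  also have "\<dots> = polef x v * (\<Sum>m. ?a m) + (\<Sum>m. ?b m)"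
    using suminf_add[OF summable_mult[OF sa] sb'] suminf_mult[OF sa] by simp
  also have "(\<Sum>m. ?b m) = (\<Sum>m. ?b (Suc m)) + ?b 0" using suminf_split_head[OF sb'] by simp
  finally show ?thesis by (simp add: twsum_def lerch_rem_def)
qed

end

subsection \<open>Expansion of the iterated sums\<close>

lemma double_sum_single:
  fixes f :: "nat \<Rightarrow> nat \<Rightarrow> 'a::comm_monoid_add"
  assumes "\<And>i l. i \<le> n \<Longrightarrow> l \<le> n \<Longrightarrow> (i, l) \<noteq> (a, b) \<Longrightarrow> f i l = 0" "a \<le> n" "b \<le> n"
  shows "(\<Sum>i\<le>n. \<Sum>l\<le>n. f i l) = f a b"
proof -
  have "(\<Sum>l\<le>n. f i l) = (if i = a then f a b else 0)" if "i \<le> n" for i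
  proof (cases "i = a")
    case True
    have "(\<Sum>l\<le>n. f a l) = (\<Sum>l\<in>{b}. f a l)"
      by (rule sum.mono_neutral_right) (use assms in auto)
    then show ?thesis using True by simp
  qed (use assms that in \<open>auto intro!: sum.neutral\<close>)
  then show ?thesis using assms by (simp add: sum.delta)
qed

context sector
begin

definition lerch0 :: "nat \<Rightarrow> complex \<Rightarrow> complex \<Rightarrow> complex \<Rightarrow> complex" where
  "lerch0 n x g v = x * (polef x v * g powr (v - of_nat (eps x)) + (lpart n x g v g + lerch_rem n x g v g))"

lemma lerch0_expansion:
  assumes g: "g \<in> sec" and x: "norm x = 1" and n: "1 \<le> n" and v: "Re v < real (eps x) - 1"
  shows "polef x v * twsum x g (\<lambda>Y. Y powr (v - of_nat (eps x))) 0 = lerch0 n x g v"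
proof -
  let ?f = "\<lambda>Y. Y powr (v - of_nat (eps x))"
  have s: "summable (\<lambda>m. x ^ Suc m * ?f (0 + of_nat (Suc m) * g))"
    by (rule summable_norm_cancel, rule powr_twsum_summable) (use g x v in auto)
  have "twsum x g ?f 0 = (\<Sum>m. x ^ Suc (Suc m) * ?f (0 + of_nat (Suc (Suc m)) * g)) + x * ?f g"
    unfolding twsum_def suminf_split_head[OF s] by simp
  also have "(\<Sum>m. x ^ Suc (Suc m) * ?f (0 + of_nat (Suc (Suc m)) * g)) =
      (\<Sum>m. x * (x ^ Suc m * ?f (g + of_nat (Suc m) * g)))"
    by (simp add: algebra_simps)
  also have "\<dots> = x * twsum x g ?f g"
    unfolding twsum_def
    by (rule suminf_mult, rule summable_norm_cancel, rule powr_twsum_summable) (use g x v in auto)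
  finally have "polef x v * twsum x g ?f 0 = x * (polef x v * ?f g + polef x v * twsum x g ?f g)"
    by (simp add: algebra_simps)
  then show ?thesis unfolding lerch0_def lerch_expansion[OF g g x n v] .
qed

lemma holo_lpart: "holo_on v U \<Longrightarrow> g \<in> sec \<Longrightarrow> X \<in> sec \<Longrightarrow> holo_on (\<lambda>s. lpart n x g (v s) X) U"
  unfolding lpart_def by (intro holo_intros holo_dcoef) (auto dest: sec_nonzero)

lemma holo_lerch0:
  assumes "open U" "holo_on v U" "\<And>s. s \<in> U \<Longrightarrow> Re (v s) < real n" "g \<in> sec" "norm x = 1" "1 \<le> n"
  shows "holo_on (\<lambda>s. lerch0 n x g (v s)) U"
proof -
  have "holo_on (\<lambda>s. lerch_rem n x g (v s) g) U"
    using decaying_lerch_rem[OF assms] assms(4) by (auto simp: decaying_def)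
  then show ?thesis
    unfolding lerch0_def using assms sec_nonzero[of g]
    by (intro holo_intros holo_polef holo_lpart) auto
qed

lemma lpart_0: "X \<in> sec \<Longrightarrow> lpart n x g 0 X = dcoef x g 0 0"
proof -
  assume X: "X \<in> sec"
  have "lpart n x g 0 X = (\<Sum>l\<in>{0}. dcoef x g l 0 * X powr (0 - of_nat l))"
    unfolding lpart_def by (rule sum.mono_neutral_right) (auto simp: dcoef_0)
  then show ?thesis using sec_nonzero[OF X] by simp
qed

text \<open>The value is \<open>lam x 0 / g ^ eps x\<close>: for \<open>x = 1\<close> the separated
  summand is annihilated by \<open>polef x 0 = 0\<close>, and for \<open>x \<noteq> 1\<close> one
  gets \<open>x * (1 + x / (1 - x)) = x / (1 - x)\<close>.\<close>

lemma lerch0_0: "g \<in> sec \<Longrightarrow> norm x = 1 \<Longrightarrow> lerch0 n x g 0 \<noteq> 0"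
  by (auto simp: lerch0_def lpart_0 lerch_rem_0 polef_def eps_def dcoef_def lam_0 sec_nonzero field_simps)

end

locale zeta_data = sector \<delta> T for \<delta> T +
  fixes \<xi> \<gamma> :: "complex ^ 'n::{finite,linorder}"
  assumes \<xi>: "\<And>j. norm (\<xi> $ j) = 1" and \<gamma>: "\<And>j. \<gamma> $ j \<in> sec"
begin

fun psi :: "'n list \<Rightarrow> (complex, 'n) vec \<Rightarrow> complex \<Rightarrow> complex" where
  "psi [] s X = 1"
| "psi (j # js) s X = twsum (\<xi> $ j) (\<gamma> $ j) (\<lambda>Y. Y powr (- (s $ j)) * psi js s Y) X"

text \<open>The inner sum \<open>psi js s X\<close> grows like \<open>X powr (- expo js s)\<close>.\<close>

fun expo :: "'n list \<Rightarrow> (complex, 'n) vec \<Rightarrow> complex" where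
  "expo [] s = 0"
| "expo (j # js) s = expo js s + s $ j - of_nat (eps (\<xi> $ j))"

fun convdom :: "'n list \<Rightarrow> ((complex, 'n) vec) set" where
  "convdom [] = UNIV"
| "convdom (j # js) = convdom js \<inter> {s. 1 - real (eps (\<xi> $ j)) < Re (expo (j # js) s)}"

text \<open>One inequality for each suffix of the list. While \<open>convdom\<close> makes every
  iterated series converge absolutely, \<open>contdom N\<close> only makes the remainders of order
  \<open>N\<close> decay; these sets are convex, increase with \<open>N\<close> and exhaust the
  space.\<close>

fun contdom :: "nat \<Rightarrow> 'n list \<Rightarrow> ((complex, 'n) vec) set" where
  "contdom N [] = UNIV"
| "contdom N (j # js) = contdom N js \<inter> {s. 0 < Re (expo (j # js) s) + real N}"

text \<open>For the last variable the inner sum is the constant 1, so only the term number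
  \<open>0\<close> can produce a pole. Otherwise each term of the inner expansion may, and
  \<open>M\<close> is where this list is cut off.\<close>

definition poles :: "nat \<Rightarrow> 'n \<Rightarrow> 'n list \<Rightarrow> nat set" where
  "poles M j js = (if \<xi> $ j = 1 then if js = [] then {0} else {..M} else {})"

fun den :: "nat \<Rightarrow> 'n list \<Rightarrow> (complex, 'n) vec \<Rightarrow> complex" where
  "den M [] s = 1"
| "den M (j # js) s = den M js s * (\<Prod>k\<in>poles M j js. expo (j # js) s + of_nat k)"

text \<open>
  At the points \<open>s\<close> with \<open>isolated js s k\<close>, the expansion of \<open>den M js s * psi js s X\<close> in powers of
  \<open>X\<close> reduces to its term number \<open>k\<close>, which is constant in \<open>X\<close>. A pole with index \<open>k > 0\<close> is
  reached from a point satisfying \<open>generic\<close>, where the coefficient number \<open>k\<close> does not vanish.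
\<close>

fun isolated :: "'n list \<Rightarrow> (complex, 'n) vec \<Rightarrow> nat \<Rightarrow> bool"
  and generic :: "'n list \<Rightarrow> (complex, 'n) vec \<Rightarrow> nat \<Rightarrow> bool" where
  "isolated [] s k \<longleftrightarrow> k = 0"
| "isolated (j # js) s k \<longleftrightarrow> isolated js s k \<and> s $ j = of_nat (eps (\<xi> $ j)) \<or>
     \<xi> $ j = 1 \<and> expo (j # js) s = - of_nat k \<and> generic js s k"
| "generic [] s k \<longleftrightarrow> False"
| "generic (j # js) s k \<longleftrightarrow>
     isolated js s 0 \<and> s $ j = of_nat (eps (\<xi> $ j)) + 1 / 2 \<and> lam (\<xi> $ j) k \<noteq> 0"

lemma isolated_expo: "isolated js s k \<Longrightarrow> expo js s = - of_nat k"
  by (induction js) auto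

lemma holo_expo: "holo_on (expo js) U"
proof (induction js)
  case Nil
  have "expo [] = (\<lambda>s. 0)" by auto
  then show ?case by (simp add: holo_on_const)
next
  case (Cons j js)
  have "expo (j # js) = (\<lambda>s. expo js s + s $ j - of_nat (eps (\<xi> $ j)))" by auto
  then show ?case using Cons by (auto intro!: holo_intros)
qed

lemma continuous_expo: "continuous_on U (expo js)"
  by (rule holo_on_continuous[OF holo_expo])

lemma holo_den: "holo_on (den M js) U"
proof (induction js)
  case Nil
  have "den M [] = (\<lambda>s. 1)" by auto
  then show ?case by (simp add: holo_on_const)
next
  case (Cons j js)
  have "den M (j # js) = (\<lambda>s. den M js s * (\<Prod>k\<in>poles M j js. expo (j # js) s + of_nat k))" by auto
  then show ?case using Cons by (simp del: expo.simps) (intro holo_intros holo_expo)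
qed

lemma open_contdom: "open (contdom N js)"
  by (induction js)
     (auto simp del: expo.simps intro!: open_Int open_Collect_less continuous_intros continuous_expo)

lemma open_convdom: "open (convdom js)"
  by (induction js)
     (auto simp del: expo.simps intro!: open_Int open_Collect_less continuous_intros continuous_expo)

lemma contdom_mono: "M \<le> N \<Longrightarrow> contdom M js \<subseteq> contdom N js"
  by (induction js) auto

lemma convdom_contdom: "convdom js \<subseteq> contdom N js"
  by (induction js) (auto simp: eps_def split: if_splits)

lemma den_nonzero: "s \<in> convdom js \<Longrightarrow> den M js s \<noteq> 0"
proof (induction js)
  case (Cons j js)
  have "0 < Re (expo (j # js) s)" using Cons.prems by (auto simp: eps_def split: if_splits)
  then have "0 < Re (expo (j # js) s + of_nat k)" for k
    by (simp add: add_pos_nonneg del: expo.simps)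
  then have "expo (j # js) s + of_nat k \<noteq> 0" for k by (metis less_irrefl zero_complex.sel(1))
  then show ?case using Cons by (simp add: poles_def del: expo.simps)
qed simp

text \<open>The behaviour at the points \<open>isolated\<close> and \<open>generic\<close> is part
  of the induction, because \<open>A\<close> and \<open>R\<close> are known only through an
  existence statement and nonvanishing could not be recovered afterwards. The clause on
  \<open>js = []\<close> matches the single pole of the last variable.\<close>

definition expands ::
  "nat \<Rightarrow> nat \<Rightarrow> 'n list \<Rightarrow> (nat \<Rightarrow> (complex, 'n) vec \<Rightarrow> complex) \<Rightarrow> (complex \<Rightarrow> (complex, 'n) vec \<Rightarrow> complex) \<Rightarrow> bool" where
  "expands M N js A R \<longleftrightarrow>
     (\<forall>i U. holo_on (A i) U) \<and>
     decaying (\<lambda>s. Re (expo js s) + real N) (contdom N js) R \<and>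
     (\<forall>i s. js = [] \<and> 0 < i \<longrightarrow> A i s = 0) \<and>
     (\<forall>s\<in>convdom js. \<forall>X\<in>sec. den M js s * psi js s X =
        (\<Sum>i\<le>N. A i s * X powr (- expo js s - of_nat i)) + R X s) \<and>
     (\<forall>s k. k \<le> N \<and> isolated js s k \<longrightarrow> A k s \<noteq> 0 \<and> (\<forall>i\<le>N. i \<noteq> k \<longrightarrow> A i s = 0)) \<and>
     (\<forall>s\<in>contdom N js. \<forall>k\<le>N. isolated js s k \<longrightarrow> (\<forall>X\<in>sec. R X s = 0)) \<and>
     (\<forall>s. \<forall>k\<le>N. generic js s k \<longrightarrow> A k s \<noteq> 0)"

lemma expands_Nil: "expands M N [] (\<lambda>i s. if i = 0 then 1 else 0) (\<lambda>X s. 0)"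
  unfolding expands_def
  by (auto intro!: holo_on_const decaying_zero sec_nonzero simp: if_distrib[of "\<lambda>c. c * _"] sum.delta
      cong: if_cong)

end

section \<open>The inductive step: one further summation\<close>

locale zeta_step = zeta_data \<delta> T \<xi> \<gamma> for \<delta> T \<xi> and \<gamma> :: "complex ^ 'n::{finite,linorder}" +
  fixes M N :: nat and j :: 'n and js :: "'n list"
    and A :: "nat \<Rightarrow> (complex, 'n) vec \<Rightarrow> complex" and R :: "complex \<Rightarrow> (complex, 'n) vec \<Rightarrow> complex"
  assumes NM: "Suc N \<le> M" and exps: "expands M (Suc N) js A R"
begin

abbreviation "x \<equiv> \<xi> $ j"
abbreviation "g \<equiv> \<gamma> $ j"
abbreviation "u \<equiv> expo (j # js)"

text \<open>The term number \<open>i\<close> of the inner expansion, multiplied by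
  \<open>Y powr (- (s $ j))\<close>, is a multiple of
  \<open>Y powr (V i s - of_nat (eps x))\<close>: the summand of the Lerch expansion with parameter
  \<open>V i s\<close>.\<close>

definition V :: "nat \<Rightarrow> (complex, 'n) vec \<Rightarrow> complex" where "V i s = - (u s + of_nat i)"

definition Q :: "nat \<Rightarrow> (complex, 'n) vec \<Rightarrow> complex" where
  "Q i s = (\<Prod>k\<in>poles M j js - {i}. u s + of_nat k)"

definition Qall :: "(complex, 'n) vec \<Rightarrow> complex" where
  "Qall s = (\<Prod>k\<in>poles M j js. u s + of_nat k)"

definition tail :: "(complex, 'n) vec \<Rightarrow> complex \<Rightarrow> complex" where
  "tail s X = twsum x g (\<lambda>Y. Y powr (- (s $ j)) * R Y s) X"

lemma holo_A: "holo_on (A i) U"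
  and R_decaying: "decaying (\<lambda>s. Re (expo js s) + real (Suc N)) (contdom (Suc N) js) R"
  and A_Nil: "js = [] \<Longrightarrow> 0 < i \<Longrightarrow> A i s = 0"
  and psi_expands: "s \<in> convdom js \<Longrightarrow> X \<in> sec \<Longrightarrow> den M js s * psi js s X =
        (\<Sum>i\<le>Suc N. A i s * X powr (- expo js s - of_nat i)) + R X s"
  and A_isolated: "k \<le> Suc N \<Longrightarrow> isolated js s k \<Longrightarrow> A k s \<noteq> 0"
    "k \<le> Suc N \<Longrightarrow> isolated js s k \<Longrightarrow> i \<le> Suc N \<Longrightarrow> i \<noteq> k \<Longrightarrow> A i s = 0"
  and R_isolated: "s \<in> contdom (Suc N) js \<Longrightarrow> k \<le> Suc N \<Longrightarrow> isolated js s k \<Longrightarrow> X \<in> sec \<Longrightarrow> R X s = 0"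
  and A_generic: "k \<le> Suc N \<Longrightarrow> generic js s k \<Longrightarrow> A k s \<noteq> 0"
  using exps unfolding expands_def by blast+

lemma finite_poles: "finite (poles M j js)"
  by (simp add: poles_def)

lemma holo_V: "holo_on (V i) U"
  unfolding V_def[abs_def] by (intro holo_intros holo_expo)

lemma holo_Q: "holo_on (Q i) U"
  unfolding Q_def[abs_def] by (intro holo_intros holo_expo)

lemma holo_Qall: "holo_on Qall U"
  unfolding Qall_def[abs_def] by (intro holo_intros holo_expo)

text \<open>If \<open>x = 1\<close>, the factor number \<open>i\<close> of \<open>Qall\<close>
  equals \<open>polef x (V i s)\<close>, just what the Lerch sum of the term \<open>i\<close>
  requires. It occurs for every \<open>i\<close> that matters: \<open>Suc N \<le> M\<close> covers
  all indices, and for \<open>js = []\<close> only \<open>A 0\<close> is nonzero.\<close>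

lemma A_Qall: "i \<le> Suc N \<Longrightarrow> A i s * Qall s = A i s * Q i s * polef x (V i s)"
proof (cases "x = 1 \<and> i \<in> poles M j js")
  case True
  then have "Qall s = (u s + of_nat i) * Q i s"
    unfolding Qall_def Q_def by (intro prod.remove finite_poles) auto
  then show ?thesis using True by (simp add: polef_def V_def)
next
  case False
  assume i: "i \<le> Suc N"
  show ?thesis
  proof (cases "x = 1")
    case True
    then have "js = []" "0 < i" using False i NM by (auto simp: poles_def split: if_splits)
    then show ?thesis using A_Nil by simp
  qed (simp add: polef_def Qall_def Q_def poles_def)
qed

lemma domain: "s \<in> contdom N (j # js) \<Longrightarrow> s \<in> contdom (Suc N) js"
  using contdom_mono[of N "Suc N" js] by auto

lemma tail_decaying: "decaying (\<lambda>s. Re (expo js s) + Re (s $ j) + real (Suc N)) (contdom N (j # js))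
    (\<lambda>X s. X powr (- (s $ j)) * R X s)"
proof (rule decaying_eq)
  show "decaying (\<lambda>s. - Re (- (s $ j)) + (Re (expo js s) + real (Suc N))) (contdom N (j # js))
      (\<lambda>X s. X powr (- (s $ j)) * R X s)"
    by (intro decaying_mult decaying_powr holo_intros decaying_subset[OF R_decaying]) (use domain in blast)
qed simp

lemma tail_exponent: "s \<in> contdom N (j # js) \<Longrightarrow> 1 < Re (expo js s) + Re (s $ j) + real (Suc N)"
  by auto

lemma tail_continuous: "continuous_on U (\<lambda>s. Re (expo js s) + Re (s $ j) + real (Suc N))"
  by (intro continuous_intros continuous_expo)

text \<open>Summing absolute values loses a full power even if \<open>x \<noteq> 1\<close>, where
  \<open>u\<close> is not lowered by one. Hence the order drops from \<open>Suc N\<close> to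
  \<open>N\<close>; for \<open>x = 1\<close> one power is left over.\<close>

lemma decaying_tail: "decaying (\<lambda>s. Re (u s) + real N) (contdom N (j # js)) (\<lambda>X s. tail s X)"
proof (rule decaying_weaken[where c = "real (eps x)"])
  show "decaying (\<lambda>s. Re (u s) + real N + real (eps x)) (contdom N (j # js)) (\<lambda>X s. tail s X)"
    unfolding tail_def
    by (rule decaying_eq[OF decaying_twsum[OF open_contdom tail_decaying tail_continuous tail_exponent \<gamma> \<xi>]])
       auto
qed simp

lemma holo_tail: "X \<in> insert 0 sec \<Longrightarrow> holo_on (\<lambda>s. tail s X) (contdom N (j # js))"
  unfolding tail_def
  by (rule holo_on_twsum[OF open_contdom tail_decaying tail_continuous tail_exponent _ \<gamma> \<xi>])

lemma step_sum:
  assumes s: "s \<in> convdom (j # js)" and X: "X \<in> insert 0 sec"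
  shows "den M (j # js) s * psi (j # js) s X =
    (\<Sum>i\<le>Suc N. A i s * Q i s * (polef x (V i s) * twsum x g (\<lambda>Y. Y powr (V i s - of_nat (eps x))) X))
    + Qall s * tail s X"
proof -
  have sj: "s \<in> convdom js" using s by simp
  have sN: "s \<in> contdom N (j # js)" using s convdom_contdom by blast
  have d: "den M js s \<noteq> 0" by (rule den_nonzero[OF sj])
  let ?Y = "\<lambda>m. X + of_nat (Suc m) * g"
  let ?f = "\<lambda>i m. x ^ Suc m * ?Y m powr (V i s - of_nat (eps x))"
  let ?r = "\<lambda>m. x ^ Suc m * (?Y m powr (- (s $ j)) * R (?Y m) s)"
  have sf: "summable (?f i)" for i
  proof -
    have "Re (V i s - of_nat (eps x)) < - 1" using s by (auto simp: V_def)
    from summable_norm_cancel[OF powr_twsum_summable[OF X \<gamma> \<xi> this]] show ?thesis .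
  qed
  have sr: "summable ?r"
    by (rule summable_norm_cancel, rule decaying_twsum_summable[OF tail_decaying sN tail_exponent[OF sN] X \<gamma> \<xi>])
  have summand: "x ^ Suc m * (?Y m powr (- (s $ j)) * psi js s (?Y m)) =
      ((\<Sum>i\<le>Suc N. A i s * ?f i m) + ?r m) / den M js s" for m
  proof -
    have Y: "?Y m \<in> sec" using sec_shift[OF X \<gamma>] .
    have e: "?Y m powr (- (s $ j)) * ?Y m powr (- expo js s - of_nat i) = ?Y m powr (V i s - of_nat (eps x))" for i
    proof -
      have "- (s $ j) + (- expo js s - of_nat i) = V i s - of_nat (eps x)" by (simp add: V_def)
      then show ?thesis unfolding powr_add[symmetric] by (rule arg_cong)
    qed
    have psi: "psi js s (?Y m) = ((\<Sum>i\<le>Suc N. A i s * ?Y m powr (- expo js s - of_nat i)) + R (?Y m) s) / den M js s"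
      using psi_expands[OF sj Y] d by (simp add: field_simps del: of_nat_Suc sum.atMost_Suc)
    have "x ^ Suc m * (?Y m powr (- (s $ j)) * psi js s (?Y m)) =
        ((\<Sum>i\<le>Suc N. A i s * (x ^ Suc m * (?Y m powr (- (s $ j)) * ?Y m powr (- expo js s - of_nat i)))) + ?r m) / den M js s"
      unfolding psi by (simp add: sum_distrib_left distrib_left mult_ac del: of_nat_Suc sum.atMost_Suc power_Suc)
    then show ?thesis unfolding e .
  qed
  have "psi (j # js) s X = (\<Sum>m. ((\<Sum>i\<le>Suc N. A i s * ?f i m) + ?r m) / den M js s)"
    unfolding psi.simps twsum_def summand ..
  also have "\<dots> = (\<Sum>m. (\<Sum>i\<le>Suc N. A i s * ?f i m) + ?r m) / den M js s"
    by (intro suminf_divide summable_add summable_sum summable_mult sf sr)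
  also have "(\<Sum>m. (\<Sum>i\<le>Suc N. A i s * ?f i m) + ?r m) = (\<Sum>m. \<Sum>i\<le>Suc N. A i s * ?f i m) + (\<Sum>m. ?r m)"
    by (intro suminf_add[symmetric] summable_sum summable_mult sf sr)
  also have "(\<Sum>m. \<Sum>i\<le>Suc N. A i s * ?f i m) = (\<Sum>i\<le>Suc N. \<Sum>m. A i s * ?f i m)"
    by (intro suminf_sum summable_mult sf)
  also have "\<dots> = (\<Sum>i\<le>Suc N. A i s * (\<Sum>m. ?f i m))"
    by (intro sum.cong refl suminf_mult sf)
  finally have "den M js s * psi (j # js) s X =
      (\<Sum>i\<le>Suc N. A i s * twsum x g (\<lambda>Y. Y powr (V i s - of_nat (eps x))) X) + tail s X"
    using d unfolding twsum_def tail_def by (simp add: field_simps del: of_nat_Suc sum.atMost_Suc psi.simps)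
  moreover have "den M (j # js) s * psi (j # js) s X = Qall s * (den M js s * psi (j # js) s X)"
    by (simp add: Qall_def del: expo.simps psi.simps)
  moreover have "Qall s * (\<Sum>i\<le>Suc N. A i s * twsum x g (\<lambda>Y. Y powr (V i s - of_nat (eps x))) X) =
      (\<Sum>i\<le>Suc N. (A i s * Qall s) * twsum x g (\<lambda>Y. Y powr (V i s - of_nat (eps x))) X)"
    unfolding sum_distrib_left by (simp add: mult_ac del: sum.atMost_Suc)
  moreover have "\<dots> = (\<Sum>i\<le>Suc N. A i s * Q i s * (polef x (V i s) * twsum x g (\<lambda>Y. Y powr (V i s - of_nat (eps x))) X))"
    by (intro sum.cong refl) (simp add: A_Qall mult.assoc)
  ultimately show ?thesis by (simp add: distrib_left del: sum.atMost_Suc psi.simps den.simps)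
qed

text \<open>Two mechanisms single out \<open>k\<close>. Either the inner expansion already reduces
  to the term \<open>k\<close> and \<open>s $ j\<close> leaves its exponent unchanged; or
  \<open>u s = - of_nat k\<close> is a zero of the denominator, so every product containing the
  factor number \<open>k\<close> vanishes and only \<open>Q k s\<close> survives. Both give
  \<open>V k s = 0\<close>, where the Lerch expansion is constant.\<close>

lemma isolated_step:
  assumes k: "k \<le> N" and s: "isolated (j # js) s k"
  shows "V k s = 0" "A k s * Q k s \<noteq> 0"
    "\<And>i. i \<le> Suc N \<Longrightarrow> i \<noteq> k \<Longrightarrow> A i s * Q i s = 0"
    "\<And>X. s \<in> contdom N (j # js) \<Longrightarrow> X \<in> insert 0 sec \<Longrightarrow> Qall s * tail s X = 0"
proof -
  have u: "u s = - of_nat k" using isolated_expo[OF s] .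
  then show "V k s = 0" by (simp add: V_def)
  have "Q k s \<noteq> 0" unfolding Q_def u by (simp add: finite_poles)
  consider "isolated js s k" | "\<xi> $ j = 1" "generic js s k" using s by auto
  then have "A k s \<noteq> 0 \<and> (\<forall>i. i \<le> Suc N \<and> i \<noteq> k \<longrightarrow> A i s * Q i s = 0) \<and>
    (\<forall>X. s \<in> contdom N (j # js) \<and> X \<in> insert 0 sec \<longrightarrow> Qall s * tail s X = 0)"
  proof cases
    case 1
    have "tail s X = 0" if "s \<in> contdom N (j # js)" "X \<in> insert 0 sec" for X
      unfolding tail_def twsum_def
      using R_isolated[OF domain[OF that(1)] _ 1 sec_shift[OF that(2) \<gamma>]] k by (simp del: of_nat_Suc)
    then show ?thesis using A_isolated[OF _ 1] k by auto
  next
    case 2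
    have "js \<noteq> []" using 2 by (cases js) auto
    then have kp: "k \<in> poles M j js" using 2(1) k NM by (auto simp: poles_def)
    have "Qall s = 0" unfolding Qall_def by (rule prod_zero[OF finite_poles]) (use kp u in auto)
    moreover have "Q i s = 0" if "i \<noteq> k" for i
      unfolding Q_def by (rule prod_zero) (use kp u that finite_poles in \<open>auto intro!: bexI[of _ k]\<close>)
    ultimately show ?thesis using A_generic[OF _ 2(2)] k by auto
  qed
  then show "A k s * Q k s \<noteq> 0" "\<And>i. i \<le> Suc N \<Longrightarrow> i \<noteq> k \<Longrightarrow> A i s * Q i s = 0"
    "\<And>X. s \<in> contdom N (j # js) \<Longrightarrow> X \<in> insert 0 sec \<Longrightarrow> Qall s * tail s X = 0"
    using \<open>Q k s \<noteq> 0\<close> by auto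
qed

definition step_coeff :: "nat \<Rightarrow> nat \<Rightarrow> (complex, 'n) vec \<Rightarrow> complex" where
  "step_coeff i l s = A i s * Q i s * dcoef x g l (V i s)"

text \<open>The Lerch expansion of the term \<open>i\<close> contributes the powers with exponent
  \<open>- u s - of_nat (i + l)\<close>, so the new coefficients are a convolution; pairs with
  \<open>i + l > N\<close> go to \<open>step_R\<close>.\<close>

definition step_A :: "nat \<Rightarrow> (complex, 'n) vec \<Rightarrow> complex" where
  "step_A k s = (\<Sum>i\<le>Suc N. \<Sum>l\<le>Suc N. if i + l = k then step_coeff i l s else 0)"

definition step_R :: "complex \<Rightarrow> (complex, 'n) vec \<Rightarrow> complex" where
  "step_R X s = (\<Sum>i\<le>Suc N. A i s * Q i s * lerch_rem (Suc N) x g (V i s) X) +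
     (\<Sum>i\<le>Suc N. \<Sum>l\<le>Suc N. if N < i + l then step_coeff i l s * X powr (- u s - of_nat (i + l)) else 0) +
     Qall s * tail s X"

lemma holo_step_coeff: "holo_on (step_coeff i l) U"
  unfolding step_coeff_def[abs_def]
  by (intro holo_intros holo_A holo_Q holo_dcoef holo_V) (rule sec_nonzero[OF \<gamma>])

lemma holo_step_A: "holo_on (step_A k) U"
proof -
  have "holo_on (\<lambda>s. if i + l = k then step_coeff i l s else 0) U" for i l
    using holo_step_coeff holo_on_const by (cases "i + l = k") auto
  then show ?thesis unfolding step_A_def[abs_def] by (intro holo_on_sum)
qed

lemma V_less: "s \<in> contdom N (j # js) \<Longrightarrow> Re (V i s) < real (Suc N)"
  by (auto simp: V_def)

lemma decaying_step_R: "decaying (\<lambda>s. Re (u s) + real N) (contdom N (j # js)) step_R"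
proof -
  have 1: "decaying (\<lambda>s. Re (u s) + real N) (contdom N (j # js)) (\<lambda>X s. lerch_rem (Suc N) x g (V i s) X)" for i
  proof (rule decaying_weaken[where c = "1 + real i"])
    show "decaying (\<lambda>s. Re (u s) + real N + (1 + real i)) (contdom N (j # js)) (\<lambda>X s. lerch_rem (Suc N) x g (V i s) X)"
      by (rule decaying_eq[OF decaying_lerch_rem[OF open_contdom holo_V V_less \<gamma> \<xi>]])
         (auto simp: V_def simp del: expo.simps)
  qed simp
  have 2: "decaying (\<lambda>s. Re (u s) + real N) (contdom N (j # js))
     (\<lambda>X s. if N < i + l then step_coeff i l s * X powr (- u s - of_nat (i + l)) else 0)" for i l
  proof (cases "N < i + l")
    case True
    have "decaying (\<lambda>s. Re (u s) + real N) (contdom N (j # js)) (\<lambda>X s. X powr (- u s - of_nat (i + l)))"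
    proof (rule decaying_weaken[where c = "real (i + l - N)"])
      show "decaying (\<lambda>s. Re (u s) + real N + real (i + l - N)) (contdom N (j # js)) (\<lambda>X s. X powr (- u s - of_nat (i + l)))"
        by (rule decaying_eq[OF decaying_powr[of "\<lambda>s. - u s - of_nat (i + l)"]])
           (use True in \<open>auto simp: of_nat_diff simp del: expo.simps intro!: holo_intros holo_expo\<close>)
    qed simp
    then show ?thesis using True by (simp del: expo.simps) (intro decaying_cmult holo_step_coeff)
  qed (simp add: decaying_zero)
  show ?thesis
    unfolding step_R_def[abs_def]
    by (intro decaying_add decaying_sum decaying_cmult holo_on_mult holo_A holo_Q holo_Qall 1 2 decaying_tail)
qed

lemma step_expansion:
  assumes s: "s \<in> convdom (j # js)" and X: "X \<in> sec"
  shows "den M (j # js) s * psi (j # js) s X =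
    (\<Sum>i\<le>N. step_A i s * X powr (- u s - of_nat i)) + step_R X s"
proof -
  let ?I = "{..Suc N}"
  define F where "F i l = step_coeff i l s * X powr (- u s - of_nat (i + l))" for i l
  have "Re (V i s) < real (eps x) - 1" for i using s by (auto simp: V_def)
  then have L: "A i s * Q i s * (polef x (V i s) * twsum x g (\<lambda>Y. Y powr (V i s - of_nat (eps x))) X) =
      (\<Sum>l\<in>?I. F i l) + A i s * Q i s * lerch_rem (Suc N) x g (V i s) X" for i
    by (subst lerch_expansion[OF X \<gamma> \<xi>, of "Suc N"])
       (auto simp: lpart_def F_def step_coeff_def V_def sum_distrib_left distrib_left mult_ac
         diff_diff_eq add.assoc simp del: expo.simps sum.atMost_Suc)
  have "(\<Sum>i\<le>N. step_A i s * X powr (- u s - of_nat i)) = (\<Sum>k\<le>N. \<Sum>i\<in>?I. \<Sum>l\<in>?I. if i + l = k then F i l else 0)"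
    unfolding step_A_def sum_distrib_right F_def by (intro sum.cong refl) simp
  also have "\<dots> = (\<Sum>i\<in>?I. \<Sum>k\<le>N. \<Sum>l\<in>?I. if i + l = k then F i l else 0)" by (rule sum.swap)
  also have "\<dots> = (\<Sum>i\<in>?I. \<Sum>l\<in>?I. \<Sum>k\<le>N. if i + l = k then F i l else 0)"
    by (intro sum.cong refl sum.swap)
  also have "\<dots> = (\<Sum>i\<in>?I. \<Sum>l\<in>?I. if i + l \<le> N then F i l else 0)"
    by (intro sum.cong refl) (simp add: sum.delta)
  finally have "(\<Sum>i\<le>N. step_A i s * X powr (- u s - of_nat i)) +
     (\<Sum>i\<in>?I. \<Sum>l\<in>?I. if N < i + l then F i l else 0) = (\<Sum>i\<in>?I. \<Sum>l\<in>?I. F i l)"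
    unfolding sum.distrib[symmetric]
    by (simp only: sum.distrib[symmetric]) (intro sum.cong refl, auto)
  then show ?thesis
    using step_sum[OF s, of X] X unfolding L sum.distrib step_R_def F_def
    by (simp add: algebra_simps del: expo.simps den.simps psi.simps sum.atMost_Suc)
qed

lemma expands_step: "expands M N (j # js) step_A step_R"
  unfolding expands_def
proof (intro conjI allI impI ballI)
  show "holo_on (step_A i) U" for i U by (rule holo_step_A)
  show "decaying (\<lambda>s. Re (u s) + real N) (contdom N (j # js)) step_R" by (rule decaying_step_R)
  show "den M (j # js) s * psi (j # js) s X = (\<Sum>i\<le>N. step_A i s * X powr (- u s - of_nat i)) + step_R X s"
    if "s \<in> convdom (j # js)" "X \<in> sec" for s X using step_expansion[OF that] .
  \<comment> \<open>For \<open>i \<noteq> k\<close> the product \<open>A i s * Q i s\<close>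
    vanishes; for \<open>i = k\<close> the equation \<open>V k s = 0\<close> makes
    \<open>dcoef\<close> vanish for all \<open>l > 0\<close>.\<close>
  have coeff: "step_coeff i l s = 0" if "k \<le> N" "isolated (j # js) s k" "i \<le> Suc N" "(i, l) \<noteq> (k, 0)" for i l k s
    using isolated_step(1,3)[OF that(1,2)] that dcoef_0[of l x g] by (cases "i = k") (auto simp: step_coeff_def)
  have coeff0: "step_coeff k 0 s \<noteq> 0" if "k \<le> N" "isolated (j # js) s k" for k s
  proof -
    have "x \<noteq> 0" using \<xi>[of j] by auto
    then show ?thesis
      using isolated_step(1,2)[OF that] dcoef_0_0[of x g] sec_nonzero[OF \<gamma>, of j]
      by (auto simp: step_coeff_def)
  qed
  have sA: "step_A i s = (if i = k then step_coeff k 0 s else 0)" if "k \<le> N" "isolated (j # js) s k" for i k s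
    unfolding step_A_def by (subst double_sum_single[of _ k 0]) (use coeff[OF that] that in auto)
  show "step_A k s \<noteq> 0" if "k \<le> N \<and> isolated (j # js) s k" for k s
    using sA[of k s] coeff0[of k s] that by simp
  show "step_A i s = 0" if "k \<le> N \<and> isolated (j # js) s k" "i \<le> N" "i \<noteq> k" for i k s
    using sA[of k s] that by simp
  show "step_R X s = 0" if "s \<in> contdom N (j # js)" "k \<le> N" "isolated (j # js) s k" "X \<in> sec" for X s k
  proof -
    have "(\<Sum>i\<le>Suc N. A i s * Q i s * lerch_rem (Suc N) x g (V i s) X) = 0"
      using isolated_step(1,3)[OF that(2,3)] lerch_rem_0[OF \<gamma> that(4)]
      by (intro sum.neutral) (metis atMost_iff mult_eq_0_iff)
    moreover have "(\<Sum>i\<le>Suc N. \<Sum>l\<le>Suc N. if N < i + l then step_coeff i l s * X powr (- u s - of_nat (i + l)) else 0) = 0"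
      by (intro sum.neutral ballI) (use coeff[OF that(2,3)] that(2) in auto)
    ultimately show ?thesis
      using isolated_step(4)[OF that(2,3,1), of X] that(4) unfolding step_R_def by simp
  qed
  show "step_A k s \<noteq> 0" if "k \<le> N" "generic (j # js) s k" for k s
  proof -
    have g: "isolated js s 0" "s $ j = of_nat (eps x) + 1 / 2" "lam x k \<noteq> 0" using that by auto
    \<comment> \<open>The value \<open>1 / 2\<close> stays off all factors, so
      \<open>Q 0 s \<noteq> 0\<close>, and gives \<open>V 0 s = - (1 / 2)\<close>, whose binomial
      coefficients are all nonzero. The coefficient number \<open>k\<close> is then a nonzero
      multiple of \<open>lam x k\<close>.\<close>
    have u: "u s = 1 / 2" using isolated_expo[OF g(1)] g(2) by simp
    have half: "(1 / 2 :: complex) + of_nat i \<noteq> 0" for i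
      using complex_eq_iff[of "1 / 2 + of_nat i" 0] by auto
    have "step_A k s = (\<Sum>i\<le>Suc N. \<Sum>l\<le>Suc N. if i = 0 \<and> l = k then step_coeff 0 k s else 0)"
      unfolding step_A_def using A_isolated(2)[OF _ g(1)]
      by (intro sum.cong refl) (auto simp: step_coeff_def)
    also have "\<dots> = step_coeff 0 k s" by (subst double_sum_single[of _ 0 k]) (use that in auto)
    also have "\<dots> \<noteq> 0"
    proof -
      have "Q 0 s \<noteq> 0" unfolding Q_def u using half finite_poles by simp
      moreover have "(V 0 s gchoose k) \<noteq> 0"
      proof -
        have "(- (1 / 2) :: complex) - of_nat i \<noteq> 0" for i 
        proof -
          have "(- (1 / 2) :: complex) - of_nat i = - (1 / 2 + of_nat i)" by simp
          then show ?thesis using half[of i] by (simp only: neg_equal_0_iff_equal not_False_eq_True)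
        qed
        then show ?thesis unfolding V_def u gbinomial_prod_rev by simp
      qed
      ultimately show ?thesis
        using A_isolated(1)[OF _ g(1)] g(3) sec_nonzero[OF \<gamma>, of j] by (simp add: step_coeff_def dcoef_def)
    qed
    finally show ?thesis .
  qed
qed auto

text \<open>The numerator of the complete sum, which starts at \<open>X = 0\<close>; it is therefore
  assembled from \<open>lerch0\<close> instead of an expansion in powers of
  \<open>X\<close>.\<close>

definition step_G :: "(complex, 'n) vec \<Rightarrow> complex" where
  "step_G s = (\<Sum>i\<le>Suc N. A i s * Q i s * lerch0 (Suc N) x g (V i s)) + Qall s * tail s 0"

lemma holo_step_G: "holo_on step_G (contdom N (j # js))"
  unfolding step_G_def[abs_def]
  by (intro holo_on_add holo_on_sum holo_on_mult holo_A holo_Q holo_Qall holo_tail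
      holo_lerch0 open_contdom holo_V V_less \<gamma> \<xi>) auto

lemma step_G_eq: "s \<in> convdom (j # js) \<Longrightarrow> step_G s = den M (j # js) s * psi (j # js) s 0"
proof -
  assume s: "s \<in> convdom (j # js)"
  then have "Re (V i s) < real (eps x) - 1" for i by (auto simp: V_def)
  then show ?thesis
    unfolding step_sum[OF s insertI1] step_G_def by (subst lerch0_expansion[OF \<gamma> \<xi>, of "Suc N"]) auto
qed

lemma step_G_isolated:
  assumes "k \<le> N" "isolated (j # js) s k" "s \<in> contdom N (j # js)" shows "step_G s \<noteq> 0"
proof -
  have "(\<Sum>i\<le>Suc N. A i s * Q i s * lerch0 (Suc N) x g (V i s)) = (\<Sum>i\<in>{k}. A i s * Q i s * lerch0 (Suc N) x g (V i s))"
    by (rule sum.mono_neutral_right) (use isolated_step(3)[OF assms(1,2)] assms(1) in auto)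
  then show ?thesis
    using isolated_step(1,2)[OF assms(1,2)] lerch0_0[OF \<gamma> \<xi>]
    unfolding step_G_def isolated_step(4)[OF assms(1,2,3) insertI1]
    by (simp del: sum.atMost_Suc)
qed

end

context zeta_data
begin

text \<open>Passing to the inner list raises the order by one, and
  \<open>N + length js \<le> M\<close> keeps all these orders within the range covered by
  \<open>poles M\<close>.\<close>

lemma expands_exists: "N + length js \<le> M \<Longrightarrow> \<exists>A R. expands M N js A R"
proof (induction js arbitrary: N)
  case Nil
  then show ?case using expands_Nil by blast
next
  case (Cons j js)
  then obtain A R where "expands M (Suc N) js A R" by fastforce
  then interpret zeta_step \<delta> T \<xi> \<gamma> M N j js A R
    using Cons.prems by unfold_locales auto
  show ?case using expands_step by blast
qed

lemma continuation_exists: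
  assumes "js \<noteq> []"
  shows "\<exists>G. holo_on G (contdom N js) \<and>
    (\<forall>s\<in>convdom js. G s = den (N + length js) js s * psi js s 0) \<and>
    (\<forall>s\<in>contdom N js. \<forall>k\<le>N. isolated js s k \<longrightarrow> G s \<noteq> 0)"
proof -
  obtain j ks where js: "js = j # ks" using assms by (cases js) auto
  obtain A R where "expands (N + length js) (Suc N) ks A R"
    using expands_exists[of "Suc N" ks "N + length js"] js by auto
  then interpret zeta_step \<delta> T \<xi> \<gamma> "N + length js" N j ks A R
    using js by unfold_locales auto
  show ?thesis unfolding js
    using holo_step_G step_G_eq step_G_isolated unfolding js by blast
qed

end

subsection \<open>The region of absolute convergence\<close>

abbreviation abs_summable :: "('a \<Rightarrow> complex) \<Rightarrow> 'a set \<Rightarrow> bool" where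
  "abs_summable f A \<equiv> (\<lambda>x. norm (f x)) summable_on A"

context zeta_data
begin

text \<open>The offset \<open>X\<close> stands for the contribution of the earlier variables, which
  makes the general term comparable with \<open>psi\<close> by recursion on the list.\<close>

fun summand :: "'n list \<Rightarrow> (complex, 'n) vec \<Rightarrow> complex \<Rightarrow> ('n \<Rightarrow> nat) \<Rightarrow> complex" where
  "summand [] s X m = 1"
| "summand (j # js) s X m = \<xi> $ j ^ m j * (X + of_nat (m j) * \<gamma> $ j) powr (- (s $ j)) *
     summand js s (X + of_nat (m j) * \<gamma> $ j) m"

definition tuples :: "'n list \<Rightarrow> ('n \<Rightarrow> nat) set" where
  "tuples js = (\<Pi>\<^sub>E j\<in>set js. {1..})"

definition head :: "'n \<Rightarrow> (complex, 'n) vec \<Rightarrow> complex \<Rightarrow> nat \<Rightarrow> complex" where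
  "head j s X n = \<xi> $ j ^ n * (X + of_nat n * \<gamma> $ j) powr (- (s $ j))"

lemma summand_cong: "(\<And>i. i \<in> set js \<Longrightarrow> m i = m' i) \<Longrightarrow> summand js s X m = summand js s X m'"
  by (induction js arbitrary: X) auto

lemma step_sec: "X \<in> insert 0 sec \<Longrightarrow> 1 \<le> n \<Longrightarrow> X + of_nat n * \<gamma> $ j \<in> sec"
  using sec_shift[OF _ \<gamma>, of X "n - 1" j] by (cases n) auto

lemma head_nonzero: "X \<in> insert 0 sec \<Longrightarrow> 1 \<le> n \<Longrightarrow> head j s X n \<noteq> 0"
  using sec_nonzero[OF step_sec, of X n j] \<xi>[of j] by (auto simp: head_def)

lemma summand_split:
  assumes j: "j \<notin> set js" and sm: "abs_summable (summand (j # js) s X) (tuples (j # js))"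
  defines "F \<equiv> \<lambda>(n, f). head j s X n * summand js s (X + of_nat n * \<gamma> $ j) f"
  shows "abs_summable F ({1..} \<times> tuples js)"
    and "infsum (summand (j # js) s X) (tuples (j # js)) = infsum F ({1..} \<times> tuples js)"
proof -
  let ?h = "\<lambda>(n, f). f(j := n)"
  have im: "tuples (j # js) = ?h ` ({1..} \<times> tuples js)"
    unfolding tuples_def by (simp add: PiE_insert_eq)
  have inj: "inj_on ?h ({1..} \<times> tuples js)"
    unfolding tuples_def using inj_combinator[of j "set js" "\<lambda>_. {1::nat..}"] j by simp
  have eq: "(summand (j # js) s X \<circ> ?h) p = F p" for p
  proof -
    have "summand js s Y ((snd p)(j := fst p)) = summand js s Y (snd p)" for Y
      by (rule summand_cong) (use j in auto)
    then show ?thesis by (simp add: F_def head_def case_prod_unfold)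
  qed
  show "abs_summable F ({1..} \<times> tuples js)"
    using sm unfolding im summable_on_reindex[OF inj] by (simp add: eq[symmetric] comp_def)
  show "infsum (summand (j # js) s X) (tuples (j # js)) = infsum F ({1..} \<times> tuples js)"
    unfolding im infsum_reindex[OF inj] using eq by (intro infsum_cong)
qed

text \<open>Sections of an absolutely summable family on a product are absolutely summable, and the
  factor \<open>head j s X n\<close> can be divided out since the base of its power lies in the
  sector.\<close>

lemma summand_section:
  assumes j: "j \<notin> set js" and sm: "abs_summable (summand (j # js) s X) (tuples (j # js))"
    and X: "X \<in> insert 0 sec" and n: "1 \<le> n"
  shows "abs_summable (summand js s (X + of_nat n * \<gamma> $ j)) (tuples js)"
proof -
  have "abs_summable (\<lambda>f. head j s X n * summand js s (X + of_nat n * \<gamma> $ j) f) (tuples js)"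
    using summand_split(1)[OF j sm] n
      Infinite_Sum.abs_summable_on_Sigma_iff[of "\<lambda>(n, f). head j s X n * summand js s (X + of_nat n * \<gamma> $ j) f"
        "{1..}" "\<lambda>_. tuples js"] by auto
  then have "(\<lambda>f. inverse (norm (head j s X n)) * norm (head j s X n * summand js s (X + of_nat n * \<gamma> $ j) f))
      summable_on tuples js"
    by (rule summable_on_cmult_right)
  then show ?thesis using head_nonzero[OF X n, of j s] by (simp add: norm_mult field_simps)
qed

text \<open>Fubini for absolutely summable families, one variable at a time;
  \<open>summand_section\<close> hands the summability down to the inner families.\<close>

lemma infsum_summand:
  "distinct js \<Longrightarrow> X \<in> insert 0 sec \<Longrightarrow> abs_summable (summand js s X) (tuples js) \<Longrightarrow>
    infsum (summand js s X) (tuples js) = psi js s X"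
proof (induction js arbitrary: X)
  case Nil
  then show ?case by (simp add: tuples_def)
next
  case (Cons j js)
  have j: "j \<notin> set js" and d: "distinct js" using Cons.prems by auto
  note sm = Cons.prems(3) and X = Cons.prems(2)
  have range: "{1..} = range Suc" by (simp add: atLeast_Suc_greaterThan greaterThan_0)
  let ?Y = "\<lambda>n. X + of_nat n * \<gamma> $ j"
  let ?G = "\<lambda>n f. head j s X n * summand js s (?Y n) f"
  have S: "abs_summable (\<lambda>(n, f). ?G n f) ({1..} \<times> tuples js)"
    using summand_split(1)[OF j sm] .
  have inner: "infsum (?G n) (tuples js) = head j s X n * psi js s (?Y n)" if n: "n \<in> {1..}" for n
  proof -
    have "infsum (summand js s (?Y n)) (tuples js) = psi js s (?Y n)"
      using Cons.IH[OF d _ summand_section[OF j sm X]] step_sec[OF X] n by auto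
    then show ?thesis by (simp add: infsum_cmult_right')
  qed
  have "infsum (summand (j # js) s X) (tuples (j # js)) = infsum (\<lambda>(n, f). ?G n f) ({1..} \<times> tuples js)"
    by (rule summand_split(2)[OF j sm])
  also have "\<dots> = (\<Sum>\<^sub>\<infinity>n\<in>{1..}. infsum (?G n) (tuples js))"
    by (rule infsum_Sigma'_banach[symmetric]) (rule abs_summable_summable[OF S])
  also have "\<dots> = (\<Sum>\<^sub>\<infinity>n\<in>{1..}. head j s X n * psi js s (?Y n))"
    by (rule infsum_cong) (rule inner)
  also have "\<dots> = (\<Sum>\<^sub>\<infinity>n\<in>range Suc. head j s X n * psi js s (?Y n))"
    unfolding range ..
  also have "\<dots> = (\<Sum>\<^sub>\<infinity>n. head j s X (Suc n) * psi js s (?Y (Suc n)))"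
    by (subst infsum_reindex) (auto simp: comp_def)
  also have "\<dots> = (\<Sum>n. head j s X (Suc n) * psi js s (?Y (Suc n)))"
  proof -
    have "(\<lambda>n. infsum (?G n) (tuples js)) summable_on {1..}"
      by (rule summable_on_Sigma_banach[of ?G])
         (rule abs_summable_summable[OF S])
    then have "(\<lambda>n. head j s X n * psi js s (?Y n)) summable_on {1..}"
      using inner by (subst (asm) summable_on_cong) auto
    then have "(\<lambda>n. head j s X (Suc n) * psi js s (?Y (Suc n))) summable_on UNIV"
      unfolding range by (simp add: summable_on_reindex comp_def)
    then show ?thesis using has_sum_imp_sums[OF has_sum_infsum] sums_unique by blast
  qed
  also have "\<dots> = psi (j # js) s X"
    by (simp add: twsum_def head_def mult.assoc)
  finally show ?case .
qed

text \<open>On a dyadic box all partial sums have real part between fixed multiples of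
  \<open>2 ^ n\<close>, so powers with exponents of either sign are bounded below by a multiple of
  the same power of \<open>2 ^ n\<close>. \<open>D\<close> varies in the induction because the
  offset grows with each variable.\<close>

lemma summand_lower_bound:
  "\<exists>c>0. \<forall>n m X. (\<forall>i\<in>set js. 2 ^ n \<le> m i \<and> m i < 2 ^ Suc n) \<and> X \<in> insert 0 sec \<and> Re X \<le> D * 2 ^ n \<longrightarrow>
     c * (2 ^ n) powr (- (\<Sum>j\<leftarrow>js. Re (s $ j))) \<le> norm (summand js s X m)"
proof (induction js arbitrary: D)
  case Nil
  show ?case by (intro exI[of _ 1]) auto
next
  case (Cons j js)
  \<comment> \<open>The offset is at most \<open>D * 2 ^ n\<close>, and fewer than
    \<open>2 * 2 ^ n\<close> steps of real part \<open>Re (\<gamma> $ j)\<close> are added;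
    \<open>max D 0\<close> keeps \<open>C\<close> positive.\<close>
  define C where "C = max D 0 + 2 * Re (\<gamma> $ j)"
  define \<sigma> where "\<sigma> = - Re (s $ j)"
  obtain c where c: "c > 0" "\<And>n m X. (\<forall>i\<in>set js. 2 ^ n \<le> m i \<and> m i < 2 ^ Suc n) \<and> X \<in> insert 0 sec \<and> Re X \<le> C * 2 ^ n \<Longrightarrow>
     c * (2 ^ n) powr (- (\<Sum>j\<leftarrow>js. Re (s $ j))) \<le> norm (summand js s X m)"
    using Cons.IH[of C] by blast
  have g: "0 < Re (\<gamma> $ j)" "\<delta> \<le> Re (\<gamma> $ j)" using sec_Re_pos[OF \<gamma>] \<gamma>[of j] by (auto simp: sec_def)
  have C0: "0 < C" using g by (simp add: C_def)
  define b where "b = exp (- (powc * norm (s $ j))) * min (\<delta> powr \<sigma>) (C powr \<sigma>)"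
  have b: "0 < b" using \<delta>_pos C0 by (simp add: b_def)
  show ?case
  proof (intro exI[of _ "b * c"] conjI allI impI)
    show "0 < b * c" using b c by simp
    fix n :: nat and m :: "'n \<Rightarrow> nat" and X
    assume *: "(\<forall>i\<in>set (j # js). 2 ^ n \<le> m i \<and> m i < 2 ^ Suc n) \<and> X \<in> insert 0 sec \<and> Re X \<le> D * 2 ^ n"
    let ?p = "2 ^ n :: real"
    define Y where "Y = X + of_nat (m j) * \<gamma> $ j"
    have mj: "?p \<le> real (m j)" "real (m j) \<le> 2 * ?p"
    proof -
      have "2 ^ n \<le> m j" "m j \<le> 2 * 2 ^ n" using * by auto
      from this[THEN of_nat_mono[where 'a = real]] show "?p \<le> real (m j)" "real (m j) \<le> 2 * ?p" by auto
    qed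
    have "1 \<le> m j" using mj(1) one_le_power[of "2 :: real" n] by linarith
    then have Y: "Y \<in> sec" unfolding Y_def using * step_sec by blast
    have X0: "0 \<le> Re X" using * sec_Re_pos[of X] by auto
    have Y1: "\<delta> * ?p \<le> Re Y"
    proof -
      have "\<delta> * ?p \<le> real (m j) * Re (\<gamma> $ j)" using mj g \<delta>_pos by (subst mult.commute) (intro mult_mono, auto)
      then show ?thesis using X0 by (simp add: Y_def)
    qed
    have Y2: "Re Y \<le> C * ?p"
    proof -
      have "real (m j) * Re (\<gamma> $ j) \<le> 2 * ?p * Re (\<gamma> $ j)" using mj g by (intro mult_right_mono) auto
      moreover have "Re X \<le> max D 0 * ?p"
        by (rule order_trans[of _ "D * ?p"]) (use * in \<open>auto intro!: mult_right_mono\<close>)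
      ultimately show ?thesis by (simp add: Y_def C_def algebra_simps)
    qed
    have "min (\<delta> powr \<sigma>) (C powr \<sigma>) * ?p powr \<sigma> \<le> Re Y powr \<sigma>"
    proof (cases "0 \<le> \<sigma>")
      case True
      then have "(\<delta> * ?p) powr \<sigma> \<le> Re Y powr \<sigma>" using Y1 \<delta>_pos by (intro powr_mono2) auto
      then have "\<delta> powr \<sigma> * ?p powr \<sigma> \<le> Re Y powr \<sigma>" using \<delta>_pos by (simp add: powr_mult)
      moreover have "min (\<delta> powr \<sigma>) (C powr \<sigma>) * ?p powr \<sigma> \<le> \<delta> powr \<sigma> * ?p powr \<sigma>"
        by (intro mult_right_mono) auto
      ultimately show ?thesis by linarith
    next
      case False
      then have "(C * ?p) powr \<sigma> \<le> Re Y powr \<sigma>" using Y2 sec_Re_pos[OF Y] by (intro powr_mono2') auto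
      then have "C powr \<sigma> * ?p powr \<sigma> \<le> Re Y powr \<sigma>" using C0 by (simp add: powr_mult)
      moreover have "min (\<delta> powr \<sigma>) (C powr \<sigma>) * ?p powr \<sigma> \<le> C powr \<sigma> * ?p powr \<sigma>"
        by (intro mult_right_mono) auto
      ultimately show ?thesis by linarith
    qed
    then have "exp (- (powc * norm (s $ j))) * (min (\<delta> powr \<sigma>) (C powr \<sigma>) * ?p powr \<sigma>) \<le>
        exp (- (powc * norm (s $ j))) * Re Y powr \<sigma>"
      by (rule mult_left_mono) simp
    also have "\<dots> \<le> norm (Y powr (- (s $ j)))"
      using norm_powr_ge[OF Y, of "- (s $ j)"] by (simp add: \<sigma>_def)
    finally have 1: "b * ?p powr \<sigma> \<le> norm (Y powr (- (s $ j)))" by (simp add: b_def mult.assoc)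
    have 2: "c * ?p powr (- (\<Sum>j\<leftarrow>js. Re (s $ j))) \<le> norm (summand js s Y m)"
      using * Y Y2 by (intro c(2)) auto
    have "(b * ?p powr \<sigma>) * (c * ?p powr (- (\<Sum>j\<leftarrow>js. Re (s $ j)))) \<le> norm (Y powr (- (s $ j))) * norm (summand js s Y m)"
      using 1 2 c(1) by (intro mult_mono) auto
    also have "\<dots> = norm (summand (j # js) s X m)"
      using \<xi>[of j] by (simp add: norm_mult norm_power Y_def)
    also have "(b * ?p powr \<sigma>) * (c * ?p powr (- (\<Sum>j\<leftarrow>js. Re (s $ j)))) =
        b * c * ?p powr (\<sigma> + - (\<Sum>j\<leftarrow>js. Re (s $ j)))"
      unfolding powr_add by (simp add: mult_ac)
    finally show "b * c * ?p powr (- (\<Sum>j\<leftarrow>j # js. Re (s $ j))) \<le> norm (summand (j # js) s X m)"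
      by (simp add: \<sigma>_def algebra_simps)
  qed
qed

text \<open>
  Each of the disjoint dyadic boxes contributes a bounded amount from below unless the total
  exponent exceeds the number of summation variables.
\<close>

lemma exponent_sum_gt:
  fixes s :: "(complex, 'n) vec"
  assumes js: "js \<noteq> []" "distinct js" and X: "X \<in> insert 0 sec"
    and sm: "abs_summable (summand js s X) (tuples js)"
  shows "real (length js) < (\<Sum>j\<leftarrow>js. Re (s $ j))"
proof (rule ccontr)
  assume not: "\<not> ?thesis"
  obtain c where c: "c > 0" "\<And>n m. (\<forall>i\<in>set js. 2 ^ n \<le> m i \<and> m i < 2 ^ Suc n) \<Longrightarrow> Re X \<le> Re X * 2 ^ n \<Longrightarrow>
     c * (2 ^ n) powr (- (\<Sum>j\<leftarrow>js. Re (s $ j))) \<le> norm (summand js s X m)"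
    using summand_lower_bound[of js "Re X" s] X by metis
  define box where "box n = (\<Pi>\<^sub>E j\<in>set js. {2 ^ n..<2 ^ Suc n :: nat})" for n
  have fin: "finite (box n)" for n unfolding box_def by (intro finite_PiE) auto
  have card: "real (card (box n)) = (2 ^ n) ^ length js" for n
    by (simp add: box_def card_PiE distinct_card[OF js(2)])
  have sub: "box n \<subseteq> tuples js" for n
  proof -
    have "1 \<le> m" if "2 ^ n \<le> m" for m :: nat using that one_le_power[of "2 :: nat" n] by linarith
    then show ?thesis unfolding box_def tuples_def by (intro PiE_mono) auto
  qed
  have lower: "c \<le> (\<Sum>m\<in>box n. norm (summand js s X m))" for n
  proof -
    have "Re X * 1 \<le> Re X * 2 ^ n" using X sec_Re_pos[of X] by (intro mult_left_mono) auto
    then have "c * (2 ^ n) powr (- (\<Sum>j\<leftarrow>js. Re (s $ j))) \<le> norm (summand js s X m)" if "m \<in> box n" for m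
      using that by (intro c(2)) (auto simp: box_def PiE_iff)
    moreover have "c * (2 ^ n) powr (- real (length js)) \<le> c * (2 ^ n) powr (- (\<Sum>j\<leftarrow>js. Re (s $ j)))"
      using not c(1) by (intro mult_left_mono powr_mono) auto
    ultimately have "(\<Sum>m\<in>box n. c * (2 ^ n) powr (- real (length js))) \<le> (\<Sum>m\<in>box n. norm (summand js s X m))"
      by (intro sum_mono) fastforce
    then show ?thesis by (simp add: card powr_minus powr_realpow field_simps)
  qed
  have disj: "box a \<inter> box b = {}" if "a < b" for a b
  proof -
    obtain j where j: "j \<in> set js" using js(1) by (cases js) auto
    have "2 ^ Suc a \<le> (2 ^ b :: nat)" using that by (intro power_increasing) auto
    moreover have "2 ^ b \<le> m j \<and> m j < 2 ^ Suc a" if "m \<in> box a \<inter> box b" for m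
      using that j by (auto simp: box_def PiE_iff simp del: power_Suc)
    ultimately show ?thesis by (meson disjoint_iff_not_equal equals0I leD le_less_trans less_le_trans)
  qed
  have disj': "box a \<inter> box b = {}" if "a \<noteq> b" for a b
    using disj[of a b] disj[of b a] that by (cases "a < b") auto
  define S where "S = infsum (\<lambda>m. norm (summand js s X m)) (tuples js)"
  have "real K * c \<le> S" for K
  proof -
    have "real K * c \<le> (\<Sum>n<K. \<Sum>m\<in>box n. norm (summand js s X m))"
      using sum_bounded_below[of "{..<K}" c] lower by auto
    also have "\<dots> = (\<Sum>m\<in>(\<Union>n<K. box n). norm (summand js s X m))"
      by (rule sum.UNION_disjoint[symmetric]) (use fin disj' in auto)
    also have "\<dots> \<le> S"
      unfolding S_def by (rule finite_sum_le_infsum[OF sm]) (use fin sub in auto)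
    finally show ?thesis .
  qed
  moreover obtain K where "S < real K * c" using reals_Archimedean3[OF c(1)] by blast
  ultimately show False using not_less by blast
qed

lemma Re_expo: "Re (expo js s) = (\<Sum>j\<leftarrow>js. Re (s $ j)) - (\<Sum>j\<leftarrow>js. real (eps (\<xi> $ j)))"
  by (induction js) auto

text \<open>Absolute values do not see the twists, so the total exponent of every suffix exceeds its
  number of variables. The later variables lower \<open>expo\<close> by at most one each, which
  leaves the inequality of \<open>convdom\<close>.\<close>

lemma summable_imp_convdom:
  "distinct js \<Longrightarrow> X \<in> insert 0 sec \<Longrightarrow> abs_summable (summand js s X) (tuples js) \<Longrightarrow> s \<in> convdom js"
proof (induction js arbitrary: X)
  case (Cons j js)
  have "s \<in> convdom js"
    using Cons.prems summand_section[of j js s X 1] step_sec[of X 1 j] by (intro Cons.IH[of "X + \<gamma> $ j"]) auto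
  moreover have "(\<Sum>j\<leftarrow>js. real (eps (\<xi> $ j))) \<le> real (length js)"
    by (induction js) (auto simp: eps_def)
  moreover have "1 + real (length js) < Re (s $ j) + (\<Sum>j\<leftarrow>js. Re (s $ j))"
    using exponent_sum_gt[OF _ Cons.prems] by simp
  ultimately show ?case using Re_expo[of js s] by auto
qed simp

definition indices :: "'n list" where
  "indices = sorted_list_of_set UNIV"

lemma summand_sorted:
  "sorted_wrt (<) js \<Longrightarrow> summand js s X m =
    (\<Prod>j\<in>set js. \<xi> $ j ^ m j * (X + (\<Sum>i\<in>{i\<in>set js. i \<le> j}. of_nat (m i) * \<gamma> $ i)) powr (- (s $ j)))"
proof (induction js arbitrary: X)
  case (Cons j js)
  have j: "\<And>i. i \<in> set js \<Longrightarrow> j < i" and s: "sorted_wrt (<) js" using Cons.prems by auto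
  then have nj: "j \<notin> set js" by blast
  have 1: "{i \<in> set (j # js). i \<le> j} = {j}" using j by force
  have 2: "{i \<in> set (j # js). i \<le> k} = insert j {i \<in> set js. i \<le> k}" if "k \<in> set js" for k
    using j[OF that] by auto
  have 3: "(\<Sum>i\<in>{i \<in> set (j # js). i \<le> k}. of_nat (m i) * \<gamma> $ i) =
      of_nat (m j) * \<gamma> $ j + (\<Sum>i\<in>{i \<in> set js. i \<le> k}. of_nat (m i) * \<gamma> $ i)" if "k \<in> set js" for k
    unfolding 2[OF that] using nj by (subst sum.insert) auto
  define f where "f k = \<xi> $ k ^ m k *
    (X + (\<Sum>i\<in>{i\<in>set (j # js). i \<le> k}. of_nat (m i) * \<gamma> $ i)) powr (- (s $ k))" for k
  have "f j = \<xi> $ j ^ m j * (X + of_nat (m j) * \<gamma> $ j) powr (- (s $ j))"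
    unfolding f_def 1 by simp
  moreover have "(\<Prod>k\<in>set js. f k) = summand js s (X + of_nat (m j) * \<gamma> $ j) m"
    unfolding Cons.IH[OF s] f_def by (intro prod.cong refl) (simp only: 3 add.assoc)
  moreover have "(\<Prod>k\<in>set (j # js). f k) = f j * (\<Prod>k\<in>set js. f k)"
    using nj by simp
  ultimately have "(\<Prod>k\<in>set (j # js). f k) = summand (j # js) s X m" by simp
  then show ?case unfolding f_def by (rule sym)
qed simp

lemma indices_props: "sorted_wrt (<) indices" "distinct indices" "set indices = UNIV" "indices \<noteq> []"
proof -
  show "sorted_wrt (<) indices" "distinct indices" and u: "set indices = UNIV"
    by (simp_all add: indices_def)
  then show "indices \<noteq> []" by fastforce
qed

lemma mzeta_term_eq: "mzeta_term \<xi> \<gamma> s m = summand indices s 0 m"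
  unfolding mzeta_term_def summand_sorted[OF indices_props(1)] indices_props(3)
  by (simp add: atMost_def)

lemma pos_tuples_eq: "pos_tuples = tuples indices"
  by (auto simp: pos_tuples_def tuples_def indices_props PiE_UNIV_domain)

lemma abs_conv_region_subset: "abs_conv_region \<xi> \<gamma> \<subseteq> convdom indices"
  unfolding abs_conv_region_def mzeta_term_eq pos_tuples_eq
  using summable_imp_convdom[OF indices_props(2), of 0] by auto

lemma mzeta_eq_psi: "s \<in> abs_conv_region \<xi> \<gamma> \<Longrightarrow> mzeta \<xi> \<gamma> s = psi indices s 0"
  unfolding abs_conv_region_def mzeta_def mzeta_term_eq pos_tuples_eq
  using infsum_summand[OF indices_props(2), of 0] by auto

end

subsection \<open>The continuation and its singular hyperplanes\<close>

lemma closure_line: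
  fixes p v :: "complex ^ 'n::finite"
  assumes "e > 0" "\<And>t. 0 < t \<Longrightarrow> t < e \<Longrightarrow> p + of_real t *s v \<in> A"
  shows "p \<in> closure A"
  unfolding closure_approachable
proof (intro allI impI)
  fix d :: real assume d: "0 < d"
  define t where "t = min (e / 2) (d / (2 * (norm v + 1)))"
  have t: "0 < t" "t < e" using assms(1) d by (auto simp: t_def add_nonneg_pos)
  have "t * norm v \<le> d / (2 * (norm v + 1)) * norm v" by (intro mult_right_mono) (auto simp: t_def)
  also have "\<dots> < d" using d by (simp add: divide_simps add_nonneg_pos)
  finally have "dist (p + of_real t *s v) p < d" using t by (simp add: dist_norm norm_vector_scalar_mult)
  then show "\<exists>y\<in>A. dist y p < d" using assms(2)[OF t] by blast
qed

lemma open_line_ball: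
  fixes U :: "(complex ^ 'n::finite) set"
  assumes "open U" "p \<in> U" obtains e where "e > 0" "\<And>z. norm z < e \<Longrightarrow> p + z *s v \<in> U"
proof -
  have "(0 :: complex) \<in> {z. p + z *s v \<in> U}" using assms(2) by simp
  then obtain e where "e > 0" "ball 0 e \<subseteq> {z. p + z *s v \<in> U}"
    using openE[OF open_line[OF assms(1)]] by blast
  then show ?thesis by (intro that[of e]) (auto simp: subset_iff)
qed

lemma notin_singular_set:
  assumes "open U" "p \<in> U" "holo_on g U" "U \<subseteq> closure {z \<in> U. F z = g z}"
  shows "p \<notin> singular_set F"
  using assms unfolding singular_set_def by blast

context zeta_data
begin

definition weight :: "'n list \<Rightarrow> (complex, 'n) vec \<Rightarrow> complex" where
  "weight ks v = (\<Sum>j\<leftarrow>ks. v $ j)"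

lemma expo_line: "expo ks (p + z *s v) = expo ks p + z * weight ks v"
  by (induction ks) (auto simp: weight_def algebra_simps)

lemma expo_convex: "a + b = 1 \<Longrightarrow> expo ks (a *\<^sub>R x + b *\<^sub>R y) = of_real a * expo ks x + of_real b * expo ks y"
proof (induction ks)
  case (Cons j ks)
  have "of_nat (eps (\<xi> $ j)) = (of_real a + of_real b) * (of_nat (eps (\<xi> $ j)) :: complex)"
    using Cons.prems by (simp flip: of_real_add)
  moreover have "(a *\<^sub>R x + b *\<^sub>R y) $ j = of_real a * x $ j + of_real b * y $ j"
    by (simp add: scaleR_conv_of_real[where 'a = complex])
  ultimately show ?case using Cons by (simp only: expo.simps) (simp add: algebra_simps)
qed simp

lemma convex_contdom: "convex (contdom N ks)"
proof (induction ks)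
  case (Cons j ks)
  have "convex {s. 0 < Re (expo (j # ks) s) + real N}"
  proof (rule convexI)
    fix x y :: "(complex, 'n) vec" and a b :: real
    assume *: "x \<in> {s. 0 < Re (expo (j # ks) s) + real N}" "y \<in> {s. 0 < Re (expo (j # ks) s) + real N}"
      "0 \<le> a" "0 \<le> b" "a + b = 1"
    let ?P = "\<lambda>s. Re (expo (j # ks) s) + real N"
    have "real N = (a + b) * real N" using *(5) by simp
    then have "?P (a *\<^sub>R x + b *\<^sub>R y) = a * ?P x + b * ?P y"
      unfolding expo_convex[OF *(5)] by (simp add: distrib_left distrib_right del: expo.simps)
    moreover have "0 < a * ?P x + b * ?P y"
      using * by (cases "a = 0") (auto simp del: expo.simps intro!: add_pos_nonneg mult_nonneg_nonneg)
    ultimately show "a *\<^sub>R x + b *\<^sub>R y \<in> {s. 0 < Re (expo (j # ks) s) + real N}" by simp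
  qed
  then show ?case using Cons by (auto intro: convex_Int)
qed simp

lemma ex_contdom: "\<exists>N. s \<in> contdom N ks"
proof (induction ks)
  case (Cons j ks)
  then obtain N where N: "s \<in> contdom N ks" by blast
  obtain K :: nat where K: "- Re (expo (j # ks) s) < real K" using reals_Archimedean2 by blast
  have "s \<in> contdom (max N K) (j # ks)"
    using N K contdom_mono[of N "max N K" ks] by (auto simp del: expo.simps)
  then show ?case by blast
qed simp

lemma convdom_nonempty: "\<exists>s. s \<in> convdom ks"
proof
  have "0 \<le> Re (expo ks (\<chi> i. 2)) \<and> (\<chi> i. 2) \<in> convdom ks"
    by (induction ks) (auto simp: eps_def)
  then show "(\<chi> i. 2) \<in> convdom ks" ..
qed

text \<open>The linear factors are indexed by suffix and pole number, so that a single one can be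
  taken out of the product.\<close>

fun factors :: "nat \<Rightarrow> 'n list \<Rightarrow> ('n list \<times> nat) set" where
  "factors M [] = {}"
| "factors M (j # js) = factors M js \<union> {j # js} \<times> poles M j js"

lemma finite_factors: "finite (factors M js)"
  by (induction js) (auto simp: poles_def)

lemma factors_suffix: "(ks, k) \<in> factors M js \<Longrightarrow> ks \<noteq> [] \<and> (\<exists>pre. js = pre @ ks)"
proof (induction js)
  case (Cons j js)
  then show ?case by (cases "(ks, k) \<in> factors M js") (auto intro: exI[of _ "j # _"] exI[of _ "[]"])
qed simp

lemma den_factors: "den M js s = (\<Prod>(ks, k)\<in>factors M js. expo ks s + of_nat k)"
proof (induction js)
  case (Cons j js)
  have "factors M js \<inter> {j # js} \<times> poles M j js = {}"
    using factors_suffix[of "j # js" _ M js] by auto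
  then have "(\<Prod>(ks, k)\<in>factors M (j # js). expo ks s + of_nat k) =
      (\<Prod>(ks, k)\<in>factors M js. expo ks s + of_nat k) * (\<Prod>(ks, k)\<in>{j # js} \<times> poles M j js. expo ks s + of_nat k)"
    using finite_factors[of M js] by (simp add: poles_def prod.union_disjoint del: expo.simps)
  also have "(\<Prod>(ks, k)\<in>{j # js} \<times> poles M j js. expo ks s + of_nat k) = (\<Prod>k\<in>poles M j js. expo (j # js) s + of_nat k)"
    by (subst prod.cartesian_product[symmetric]) simp
  finally show ?case using Cons by (simp del: expo.simps)
qed simp

lemma factors_append: "k \<in> poles M j ks \<Longrightarrow> (j # ks, k) \<in> factors M (pre @ j # ks)"
  by (induction pre) auto

text \<open>Along the line each factor is affine in \<open>z\<close>, hence a nonzero constant or a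
  function with one zero; finitely many zeros keep a distance from \<open>0\<close>, except for
  those at \<open>0\<close> itself.\<close>

lemma factors_nonzero_near:
  assumes "finite S" "\<And>ks k. (ks, k) \<in> S \<Longrightarrow> weight ks v \<noteq> 0 \<or> expo ks p + of_nat k \<noteq> 0"
  obtains e where "e > 0"
    "\<And>z. z \<noteq> 0 \<Longrightarrow> norm z < e \<Longrightarrow> (\<Prod>(ks, k)\<in>S. expo ks (p + z *s v) + of_nat k) \<noteq> 0"
proof -
  define Z where "Z = (\<lambda>(ks, k). - (expo ks p + of_nat k) / weight ks v) ` S"
  have "finite Z" unfolding Z_def using assms(1) by simp
  then obtain d where d: "d > 0" "\<forall>x\<in>Z. x \<noteq> 0 \<longrightarrow> d \<le> dist 0 x"
    using finite_set_avoid[of Z 0] by blast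
  show ?thesis
  proof (rule that[OF d(1)])
    fix z :: complex assume z: "z \<noteq> 0" "norm z < d"
    have "expo ks (p + z *s v) + of_nat k \<noteq> 0" if S: "(ks, k) \<in> S" for ks k
    proof
      assume 0: "expo ks (p + z *s v) + of_nat k = 0"
      then have e: "(expo ks p + of_nat k) + z * weight ks v = 0" by (simp add: expo_line algebra_simps)
      show False
      proof (cases "weight ks v = 0")
        case True
        then show False using e assms(2)[OF S] by simp
      next
        case False
        moreover have "z * weight ks v = - (expo ks p + of_nat k)"
          using e by (simp only: add_eq_0_iff)
        ultimately have "z = - (expo ks p + of_nat k) / weight ks v"
          by (simp only: nonzero_eq_divide_eq not_False_eq_True)
        then have "z \<in> Z" unfolding Z_def using S by (force intro!: image_eqI[of _ _ "(ks, k)"])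
        then show False using d(2) z by auto
      qed
    qed
    then show "(\<Prod>(ks, k)\<in>S. expo ks (p + z *s v) + of_nat k) \<noteq> 0"
      using assms(1) by (auto simp: prod_zero_iff)
  qed
qed

section \<open>Gluing the quotients on the tube domains\<close>

abbreviation "hdom N \<equiv> contdom N indices"

definition denom :: "nat \<Rightarrow> (complex, 'n) vec \<Rightarrow> complex" where
  "denom N = den (N + length indices) indices"

definition numer :: "nat \<Rightarrow> (complex, 'n) vec \<Rightarrow> complex" where
  "numer N = (SOME G. holo_on G (hdom N) \<and>
    (\<forall>s\<in>convdom indices. G s = denom N s * psi indices s 0) \<and>
    (\<forall>s\<in>hdom N. \<forall>k\<le>N. isolated indices s k \<longrightarrow> G s \<noteq> 0))"

lemma numer_properties:
  "holo_on (numer N) (hdom N) \<and>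
    (\<forall>s\<in>convdom indices. numer N s = denom N s * psi indices s 0) \<and>
    (\<forall>s\<in>hdom N. \<forall>k\<le>N. isolated indices s k \<longrightarrow> numer N s \<noteq> 0)"
  using someI_ex[OF continuation_exists[OF indices_props(4), of N]]
  unfolding numer_def denom_def .

lemma holo_numer: "holo_on (numer N) (hdom N)"
  and numer_eq: "s \<in> convdom indices \<Longrightarrow> numer N s = denom N s * psi indices s 0"
  and numer_nonzero: "s \<in> hdom N \<Longrightarrow> k \<le> N \<Longrightarrow> isolated indices s k \<Longrightarrow> numer N s \<noteq> 0"
  using numer_properties by blast+

lemma holo_denom: "holo_on (denom N) U"
  unfolding denom_def by (rule holo_den)

text \<open>Cross-multiplied, the identity involves holomorphic functions only. On
  \<open>convdom\<close> both sides are the same multiple of \<open>psi indices s 0\<close>; since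
  the intersection of two tube domains is convex, the identity spreads from there along
  lines.\<close>

lemma consistent:
  assumes "s \<in> hdom N" "s \<in> hdom N'"
  shows "numer N s * denom N' s = numer N' s * denom N s"
proof -
  obtain p where p: "p \<in> convdom indices" using convdom_nonempty by blast
  let ?f = "\<lambda>s. numer N s * denom N' s - numer N' s * denom N s"
  obtain e where e: "e > 0" "\<And>z. norm z < e \<Longrightarrow> p + z *s (s - p) \<in> convdom indices"
    using open_line_ball[OF open_convdom p] by metis
  have "?f (p + (s - p)) = 0"
  proof (rule holo_zero_along_line[of ?f "hdom N \<inter> hdom N'"])
    show "holo_on ?f (hdom N \<inter> hdom N')"
      by (intro holo_intros holo_denom holo_on_subset[OF holo_numer]) auto
    show "open (hdom N \<inter> hdom N')" by (intro open_Int open_contdom)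
    show "convex (hdom N \<inter> hdom N')" by (intro convex_Int convex_contdom)
    show "p \<in> hdom N \<inter> hdom N'" using p convdom_contdom by blast
    show "?f (p + z *s (s - p)) = 0" if "norm z < e" for z
      using numer_eq[OF e(2)[OF that]] by simp
  qed (use assms e in auto)
  then show ?thesis by simp
qed

text \<open>Where \<open>denom N s\<close> vanishes for every tube domain containing
  \<open>s\<close> the value is arbitrary; such points form a thin set.\<close>

definition cont :: "(complex, 'n) vec \<Rightarrow> complex" where
  "cont s = (let N = (SOME N. s \<in> hdom N \<and> denom N s \<noteq> 0) in numer N s / denom N s)"

lemma cont_eq: "s \<in> hdom N \<Longrightarrow> denom N s \<noteq> 0 \<Longrightarrow> cont s = numer N s / denom N s"
proof -
  assume s: "s \<in> hdom N" "denom N s \<noteq> 0"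
  define N' where "N' = (SOME N. s \<in> hdom N \<and> denom N s \<noteq> 0)"
  have N': "s \<in> hdom N'" "denom N' s \<noteq> 0"
    using someI[of "\<lambda>N. s \<in> hdom N \<and> denom N s \<noteq> 0" N] s unfolding N'_def by auto
  have "cont s = numer N' s / denom N' s" unfolding cont_def Let_def N'_def ..
  also have "\<dots> = numer N s / denom N s"
    using consistent[OF s(1) N'(1)] s N' by (simp add: frac_eq_eq)
  finally show ?thesis .
qed

lemma cont_eq_mzeta: "s \<in> abs_conv_region \<xi> \<gamma> \<Longrightarrow> cont s = mzeta \<xi> \<gamma> s"
proof -
  assume s: "s \<in> abs_conv_region \<xi> \<gamma>"
  then have c: "s \<in> convdom indices" using abs_conv_region_subset by blast
  then have d: "denom 0 s \<noteq> 0" unfolding denom_def by (rule den_nonzero)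
  have "s \<in> hdom 0" using c convdom_contdom by blast
  from cont_eq[OF this d] show ?thesis using numer_eq[OF c] d mzeta_eq_psi[OF s] by simp
qed

lemma mero_cont: "mero_on cont UNIV"
  unfolding mero_on_def
proof
  fix p :: "(complex, 'n) vec"
  obtain N where N: "p \<in> hdom N" using ex_contdom by blast
  obtain q where q: "q \<in> convdom indices" using convdom_nonempty by blast
  show "\<exists>U g h. open U \<and> connected U \<and> p \<in> U \<and> U \<subseteq> UNIV \<and> holo_on g U \<and> holo_on h U \<and>
        (\<exists>z\<in>U. h z \<noteq> 0) \<and> (\<forall>z\<in>U. h z \<noteq> 0 \<longrightarrow> cont z = g z / h z)"
  proof (intro exI conjI)
    show "open (hdom N)" by (rule open_contdom)
    show "connected (hdom N)" by (rule convex_connected[OF convex_contdom])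
    show "holo_on (numer N) (hdom N)" by (rule holo_numer)
    show "holo_on (denom N) (hdom N)" by (rule holo_denom)
    show "\<exists>z\<in>hdom N. denom N z \<noteq> 0"
      using q convdom_contdom den_nonzero[OF q] unfolding denom_def by blast
    show "\<forall>z\<in>hdom N. denom N z \<noteq> 0 \<longrightarrow> cont z = numer N z / denom N z" using cont_eq by blast
  qed (use N in auto)
qed

lemma denom_nonzero_dense:
  assumes "open U" "p \<in> U" shows "p \<in> closure {z \<in> U. denom N z \<noteq> 0}"
proof -
  \<comment> \<open>In this direction the form of each nonempty suffix changes at the rate given by
    its length, so the line is transversal to all hyperplanes at once.\<close>
  define v :: "(complex, 'n) vec" where "v = (\<chi> i. 1)"
  have w: "weight ks v = of_nat (length ks)" for ks
    unfolding weight_def v_def by (induction ks) auto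
  obtain e where e: "e > 0" "\<And>z. z \<noteq> 0 \<Longrightarrow> norm z < e \<Longrightarrow> denom N (p + z *s v) \<noteq> 0"
  proof (rule factors_nonzero_near[of "factors (N + length indices) indices" v p])
    show "weight ks v \<noteq> 0 \<or> expo ks p + of_nat k \<noteq> 0"
      if "(ks, k) \<in> factors (N + length indices) indices" for ks k
      using factors_suffix[OF that] by (simp add: w)
  qed (use that finite_factors in \<open>auto simp: denom_def den_factors\<close>)
  obtain d where d: "d > 0" "\<And>z. norm z < d \<Longrightarrow> p + z *s v \<in> U"
    using open_line_ball[OF assms] by metis
  show ?thesis
    by (rule closure_line[of "min d e" _ v]) (use d e in auto)
qed

lemma cont_regular: "p \<in> hdom N \<Longrightarrow> denom N p \<noteq> 0 \<Longrightarrow> p \<notin> singular_set cont"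
proof (rule notin_singular_set)
  assume p: "p \<in> hdom N" "denom N p \<noteq> 0"
  let ?U = "hdom N \<inter> {s. denom N s \<noteq> 0}"
  show "open ?U"
    by (intro open_Int open_contdom open_Collect_neq continuous_on_const holo_on_continuous holo_denom)
  show "p \<in> ?U" using p by simp
  show "holo_on (\<lambda>s. numer N s / denom N s) ?U"
    by (intro holo_on_divide holo_on_subset[OF holo_numer] holo_denom) auto
  have "{z \<in> ?U. cont z = numer N z / denom N z} = ?U" using cont_eq by auto
  then show "?U \<subseteq> closure {z \<in> ?U. cont z = numer N z / denom N z}"
    by (simp only: closure_subset)
qed

text \<open>Agreement of \<open>cont\<close> and \<open>g\<close> is known on a dense subset only.
  If the identity failed at \<open>z\<close>, it would fail on an open set; this has an open
  nonempty part where \<open>denom N\<close> is nonzero, and a point of agreement in that part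
  contradicts \<open>cont_eq\<close>.\<close>

lemma numer_eq_on_regular:
  assumes U: "open U" "holo_on g U" "U \<subseteq> closure {z \<in> U. cont z = g z}"
    and z: "z \<in> U" "z \<in> hdom N"
  shows "numer N z = g z * denom N z"
proof (rule ccontr)
  assume ne: "numer N z \<noteq> g z * denom N z"
  let ?V = "U \<inter> hdom N"
  have V: "open ?V" using U(1) open_contdom by blast
  define W where "W = (\<lambda>s. numer N s - g s * denom N s) -` (- {0}) \<inter> ?V"
  have "holo_on (\<lambda>s. numer N s - g s * denom N s) ?V"
    by (intro holo_intros holo_denom holo_on_subset[OF holo_numer] holo_on_subset[OF U(2)]) auto
  from holo_on_continuous[OF this] have W: "open W"
    unfolding W_def using continuous_on_open_vimage[OF V] by blast
  have "z \<in> W" using ne z by (simp add: W_def)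
  then have "z \<in> closure {s \<in> W. denom N s \<noteq> 0}" by (rule denom_nonzero_dense[OF W])
  then obtain y where y: "y \<in> W" "denom N y \<noteq> 0" by (metis (mono_tags, lifting) closure_empty emptyE mem_Collect_eq equals0I)
  define W' where "W' = W \<inter> {s. denom N s \<noteq> 0}"
  have W': "open W'"
    unfolding W'_def
    by (intro open_Int W open_Collect_neq continuous_on_const holo_on_continuous holo_denom)
  have "y \<in> closure {z \<in> U. cont z = g z}" using y U(3) by (auto simp: W_def)
  then obtain x where x: "x \<in> W'" "x \<in> U" "cont x = g x"
    using W' y open_Int_closure_eq_empty[of W' "{z \<in> U. cont z = g z}"] by (auto simp: W'_def)
  then have "x \<in> hdom N" "denom N x \<noteq> 0" "numer N x - g x * denom N x \<noteq> 0" by (auto simp: W'_def W_def)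
  then show False using cont_eq[of x N] x(3) by (simp add: field_simps)
qed

section \<open>Singular hyperplanes\<close>

lemma expo_linear:
  assumes "distinct ks"
  shows "expo ks s = (\<Sum>i\<in>UNIV. (\<chi> i. if i \<in> set ks then 1 else 0) $ i * s $ i) - (\<Sum>j\<leftarrow>ks. of_nat (eps (\<xi> $ j)))"
proof -
  have "expo ks s = (\<Sum>j\<leftarrow>ks. s $ j) - (\<Sum>j\<leftarrow>ks. of_nat (eps (\<xi> $ j)))"
    by (induction ks) auto
  also have "(\<Sum>j\<leftarrow>ks. s $ j) = (\<Sum>i\<in>set ks. s $ i)"
    using assms by (rule sum_list_distinct_conv_sum_set)
  also have "\<dots> = (\<Sum>i\<in>UNIV. (\<chi> i. if i \<in> set ks then 1 else 0) $ i * s $ i)"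
    by (rule sum.mono_neutral_cong_left) auto
  finally show ?thesis .
qed

text \<open>The point \<open>q\<close> decides the whole hyperplane \<open>H\<close>. A holomorphic
  \<open>g\<close> near \<open>p\<close> in \<open>H\<close> would give
  \<open>numer N = g * denom N\<close> there, hence zeros of \<open>numer N\<close> on
  \<open>H\<close> near \<open>p\<close>; the line from \<open>p\<close> to \<open>q\<close> lies in
  \<open>H\<close> and carries them to \<open>q\<close>. The order is one because the linear form
  occurs once in the denominator and the other factors are nonzero on a dense part of
  \<open>H\<close>.\<close>

lemma simple_hyperplane:
  assumes ind: "indices = pre @ j # ks" and k: "\<And>M. k \<le> M \<Longrightarrow> k \<in> poles M j ks"
    and q: "isolated indices q k" "expo (j # ks) q = - of_nat k"
  shows "simple_singular_hyperplane cont {s. expo (j # ks) s = - of_nat k}"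
proof -
  define H where "H = {s. expo (j # ks) s = - of_nat k}"
  define a :: "(complex, 'n) vec" where "a = (\<chi> i. if i \<in> set (j # ks) then 1 else 0)"
  define c where "c = (\<Sum>j\<leftarrow>j # ks. of_nat (eps (\<xi> $ j))) - (of_nat k :: complex)"
  have dist: "distinct (pre @ j # ks)" using indices_props(2) ind by simp
  have L: "(\<Sum>i\<in>UNIV. a $ i * s $ i) - c = expo (j # ks) s + of_nat k" for s
    using expo_linear[of "j # ks" s] dist unfolding a_def c_def by simp
  have "a $ j = 1" by (simp add: a_def)
  then have a: "a \<noteq> 0" by auto
  have H: "H = {s. (\<Sum>i\<in>UNIV. a $ i * s $ i) = c}"
    unfolding H_def eq_neg_iff_add_eq_0 L[symmetric] right_minus_eq ..
  have fac: "(j # ks, k) \<in> factors (N + length indices) indices" if "k \<le> N" for N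
    unfolding ind by (rule factors_append, rule k) (use that in simp)
  define E where "E N s = (\<Prod>(ls, l)\<in>factors (N + length indices) indices - {(j # ks, k)}. expo ls s + of_nat l)" for N s
  have denE: "denom N s = (expo (j # ks) s + of_nat k) * E N s" if "k \<le> N" for N s
    unfolding denom_def den_factors E_def by (subst prod.remove[OF finite_factors fac[OF that]]) simp
  have "H \<subseteq> singular_set cont"
  proof
    fix p assume p: "p \<in> H"
    show "p \<in> singular_set cont"
    proof (rule ccontr)
      assume "p \<notin> singular_set cont"
      then obtain U g where U: "open U" "p \<in> U" "holo_on g U" "U \<subseteq> closure {z \<in> U. cont z = g z}"
        unfolding singular_set_def by blast
      obtain N1 N2 where "p \<in> hdom N1" "q \<in> hdom N2" using ex_contdom by blast
      \<comment> \<open>One tube domain has to contain both points, and the factor number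
        \<open>k\<close> has to occur in \<open>denom N\<close>.\<close>
      define N where "N = max k (max N1 N2)"
      have N: "p \<in> hdom N" "q \<in> hdom N" "k \<le> N"
        using subsetD[OF contdom_mono \<open>p \<in> hdom N1\<close>, of N] subsetD[OF contdom_mono \<open>q \<in> hdom N2\<close>, of N]
        unfolding N_def by linarith+
      obtain e where e: "e > 0" "\<And>z. norm z < e \<Longrightarrow> p + z *s (q - p) \<in> U"
        using open_line_ball[OF U(1,2)] by metis
      have w: "weight (j # ks) (q - p) = 0"
        using expo_line[of "j # ks" p 1 "q - p"] q(2) p by (simp add: H_def del: expo.simps)
      have "numer N (p + (q - p)) = 0"
      proof (rule holo_zero_along_line[OF holo_numer[of N] open_contdom convex_contdom])
        show "numer N (p + z *s (q - p)) = 0" if "norm z < e" "p + z *s (q - p) \<in> hdom N" for z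
        proof -
          have "expo (j # ks) (p + z *s (q - p)) + of_nat k = 0"
            using p unfolding expo_line w by (simp add: H_def del: expo.simps)
          then have "denom N (p + z *s (q - p)) = 0" using denE[OF N(3)] by simp
          then show ?thesis
            using numer_eq_on_regular[OF U(1,3,4) e(2)[OF that(1)] that(2)] by simp
        qed
      qed (use N e in auto)
      then show False using numer_nonzero[OF N(2,3) q(1)] by simp
    qed
  qed
  moreover have "H \<subseteq> closure (H - singular_set (\<lambda>s. ((\<Sum>i\<in>UNIV. a $ i * s $ i) - c) * cont s))"
  proof
    fix p assume p: "p \<in> H"
    obtain N1 where "p \<in> hdom N1" using ex_contdom by blast
    define N where "N = max k N1"
    have N: "p \<in> hdom N" "k \<le> N"
      using subsetD[OF contdom_mono \<open>p \<in> hdom N1\<close>, of N] unfolding N_def by linarith+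
    \<comment> \<open>A direction in which the form of \<open>j # ks\<close> is constant and that of
      every other suffix is not: \<open>v $ j\<close> balances the entries 1 of \<open>ks\<close>, a
      shorter suffix omits \<open>j\<close>, and a longer one has additional entries 1.\<close>
    define v :: "(complex, 'n) vec" where "v = (\<chi> i. if i = j then - of_nat (length ks) else 1)"
    have w0: "weight ls v = of_nat (length ls)" if "j \<notin> set ls" for ls
      unfolding weight_def v_def using that by (induction ls) auto
    have w1: "weight (j # ks) v = 0"
      using w0[of ks] dist by (simp add: weight_def v_def)
    have w2: "weight ls v \<noteq> 0" if f: "(ls, l) \<in> factors (N + length indices) indices" "ls \<noteq> j # ks" for ls l
    proof -
      obtain pre' where ls: "ls \<noteq> []" "pre @ j # ks = pre' @ ls" using factors_suffix[OF f(1)] ind by auto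
      then consider us where "pre = pre' @ us" "us @ j # ks = ls" | us where "pre @ us = pre'" "j # ks = us @ ls"
        by (auto simp: append_eq_append_conv2)
      then show ?thesis
      proof cases
        case 1
        have "weight ls v = weight us v + weight (j # ks) v" using 1 by (auto simp: weight_def)
        moreover have "us \<noteq> []" using 1 f(2) by auto
        moreover have "j \<notin> set us" using dist 1 by auto
        ultimately show ?thesis using w0[of us] w1 by simp
      next
        case 2
        have "us \<noteq> []" using 2 f(2) by auto
        then have "set ls \<subseteq> set ks" using 2 by (cases us) auto
        moreover have "j \<notin> set ks" using dist by simp
        ultimately have "j \<notin> set ls" by blast
        then show ?thesis using w0[of ls] ls(1) by simp
      qed
    qed
    obtain e where e: "e > 0" "\<And>z. z \<noteq> 0 \<Longrightarrow> norm z < e \<Longrightarrow> E N (p + z *s v) \<noteq> 0"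
    proof (rule factors_nonzero_near[of "factors (N + length indices) indices - {(j # ks, k)}" v p])
      show "weight ls v \<noteq> 0 \<or> expo ls p + of_nat l \<noteq> 0"
        if "(ls, l) \<in> factors (N + length indices) indices - {(j # ks, k)}" for ls l
      proof (cases "ls = j # ks")
        case True
        then show ?thesis using p that by (auto simp: H_def simp del: expo.simps)
      qed (use w2 that in blast)
    qed (use that finite_factors in \<open>auto simp: E_def\<close>)
    obtain d where d: "d > 0" "\<And>z. norm z < d \<Longrightarrow> p + z *s v \<in> hdom N"
      using open_line_ball[OF open_contdom N(1)] by metis
    show "p \<in> closure (H - singular_set (\<lambda>s. ((\<Sum>i\<in>UNIV. a $ i * s $ i) - c) * cont s))"
    proof (rule closure_line[of "min d e" _ v])
      fix t :: real assume t: "0 < t" "t < min d e"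
      define s where "s = p + of_real t *s v"
      have s: "s \<in> hdom N" "E N s \<noteq> 0" using t d(2) e(2) by (auto simp: s_def)
      have "s \<in> H" using p unfolding H_def s_def by (simp add: expo_line w1 del: expo.simps)
      moreover have "s \<notin> singular_set (\<lambda>s. ((\<Sum>i\<in>UNIV. a $ i * s $ i) - c) * cont s)"
      proof (rule notin_singular_set)
        let ?U = "hdom N \<inter> {s. E N s \<noteq> 0}"
        have hE: "holo_on (E N) V" for V
          unfolding E_def[abs_def] case_prod_unfold by (intro holo_intros holo_expo)
        show U: "open ?U"
          by (intro open_Int open_contdom open_Collect_neq continuous_on_const holo_on_continuous hE)
        show "s \<in> ?U" using s by simp
        show "holo_on (\<lambda>s. numer N s / E N s) ?U"
          by (intro holo_on_divide holo_on_subset[OF holo_numer] hE) auto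
        have "(expo (j # ks) z + of_nat k) * cont z = numer N z / E N z"
          if "z \<in> ?U" "denom N z \<noteq> 0" for z
          using cont_eq[of z N] denE[OF N(2), of z] that by (simp del: expo.simps)
        then have "{z \<in> ?U. denom N z \<noteq> 0} \<subseteq> {z \<in> ?U. ((\<Sum>i\<in>UNIV. a $ i * z $ i) - c) * cont z = numer N z / E N z}"
          unfolding L by blast
        then show "?U \<subseteq> closure {z \<in> ?U. ((\<Sum>i\<in>UNIV. a $ i * z $ i) - c) * cont z = numer N z / E N z}"
          using denom_nonzero_dense[OF U] closure_mono by blast
      qed
      ultimately show "p + of_real t *s v \<in> H - singular_set (\<lambda>s. ((\<Sum>i\<in>UNIV. a $ i * s $ i) - c) * cont s)"
        unfolding s_def by blast
    qed (use d e in auto)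
  qed
  ultimately show ?thesis
    unfolding simple_singular_hyperplane_def H_def[symmetric]
    by (intro exI[of _ a] exI[of _ c] conjI a H)
qed

section \<open>The cases according to which twists equal 1\<close>

lemma factors_empty: "(\<And>i. i \<in> set js \<Longrightarrow> \<xi> $ i \<noteq> 1) \<Longrightarrow> factors M js = {}"
  by (induction js) (auto simp: poles_def)

lemma factors_prefix:
  "(\<And>i. i \<in> set pre \<Longrightarrow> \<xi> $ i \<noteq> 1) \<Longrightarrow> factors M (pre @ js) = factors M js"
  by (induction pre) (auto simp: poles_def)

lemma isolated_prefix:
  "isolated js s k \<Longrightarrow> (\<And>i. i \<in> set pre \<Longrightarrow> s $ i = of_nat (eps (\<xi> $ i))) \<Longrightarrow> isolated (pre @ js) s k"
  by (induction pre) auto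

lemma holo_cont: "(\<And>j. \<xi> $ j \<noteq> 1) \<Longrightarrow> holo_on cont UNIV"
proof -
  assume "\<And>j. \<xi> $ j \<noteq> 1"
  then have d: "denom N s = 1" for N s by (simp add: denom_def den_factors factors_empty)
  have "holo_on cont (hdom N)" for N
    by (rule holo_on_cong[OF _ holo_numer]) (simp add: cont_eq d)
  then have "holo_on cont (\<Union>N\<in>UNIV. hdom N)" by (intro holo_on_Union open_contdom)
  moreover have "(\<Union>N\<in>UNIV. hdom N) = UNIV" using ex_contdom by auto
  ultimately show ?thesis by simp
qed

lemma indices_split: obtains pre ks where "indices = pre @ j # ks"
  "\<And>i. i \<in> set pre \<Longrightarrow> i < j" "\<And>i. i \<in> set ks \<Longrightarrow> j < i" "ks = [] \<longleftrightarrow> j = last_index"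
proof -
  obtain pre ks where i: "indices = pre @ j # ks" using split_list[of j indices] indices_props(3) by auto
  have s: "\<And>i. i \<in> set pre \<Longrightarrow> i < j" "\<And>i. i \<in> set ks \<Longrightarrow> j < i"
    using indices_props(1) unfolding i by (auto simp: sorted_wrt_append)
  have le: "i \<le> last_index" for i :: 'n unfolding last_index_def by simp
  have "last_index \<in> set (pre @ j # ks)" using indices_props(3) i by auto
  then have "ks = [] \<longleftrightarrow> j = last_index"
    using s le[of j] le[of "hd ks"] by (cases ks) (auto dest: leD)
  then show ?thesis using that i s by blast
qed

text \<open>The denominator is the single factor \<open>s $ last_index - 1\<close>. Any other
  candidate hyperplane would lie in the singular set, and a hyperplane contained in another one
  equals it.\<close>

lemma last_pole:
  assumes "\<And>j. j < last_index \<Longrightarrow> \<xi> $ j \<noteq> 1" "\<xi> $ last_index = 1"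
  shows "singular_set cont = {s. s $ last_index = 1}"
    and "{H. simple_singular_hyperplane cont H} = {{s. s $ last_index = 1}}"
proof -
  let ?l = "last_index :: 'n"
  let ?H = "{s :: (complex, 'n) vec. s $ last_index = 1}"
  obtain pre where i: "indices = pre @ [?l]" and pre: "\<And>i. i \<in> set pre \<Longrightarrow> i < ?l"
    using indices_split[of ?l] by metis
  have e: "eps (\<xi> $ ?l) = 1" using assms(2) by (simp add: eps_def)
  have H: "{s. expo [?l] s = - of_nat 0} = ?H" by (simp add: e)
  \<comment> \<open>At this point \<open>expo\<close> is \<open>0\<close> for every suffix, and each
    expansion is a nonzero constant.\<close>
  define q :: "(complex, 'n) vec" where "q = (\<chi> i. of_nat (eps (\<xi> $ i)))"
  have "simple_singular_hyperplane cont {s. expo [?l] s = - of_nat 0}"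
  proof (rule simple_hyperplane[OF i])
    show "isolated indices q 0" unfolding i by (rule isolated_prefix) (auto simp: q_def)
    show "expo [?l] q = - of_nat 0" by (simp add: q_def)
  qed (use assms(2) in \<open>simp add: poles_def\<close>)
  then have ssh: "simple_singular_hyperplane cont ?H" unfolding H .
  have "p \<notin> singular_set cont" if "p $ ?l \<noteq> 1" for p
  proof -
    obtain N where N: "p \<in> hdom N" using ex_contdom by blast
    have "factors M indices = {([?l], 0)}" for M
      unfolding i using factors_prefix[of pre M "[?l]"] pre assms by (simp add: poles_def)
    then have "denom N p \<noteq> 0" using that by (simp add: denom_def den_factors e)
    then show ?thesis by (rule cont_regular[OF N])
  qed
  moreover have "?H \<subseteq> singular_set cont" using ssh unfolding simple_singular_hyperplane_def by blast
  ultimately show sing: "singular_set cont = ?H" by blast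
  have "H' = ?H" if "simple_singular_hyperplane cont H'" for H'
  proof -
    obtain a c where a: "a \<noteq> 0" "H' = {s. (\<Sum>j\<in>UNIV. a $ j * s $ j) = c}" "H' \<subseteq> ?H"
      using \<open>simple_singular_hyperplane cont H'\<close> unfolding simple_singular_hyperplane_def sing by blast
    have ax: "(\<Sum>j\<in>UNIV. a $ j * axis i z $ j) = a $ i * z" for i z
    proof -
      have "(\<Sum>j\<in>UNIV. a $ j * axis i z $ j) = (\<Sum>j\<in>UNIV. if j = i then a $ i * z else 0)"
        by (intro sum.cong) (auto simp: axis_def)
      then show ?thesis by simp
    qed
    \<comment> \<open>Otherwise \<open>H'\<close> would contain a point of the coordinate axis
      \<open>i\<close>, whose last coordinate is \<open>0\<close> and not 1.\<close>
    have z: "a $ i = 0" if "i \<noteq> ?l" for i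
    proof (rule ccontr)
      assume "a $ i \<noteq> 0"
      then have "axis i (c / a $ i) \<in> H'" unfolding a(2) by (simp add: ax)
      then have "axis i (c / a $ i) $ ?l = 1" using a(3) by blast
      then show False using that by (simp add: axis_def)
    qed
    then have al: "a $ ?l \<noteq> 0" using a(1) by (metis vec_eq_iff zero_index)
    have "(\<Sum>j\<in>UNIV. a $ j * s $ j) = a $ ?l * s $ ?l" for s
    proof -
      have "(\<Sum>j\<in>UNIV. a $ j * s $ j) = (\<Sum>j\<in>{?l}. a $ j * s $ j)"
        by (rule sum.mono_neutral_right) (use z in auto)
      then show ?thesis by simp
    qed
    moreover have "axis ?l (c / a $ ?l) \<in> H'" unfolding a(2) using al by (simp add: ax)
    then have "axis ?l (c / a $ ?l) $ ?l = 1" using a(3) by blast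
    then have "c = a $ ?l" using al by (simp add: axis_def)
    ultimately show ?thesis unfolding a(2) using al by auto
  qed
  then show "{H. simple_singular_hyperplane cont H} = {?H}" using ssh by blast
qed

text \<open>With \<open>l\<close> the index following \<open>j\<close>, the hyperplane number
  \<open>k\<close> is reached when \<open>lam (\<xi> $ l) k \<noteq> 0\<close>. For
  \<open>\<xi> $ l = 1\<close> the odd \<open>k \<ge> 3\<close> are excluded, as the Bernoulli
  numbers vanish there; so infinitude depends on \<open>infinite_lam_nonzero\<close>.\<close>

lemma infinitely_many_poles:
  assumes "j < last_index" "\<xi> $ j = 1"
  shows "infinite {H. simple_singular_hyperplane cont H}"
proof -
  obtain pre ks where i: "indices = pre @ j # ks" and pre: "\<And>i. i \<in> set pre \<Longrightarrow> i < j"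
    and ks: "\<And>i. i \<in> set ks \<Longrightarrow> j < i" "ks \<noteq> []"
    using indices_split[of j] assms(1) by (metis less_irrefl)
  obtain l ls where l: "ks = l # ls" using ks(2) by (cases ks) auto
  have d: "l \<notin> set ls" "j \<noteq> l" "j \<notin> set ls" "l \<notin> set pre" "j \<notin> set pre"
    using indices_props(2) unfolding i l by auto
  define H where "H k = {s. expo (j # ks) s = - of_nat k}" for k
  have "simple_singular_hyperplane cont (H k)" if k: "lam (\<xi> $ l) k \<noteq> 0" for k
  proof -
    \<comment> \<open>Moving \<open>s $ l\<close> by \<open>1 / 2\<close> makes the list from
      \<open>l\<close> on \<open>generic\<close>; the change of \<open>s $ j\<close> then brings
      \<open>expo (j # ks) q\<close> to \<open>- of_nat k\<close>, and the unchanged earlier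
      coordinates preserve \<open>isolated\<close>.\<close>
    define q :: "(complex, 'n) vec" where
      "q = (\<chi> i. of_nat (eps (\<xi> $ i)) + (if i = l then 1 / 2 else if i = j then - of_nat k - 1 / 2 else 0))"
    have "isolated (ls @ []) q 0"
      by (rule isolated_prefix) (use d in \<open>auto simp: q_def\<close>)
    then have ls: "isolated ls q 0" by simp
    then have g: "generic ks q k" using k by (simp add: l q_def)
    have "expo ls q = 0" using isolated_expo[OF ls] by simp
    then have e: "expo (j # ks) q = - of_nat k" using d(2) by (simp add: l q_def)
    have "isolated (j # ks) q k" using assms(2) e g by (simp del: expo.simps)
    then have "isolated indices q k"
      unfolding i by (rule isolated_prefix) (use d in \<open>auto simp: q_def\<close>)
    then show ?thesis
      unfolding H_def using e assms(2) ks(2)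
      by (intro simple_hyperplane[OF i]) (auto simp: poles_def simp del: expo.simps)
  qed
  then have sub: "H ` {k. lam (\<xi> $ l) k \<noteq> 0} \<subseteq> {H. simple_singular_hyperplane cont H}" by blast
  have "inj H"
  proof (rule injI)
    fix k k' assume *: "H k = H k'"
    \<comment> \<open>A point of \<open>H k\<close>, found by varying the coordinate
      \<open>j\<close> alone; \<open>expo\<close> separates it from all other
      \<open>H k'\<close>.\<close>
    define s where "s = (axis j (- of_nat k - expo (j # ks) 0) :: (complex, 'n) vec)"
    have "expo (j # ks) s = expo (j # ks) (0 + (- of_nat k - expo (j # ks) 0) *s axis j 1)"
      unfolding s_def by (rule arg_cong[where f = "expo (j # ks)"]) (auto simp: vec_eq_iff axis_def)
    also have "\<dots> = expo (j # ks) 0 + (- of_nat k - expo (j # ks) 0) * weight (j # ks) (axis j 1)"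
      by (rule expo_line)
    also have "weight (j # ks) (axis j 1) = 1"
    proof -
      have "weight us (axis j 1) = 0" if "j \<notin> set us" for us
        unfolding weight_def using that by (induction us) (auto simp: axis_def)
      moreover have "j \<notin> set ks" using ks(1) by blast
      ultimately show ?thesis by (simp add: weight_def axis_def)
    qed
    finally have "s \<in> H k" by (simp add: H_def del: expo.simps)
    then have "s \<in> H k'" using * by simp
    then show "k = k'" using \<open>s \<in> H k\<close> by (simp add: H_def del: expo.simps)
  qed
  moreover have "infinite {k. lam (\<xi> $ l) k \<noteq> 0}"
    using infinite_lam_nonzero[of "\<xi> $ l"] \<xi>[of l] by force
  ultimately have "infinite (H ` {k. lam (\<xi> $ l) k \<noteq> 0})"
    using finite_imageD[OF _ inj_on_subset[OF _ subset_UNIV]] by blast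
  then show ?thesis using sub finite_subset by blast
qed

end

theorem theorem1p1:
  fixes \<xi> \<gamma> :: "complex ^ 'n::{finite,linorder}"
  assumes "\<And>j. norm (\<xi> $ j) = 1" and "\<And>j. Re (\<gamma> $ j) > 0"
  shows "\<exists>F :: complex ^ 'n::{finite,linorder} \<Rightarrow> complex.
    mero_on F UNIV \<and>
    (\<forall>s\<in>abs_conv_region \<xi> \<gamma>. F s = mzeta \<xi> \<gamma> s) \<and>
    ((\<forall>j. \<xi> $ j \<noteq> 1) \<longrightarrow> holo_on F UNIV) \<and>
    ((\<forall>j<last_index. \<xi> $ j \<noteq> 1) \<and> \<xi> $ last_index = 1 \<longrightarrow>
       singular_set F = {s. s $ last_index = 1} \<and>
       {H. simple_singular_hyperplane F H} = {{s. s $ last_index = 1}}) \<and>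
    ((\<exists>j<last_index. \<xi> $ j = 1) \<longrightarrow>
       infinite {H. simple_singular_hyperplane F H})"
proof -
  \<comment> \<open>The smallest real part and the largest slope of the finitely many
    \<open>\<gamma> $ j\<close> determine one sector containing them all.\<close>
  define \<delta> where "\<delta> = Min (range (\<lambda>j. Re (\<gamma> $ j)))"
  define T where "T = Max (range (\<lambda>j. \<bar>Im (\<gamma> $ j)\<bar> / Re (\<gamma> $ j)))"
  have \<delta>: "\<delta> \<le> Re (\<gamma> $ j)" for j unfolding \<delta>_def by (intro Min_le) auto
  have T: "\<bar>Im (\<gamma> $ j)\<bar> / Re (\<gamma> $ j) \<le> T" for j unfolding T_def by (intro Max_ge) auto
  have "\<delta> \<in> range (\<lambda>j. Re (\<gamma> $ j))" unfolding \<delta>_def by (intro Min_in) auto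
  then have "0 < \<delta>" using assms(2) by auto
  moreover have "0 \<le> T" using order_trans[OF _ T] assms(2) by (simp add: less_imp_le)
  ultimately interpret sector \<delta> T by unfold_locales
  interpret zeta_data \<delta> T \<xi> \<gamma>
    using assms(1) \<delta> T assms(2) by unfold_locales (auto simp: sec_def divide_le_eq)
  show ?thesis
  proof (intro exI[of _ cont] conjI ballI impI)
    show "infinite {H. simple_singular_hyperplane cont H}" if "\<exists>j<last_index. \<xi> $ j = 1"
      using that infinitely_many_poles by blast
  qed (use mero_cont cont_eq_mzeta holo_cont last_pole in simp_all)
qed

end
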